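(* Let $\alpha\in(0,1)$ and $p\in(4/3,2)$ satisfy $\alpha p<2(p-1)$, let $p'$ be the conjugate exponent, $\frac1p+\frac1{p'}=1$, and put $s_0=\alpha p'/2$. There is a constant $C$ depending only on $\alpha,p$ such that the following holds. Let $T>0$ and let $V\in L^\infty(\mathbb{T}\times[0,T])$ be complex-valued, with $\|V\|_\infty=\|V\|_{L^\infty(\mathbb{T}\times[0,T])}$. For $k\in\mathbb{R}$ let $u(x,t,k)$ solve $$iu_t=(k\,\partial_{xx}^2+V)u,\qquad u(x,0,k)=1,\qquad x\in\mathbb{T}.$$ Then there is a measurable function $U_1:\mathbb{R}\to[0,\infty]$ with $$\|U_1\|_{L^{p'}(\mathbb{R})}\le C\,T^{1-1/p'}\|V\|_\infty$$ such that for $k\in\mathbb{R}$ $$\sup_{0<t<T}\log\bigl(1+\|u(\cdot,t,k)\|_{H^\alpha(\mathbb{T})}\bigr)\le C\Bigl(1+(T\|V\|_\infty)^{1+s_0}+(T\|V\|_\infty)^{1-s_0^2}\,U_1(k)^{s_0(1+s_0)}\Bigr).$$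
   Context: $\mathbb{T}$ is the one-dimensional torus with normalized measure, $\widehat f_n$ ($n\in\mathbb{Z}$) are Fourier coefficients, and $\|f\|_{H^\alpha(\mathbb{T})}^2=\sum_n(1+|n|)^{2\alpha}|\widehat f_n|^2$. Solutions are understood in the sense of Duhamel's formula in $L^2(\mathbb{T})$ (mild solutions). *)

theory Defs
  imports "HOL-Probability.Essential_Supremum"
begin

text \<open>
  The torus \<open>\<real> / 2\<pi>\<int>\<close> is represented by its fundamental domain \<open>[0, 2\<pi>)\<close> with normalized
  Lebesgue measure. The exponentials \<open>exp (\<i> n x)\<close> are an orthonormal basis of its \<open>L\<^sup>2\<close> space, and
  the second derivative acts on the \<open>n\<close>-th one as multiplication by \<open>- n\<^sup>2\<close>. Elements of \<open>L\<^sup>2\<close> and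
  \<open>L\<^sup>\<infinity>\<close> are given by Borel representatives; everything below is invariant under changes of
  a representative on null sets.
\<close>

definition torus :: "real measure" where
  "torus = scale_measure (ennreal (1 / (2 * pi))) (restrict_space lborel {0..<2 * pi})"

definition time_interval :: "real \<Rightarrow> real measure" where
  "time_interval T = restrict_space lborel {0..T}"

definition L2_torus :: "(real \<Rightarrow> complex) set" where
  "L2_torus = {f \<in> borel_measurable torus. integrable torus (\<lambda>x. (cmod (f x))\<^sup>2)}"

definition L2_norm :: "(real \<Rightarrow> complex) \<Rightarrow> real" where
  "L2_norm f = sqrt (LINT x|torus. (cmod (f x))\<^sup>2)"

definition L2_inner :: "(real \<Rightarrow> complex) \<Rightarrow> (real \<Rightarrow> complex) \<Rightarrow> complex" where
  "L2_inner f g = (LINT x|torus. f x * cnj (g x))"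

definition fourier_coeff :: "(real \<Rightarrow> complex) \<Rightarrow> int \<Rightarrow> complex" where
  "fourier_coeff f n = (LINT x|torus. f x * exp (- (\<i> * of_int n * complex_of_real x)))"

text \<open>Real powers on \<open>[0, \<infinity>]\<close>; to be used for exponents \<open>a > 0\<close> only.\<close>

definition ennreal_powr :: "ennreal \<Rightarrow> real \<Rightarrow> ennreal" where
  "ennreal_powr x a = (if x = \<infinity> then \<infinity> else ennreal (enn2real x powr a))"

definition log1p :: "ennreal \<Rightarrow> ennreal" where
  "log1p x = (if x = \<infinity> then \<infinity> else ennreal (ln (1 + enn2real x)))"

text \<open>The norm is \<open>\<infinity>\<close> for elements of \<open>L2_torus\<close> outside of the Sobolev space.\<close>

definition sobolev_norm :: "real \<Rightarrow> (real \<Rightarrow> complex) \<Rightarrow> ennreal" where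
  "sobolev_norm \<alpha> f = ennreal_powr
     (\<Sum>\<^sub>\<infinity>n\<in>UNIV. ennreal ((1 + \<bar>real_of_int n\<bar>) powr (2 * \<alpha>) * (cmod (fourier_coeff f n))\<^sup>2)) (1 / 2)"

definition Lp_norm :: "real \<Rightarrow> (real \<Rightarrow> ennreal) \<Rightarrow> ennreal" where
  "Lp_norm q U = ennreal_powr (\<integral>\<^sup>+ k. ennreal_powr (U k) q \<partial>lborel) (1 / q)"

text \<open>Potentials are functions of \<open>(x, t)\<close>.\<close>

definition Linf_norm :: "real \<Rightarrow> (real \<times> real \<Rightarrow> complex) \<Rightarrow> ennreal" where
  "Linf_norm T V = esssup (torus \<Otimes>\<^sub>M time_interval T) (\<lambda>z. ennreal (cmod (V z)))"

definition Linf :: "real \<Rightarrow> (real \<times> real \<Rightarrow> complex) set" where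
  "Linf T = {V \<in> borel_measurable (torus \<Otimes>\<^sub>M time_interval T). Linf_norm T V < \<infinity>}"

text \<open>
  \<open>free_evolution k \<tau> f g\<close>: \<open>g\<close> represents \<open>exp (- \<i> k \<tau> \<partial>\<^sub>x\<^sub>x) f\<close>, where \<open>exp (- \<i> k \<tau> \<partial>\<^sub>x\<^sub>x)\<close> is the
  unitary operator on \<open>L\<^sup>2\<close> with Fourier multiplier \<open>exp (\<i> k \<tau> n\<^sup>2)\<close>.
\<close>

definition free_evolution ::
    "real \<Rightarrow> real \<Rightarrow> (real \<Rightarrow> complex) \<Rightarrow> (real \<Rightarrow> complex) \<Rightarrow> bool" where
  "free_evolution k \<tau> f g \<longleftrightarrow> f \<in> L2_torus \<and> g \<in> L2_torus \<and>
     (\<forall>n. fourier_coeff g n = exp (\<i> * complex_of_real (k * \<tau> * (real_of_int n)\<^sup>2)) * fourier_coeff f n)"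

text \<open>
  \<open>has_L2_integral w t h\<close>: \<open>h\<close> represents the \<open>L\<^sup>2\<close>-valued integral of \<open>w s\<close> over \<open>[0, t]\<close>. The integral
  is taken in the weak sense; it agrees with the Bochner integral whenever the latter exists, as it
  does for the integrand of the Duhamel formula.
\<close>

definition has_L2_integral ::
    "(real \<Rightarrow> real \<Rightarrow> complex) \<Rightarrow> real \<Rightarrow> (real \<Rightarrow> complex) \<Rightarrow> bool" where
  "has_L2_integral w t h \<longleftrightarrow> h \<in> L2_torus \<and>
     (\<forall>\<phi> \<in> L2_torus. integrable (time_interval t) (\<lambda>s. L2_inner (w s) \<phi>) \<and>
        (LINT s|time_interval t. L2_inner (w s) \<phi>) = L2_inner h \<phi>)"

text \<open>
  Mild solutions \<open>v \<in> C([0, T], L\<^sup>2)\<close> (with \<open>v x t\<close> the value at \<open>(x, t)\<close>) of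
  \<open>\<i> v\<^sub>t = (k \<partial>\<^sub>x\<^sub>x + V) v\<close>, \<open>v(\<cdot>, 0) = v\<^sub>0\<close>, i.e., for all \<open>t\<close> in \<open>[0, T]\<close>,
  \<open>v(\<cdot>, t) = exp (- \<i> k t \<partial>\<^sub>x\<^sub>x) v\<^sub>0 - \<i> \<integral>\<^sub>0\<^sup>t exp (- \<i> k (t - s) \<partial>\<^sub>x\<^sub>x) (V(\<cdot>, s) v(\<cdot>, s)) ds\<close>.
\<close>

definition mild_solution ::
    "real \<Rightarrow> real \<Rightarrow> (real \<times> real \<Rightarrow> complex) \<Rightarrow> (real \<Rightarrow> complex) \<Rightarrow> (real \<Rightarrow> real \<Rightarrow> complex) \<Rightarrow> bool" where
  "mild_solution T k V v\<^sub>0 v \<longleftrightarrow>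
     (\<forall>t \<in> {0..T}. (\<lambda>x. v x t) \<in> L2_torus) \<and>
     (\<forall>t \<in> {0..T}. ((\<lambda>s. L2_norm (\<lambda>x. v x s - v x t)) \<longlongrightarrow> 0) (at t within {0..T})) \<and>
     (\<forall>t \<in> {0..T}. \<exists>f w h.
        free_evolution k t v\<^sub>0 f \<and>
        (AE s in time_interval t. free_evolution k (t - s) (\<lambda>x. V (x, s) * v x s) (w s)) \<and>
        has_L2_integral w t h \<and>
        (AE x in torus. v x t = f x - \<i> * h x))"

end

theory Submission
  imports Defs "HOL-Probability.Probability"
begin

text \<open>
  In the interaction picture the Fourier coefficients \<open>\<psi>\<^sub>n(t) = exp (- \<i> k n\<^sup>2 t) u\<^sub>n(t)\<close> solve a linear
  system whose entry from \<open>m\<close> to \<open>n\<close> is \<open>exp (- \<i> k (n\<^sup>2 - m\<^sup>2) t)\<close> times the \<open>(n - m)\<close>-th coefficient of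
  \<open>V\<close>. After weighting by dyadic blocks \<open>|n| \<sim> 2\<^sup>j\<close>, all transitions that raise the frequency by at
  most one block are bounded on \<open>H\<^sup>\<alpha>\<close> by \<open>C N\<close>, where \<open>N\<close> is the supremum of \<open>|V|\<close>. A transition that
  raises it further has \<open>|n\<^sup>2 - m\<^sup>2| \<ge> 3 n\<^sup>2 / 4\<close>, so by Plancherel in \<open>k\<close> its integral over an
  interval \<open>I\<close> is of size \<open>1 / |n|\<close> on average over \<open>k\<close>. Interpolation with the trivial bound on
  \<open>L\<^sup>2\<close> bounds the integral over \<open>I\<close> of the jump part, as an operator on \<open>H\<^sup>\<alpha>\<close>, by
  \<open>C (N |I|)\<^sup>1\<^sup>-\<^sup>\<alpha> e\<^sub>I(k)\<^sup>\<alpha>\<^sup>/\<^sup>2\<close>, where \<open>\<integral> e\<^sub>I(k) dk \<le> C N\<^sup>2 |I|\<close>.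

  The jump part itself is unbounded on \<open>H\<^sup>\<alpha>\<close>, but these bounds on its integrals over dyadic intervals
  of \<open>[0, T]\<close> amount to a finite variation of exponent less than 2, and a Young-type argument (Riemann
  sums over dyadic refinements, with the increments of the solution absorbed in \<open>\<ell>\<^sup>2\<close> over the dyadic
  tree) shows that the \<open>H\<^sup>\<alpha>\<close> norm at most doubles on every dyadic interval on which a control is
  small. The logarithm of the norm is thus at most the number of dyadic intervals with a large
  control. This number is estimated by the sum of the \<open>(1 + s\<^sub>0)\<close>-th powers of the controls, which
  decays geometrically in the generation because \<open>\<alpha> p < 2 (p - 1)\<close>. A weighted sum \<open>H(k)\<close> of the
  \<open>e\<^sub>I(k)\<close> over all dyadic intervals bounds the control of \<open>[0, T]\<close>, and \<open>U\<^sub>1\<close> is a multiple of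
  \<open>H\<^sup>1\<^sup>/\<^sup>p\<^sup>'\<close>, whose norm in \<open>L\<^sup>p\<^sup>'\<close> only involves the integral of \<open>H\<close>.
\<close>

section \<open>Sums over a dyadic tree and a growth estimate\<close>

text \<open>The obstacle: at a fixed time the jump operator is bounded on L^2 only; H^\<alpha> is
  gained only by its time integral against a fixed vector. So the solution is frozen at the left end
  of I. By halving, the cost of freezing is the cost on the two halves plus the integral over the
  right half applied to the increment over the left half. Iteration pairs controls with increments
  along the tree, and Cauchy-Schwarz closes the estimate if squares of controls contract under
  halving.

  The energies e_I need not contract, since the integrals over the halves of I may cancel in e_I. So
  a node carries the sum of |J|^r e_J over all dyadic J inside I, which is superadditive. Its mean
  is finite for every r > 0. With S = N^2 T^(1+r), the function S^(1/2 - 1/p') H^(1/p') has norm of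
  order sqrt S in L^(p'), and r = 1 - 2/p' turns sqrt S into N T^(1 - 1/p'). The jump control of
  [0, T] is then the product of the powers 1 - \<open>s\<^sub>0\<close> of T N and
  \<open>s\<^sub>0\<close> of this function, and its power 1 + \<open>s\<^sub>0\<close>, the
  counting exponent, is the last term of the claim.\<close>

fun tree_sum :: "(nat \<Rightarrow> nat \<Rightarrow> real) \<Rightarrow> nat \<Rightarrow> nat \<Rightarrow> nat \<Rightarrow> real" where
  "tree_sum f 0 l j = 0"
| "tree_sum f (Suc M) l j =
     f l j + tree_sum f M (Suc l) (2 * j) + tree_sum f M (Suc l) (Suc (2 * j))"

lemma child_less: "j < 2 ^ l \<Longrightarrow> 2 * j < 2 ^ Suc l" "j < 2 ^ l \<Longrightarrow> Suc (2 * j) < 2 ^ Suc l"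
  for j l :: nat by auto

lemma tree_sum_nonneg: "(\<And>l j. f l j \<ge> 0) \<Longrightarrow> tree_sum f M l j \<ge> 0"
  by (induction M arbitrary: l j) (auto intro!: add_nonneg_nonneg)

lemma tree_sum_mono:
  assumes "\<And>l j. j < 2 ^ l \<Longrightarrow> f l j \<le> h l j" and "j < 2 ^ l"
  shows "tree_sum f M l j \<le> tree_sum h M l j"
  using assms(2)
proof (induction M arbitrary: l j)
  case (Suc M)
  show ?case
    using assms(1)[OF Suc.prems] Suc.IH[OF child_less(1)[OF Suc.prems]]
      Suc.IH[OF child_less(2)[OF Suc.prems]] by simp
qed simp

lemma tree_sum_add: "tree_sum (\<lambda>l j. f l j + h l j) M l j = tree_sum f M l j + tree_sum h M l j"
  by (induction M arbitrary: l j) auto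

lemma tree_sum_cmult: "tree_sum (\<lambda>l j. c * f l j) M l j = c * tree_sum f M l j"
  by (induction M arbitrary: l j) (auto simp: algebra_simps)

text \<open>A node has only one parent, so selecting one child of every node counts no node twice.
  The root is never selected; keeping its value on the left is what makes the induction go
  through.\<close>

lemma tree_sum_child:
  assumes "\<And>l j. f l j \<ge> 0" "\<And>j. c j = 2 * j \<or> c j = Suc (2 * j)"
  shows "tree_sum (\<lambda>l j. f (Suc l) (c j)) M l j + f l j \<le> tree_sum f (Suc M) l j"
proof (induction M arbitrary: l j)
  case (Suc M)
  let ?S = "\<lambda>i. tree_sum (\<lambda>l j. f (Suc l) (c j)) M (Suc l) i + f (Suc l) i"
  have "f (Suc l) (c j) \<le> f (Suc l) (2 * j) + f (Suc l) (Suc (2 * j))"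
    using assms(1)[of "Suc l" "2 * j"] assms(1)[of "Suc l" "Suc (2 * j)"] assms(2)[of j] by auto
  then have "tree_sum (\<lambda>l j. f (Suc l) (c j)) (Suc M) l j + f l j \<le> f l j + ?S (2 * j) + ?S (Suc (2 * j))"
    by simp
  also have "\<dots> \<le> f l j + tree_sum f (Suc M) (Suc l) (2 * j) + tree_sum f (Suc M) (Suc l) (Suc (2 * j))"
    by (intro add_mono order_refl Suc.IH)
  finally show ?case by simp
qed simp

lemma cauchy_sqrt2:
  fixes a b c d :: real
  assumes "a \<ge> 0" "b \<ge> 0" "c \<ge> 0" "d \<ge> 0"
  shows "sqrt a * sqrt b + sqrt c * sqrt d \<le> sqrt (a + c) * sqrt (b + d)"
proof -
  have "sqrt a * sqrt b + sqrt c * sqrt d = sqrt a * sqrt b + sqrt c * sqrt d" ..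
  have "0 \<le> (sqrt a * sqrt d - sqrt c * sqrt b)\<^sup>2" by simp
  then have "2 * (sqrt a * sqrt b) * (sqrt c * sqrt d) \<le> a * d + c * b"
    using assms by (simp add: power2_diff power_mult_distrib algebra_simps)
  then have "(sqrt a * sqrt b + sqrt c * sqrt d)\<^sup>2 \<le> (a + c) * (b + d)"
    using assms by (simp add: power2_sum power_mult_distrib algebra_simps)
  then show ?thesis
    using assms by (metis add_nonneg_nonneg real_le_rsqrt real_sqrt_mult)
qed

lemma tree_sum_cauchy:
  assumes "\<And>l j. f l j \<ge> 0" "\<And>l j. h l j \<ge> 0"
  shows "tree_sum (\<lambda>l j. f l j * h l j) M l j \<le>
    sqrt (tree_sum (\<lambda>l j. (f l j)\<^sup>2) M l j) * sqrt (tree_sum (\<lambda>l j. (h l j)\<^sup>2) M l j)"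
proof (induction M arbitrary: l j)
  case (Suc M)
  let ?F = "tree_sum (\<lambda>l j. (f l j)\<^sup>2) M (Suc l)" and ?H = "tree_sum (\<lambda>l j. (h l j)\<^sup>2) M (Suc l)"
  have nn: "?F i \<ge> 0" "?H i \<ge> 0" for i by (auto intro: tree_sum_nonneg)
  have "tree_sum (\<lambda>l j. f l j * h l j) (Suc M) l j \<le> sqrt ((f l j)\<^sup>2) * sqrt ((h l j)\<^sup>2)
      + sqrt (?F (2*j)) * sqrt (?H (2*j)) + sqrt (?F (Suc (2*j))) * sqrt (?H (Suc (2*j)))"
    using Suc assms by (simp add: add_mono)
  also have "\<dots> \<le> sqrt ((f l j)\<^sup>2 + ?F (2*j)) * sqrt ((h l j)\<^sup>2 + ?H (2*j))
      + sqrt (?F (Suc (2*j))) * sqrt (?H (Suc (2*j)))"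
    using cauchy_sqrt2[of "(f l j)\<^sup>2" "(h l j)\<^sup>2" "?F (2*j)" "?H (2*j)"] nn by simp
  also have "\<dots> \<le> sqrt ((f l j)\<^sup>2 + ?F (2*j) + ?F (Suc (2*j))) * sqrt ((h l j)\<^sup>2 + ?H (2*j) + ?H (Suc (2*j)))"
    using nn by (intro cauchy_sqrt2) auto
  finally show ?case by simp
qed simp

text \<open>Level sums decay like powers of \<theta>, so the whole tree is dominated by a geometric
  series started at its root.\<close>

lemma tree_sum_contraction:
  assumes "0 < \<theta>" "\<theta> < 1" "\<And>l j. Q l j \<ge> 0"
    and "\<And>l j. j < 2 ^ l \<Longrightarrow> Q (Suc l) (2 * j) + Q (Suc l) (Suc (2 * j)) \<le> \<theta> * Q l j"
    and "j < 2 ^ l"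
  shows "tree_sum Q M l j \<le> Q l j / (1 - \<theta>)"
  using assms(5)
proof (induction M arbitrary: l j)
  case 0
  then show ?case using assms by simp
next
  case (Suc M)
  have "tree_sum Q (Suc M) l j \<le> Q l j + (Q (Suc l) (2 * j) + Q (Suc l) (Suc (2 * j))) / (1 - \<theta>)"
    using Suc.IH[OF child_less(1)[OF Suc.prems]] Suc.IH[OF child_less(2)[OF Suc.prems]]
    by (simp add: add_divide_distrib)
  also have "\<dots> \<le> Q l j + \<theta> * Q l j / (1 - \<theta>)"
    using assms Suc.prems by (intro add_left_mono divide_right_mono) auto
  also have "\<dots> = Q l j / (1 - \<theta>)" using assms by (simp add: field_simps)
  finally show ?case .
qed

section \<open>Dyadic division points of [0, T]\<close>

definition node :: "real \<Rightarrow> nat \<Rightarrow> nat \<Rightarrow> real" where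
  "node T l j = T * real j / 2 ^ l"

lemma node_child [simp]: "node T (Suc l) (2 * j) = node T l j"
  by (simp add: node_def)

lemma node_0_0 [simp]: "node T l 0 = 0" "node T 0 (Suc 0) = T"
  by (simp_all add: node_def)

lemma node_mono: "T \<ge> 0 \<Longrightarrow> i \<le> j \<Longrightarrow> node T l i \<le> node T l j"
  by (simp add: node_def divide_right_mono mult_left_mono)

lemma node_le: "T \<ge> 0 \<Longrightarrow> j \<le> 2 ^ l \<Longrightarrow> node T l j \<le> T"
proof -
  assume "T \<ge> 0" "j \<le> 2 ^ l"
  then have "real j \<le> 2 ^ l" by (metis of_nat_le_iff of_nat_numeral of_nat_power)
  then show ?thesis using \<open>T \<ge> 0\<close> by (simp add: node_def field_simps mult_left_mono)
qed

lemma node_nonneg: "T \<ge> 0 \<Longrightarrow> node T l j \<ge> 0"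
  by (simp add: node_def)

lemma node_Suc_diff: "node T l (Suc j) - node T l j = T / 2 ^ l"
  by (simp add: node_def field_simps)

text \<open>Square-summing \<open>c * P\<close> over the subtree of a node gives at most (c P)^2 /
  (1 - \<theta>) by \<open>tree_sum_contraction\<close>; this is the resulting factor of
  \<open>P\<close>.\<close>

definition absorb_const :: "real \<Rightarrow> real \<Rightarrow> real" where
  "absorb_const c \<theta> = c / sqrt (1 - \<theta>)"

text \<open>The solution R of R = 3 K^2 + \<theta> R, where K is
  \<open>absorb_const c \<theta>\<close>: in the induction for \<open>E_le\<close> the root of the
  tree contributes 3 K^2 and its two subtrees contribute \<theta> R.\<close>

definition square_absorb_const :: "real \<Rightarrow> real \<Rightarrow> real" where
  "square_absorb_const c \<theta> = 3 * (absorb_const c \<theta>)\<^sup>2 / (1 - \<theta>)"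

text \<open>The first bound lets the square sum of the increments be absorbed, since P <= 1 / (1 + 2
  R) implies R P^2 <= 1/2. The second keeps the geometric sum of increments in \<open>chain\<close>
  below half of the supremum of \<open>g\<close>.\<close>

definition growth_threshold :: "real \<Rightarrow> real \<Rightarrow> real" where
  "growth_threshold c \<theta> =
     min (1 / (1 + 2 * square_absorb_const c \<theta>)) ((1 - sqrt \<theta>) / (4 * absorb_const c \<theta>))"

lemma growth_threshold_pos:
  assumes "c \<ge> 1" "0 < \<theta>" "\<theta> < 1" shows "growth_threshold c \<theta> > 0"
proof -
  have "square_absorb_const c \<theta> \<ge> 0" using assms by (simp add: square_absorb_const_def)
  moreover have "absorb_const c \<theta> > 0" using assms by (simp add: absorb_const_def)
  ultimately show ?thesis using assms by (auto simp: growth_threshold_def)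
qed

text \<open>
  The last summand in \<open>increment\<close> is the error of a Riemann sum of depth \<open>M\<close>. The constant \<open>A\<close> may be
  huge, like \<open>\<Lambda>\<close>: it does not enter the conclusion.
\<close>

locale dyadic_growth =
  fixes T c \<theta> A \<Lambda> :: real and P :: "nat \<Rightarrow> nat \<Rightarrow> real"
    and g :: "real \<Rightarrow> real" and d :: "real \<Rightarrow> real \<Rightarrow> real"
  assumes T: "T > 0" and c: "c \<ge> 1" and \<theta>: "0 < \<theta>" "\<theta> < 1" and A: "A \<ge> 0"
    and P_nonneg: "P l j \<ge> 0"
    and P_children: "j < 2 ^ l \<Longrightarrow> (P (Suc l) (2 * j))\<^sup>2 + (P (Suc l) (Suc (2 * j)))\<^sup>2 \<le> \<theta> * (P l j)\<^sup>2"
    and g_nonneg: "g t \<ge> 0" and d_nonneg: "d s t \<ge> 0"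
    and g_le: "s \<in> {0..T} \<Longrightarrow> t \<in> {0..T} \<Longrightarrow> g t \<le> g s + d s t"
    and d_triangle: "r \<in> {0..T} \<Longrightarrow> s \<in> {0..T} \<Longrightarrow> t \<in> {0..T} \<Longrightarrow> d r t \<le> d r s + d s t"
    and d_lipschitz: "s \<in> {0..T} \<Longrightarrow> t \<in> {0..T} \<Longrightarrow> d s t \<le> \<Lambda> * \<bar>t - s\<bar>"
    and increment: "j < 2 ^ l \<Longrightarrow> (\<And>s. s \<in> {node T l j..node T l (Suc j)} \<Longrightarrow> g s \<le> B) \<Longrightarrow>
      d (node T l j) (node T l (Suc j)) \<le> c * P l j * B
        + tree_sum (\<lambda>l j. c * P (Suc l) (Suc (2 * j)) *
             d (node T (Suc l) (2 * j)) (node T (Suc l) (Suc (2 * j)))) M l j + A / (4 ^ l * 2 ^ M)"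
begin

abbreviation "v l j \<equiv> d (node T l j) (node T l (Suc j))"
abbreviation "E \<equiv> tree_sum (\<lambda>l j. (v l j)\<^sup>2)"

lemma E_nonneg: "E M l j \<ge> 0"
  by (rule tree_sum_nonneg) simp

lemma g_bound_nonneg:
  assumes "\<And>s. s \<in> {node T l j..node T l (Suc j)} \<Longrightarrow> g s \<le> B"
  shows "B \<ge> 0"
  using assms[of "node T l j"] g_nonneg[of "node T l j"] node_mono[of T j "Suc j" l] T by force

lemma child_interval:
  "{node T (Suc l) (2 * j)..node T (Suc l) (Suc (2 * j))} \<subseteq> {node T l j..node T l (Suc j)}"
  "{node T (Suc l) (Suc (2 * j))..node T (Suc l) (Suc (Suc (2 * j)))} \<subseteq> {node T l j..node T l (Suc j)}"
proof -
  have *: "node T (Suc l) (Suc (Suc (2 * j))) = node T l (Suc j)"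
    using node_child[of T l "Suc j"] by simp
  show "{node T (Suc l) (2 * j)..node T (Suc l) (Suc (2 * j))} \<subseteq> {node T l j..node T l (Suc j)}"
    using T node_mono[of T "Suc (2*j)" "Suc (Suc (2 * j))" "Suc l"] * by auto
  show "{node T (Suc l) (Suc (2 * j))..node T (Suc l) (Suc (Suc (2 * j)))} \<subseteq> {node T l j..node T l (Suc j)}"
    using T node_mono[of T "2*j" "Suc (2 * j)" "Suc l"] * by auto
qed

abbreviation "K \<equiv> absorb_const c \<theta>"
abbreviation "R \<equiv> square_absorb_const c \<theta>"
abbreviation "threshold \<equiv> growth_threshold c \<theta>"

lemma K_ge: "K \<ge> c" "K > 0"
proof -
  have "sqrt (1 - \<theta>) \<le> 1" "sqrt (1 - \<theta>) > 0" using \<theta> by auto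
  then show "K \<ge> c" "K > 0" using c by (auto simp: absorb_const_def le_divide_eq_1 field_simps mult_le_cancel_left1)
qed

text \<open>Cauchy-Schwarz on the tree: the controls of the right children are square-summable by
  contraction, and the increments over the left children are part of the square sum
  \<open>E\<close>. They lie one level deeper, hence \<open>Suc M\<close>.\<close>

lemma increment':
  assumes j: "j < 2 ^ l" and B: "\<And>s. s \<in> {node T l j..node T l (Suc j)} \<Longrightarrow> g s \<le> B"
  shows "v l j \<le> K * P l j * B + K * P l j * sqrt (E (Suc M) l j) + A / (4 ^ l * 2 ^ M)"
proof -
  have B0: "B \<ge> 0" using g_bound_nonneg[OF B] .
  let ?p = "\<lambda>l j. c * P (Suc l) (Suc (2 * j))" and ?v = "\<lambda>l j. v (Suc l) (2 * j)"
  have "tree_sum (\<lambda>l j. ?p l j * ?v l j) M l j \<le>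
      sqrt (tree_sum (\<lambda>l j. (?p l j)\<^sup>2) M l j) * sqrt (tree_sum (\<lambda>l j. (?v l j)\<^sup>2) M l j)"
    using P_nonneg d_nonneg c by (intro tree_sum_cauchy) auto
  also have "\<dots> \<le> (K * P l j) * sqrt (E (Suc M) l j)"
  proof (intro mult_mono real_sqrt_le_mono)
    have "tree_sum (\<lambda>l j. (?p l j)\<^sup>2) M l j = c\<^sup>2 * tree_sum (\<lambda>l j. (P (Suc l) (Suc (2 * j)))\<^sup>2) M l j"
      by (simp add: power_mult_distrib tree_sum_cmult)
    also have "\<dots> \<le> c\<^sup>2 * tree_sum (\<lambda>l j. (P l j)\<^sup>2) (Suc M) l j"
      using tree_sum_child[of "\<lambda>l j. (P l j)\<^sup>2" "\<lambda>j. Suc (2 * j)" M l j] by (intro mult_left_mono) (simp_all del: tree_sum.simps, smt (verit) zero_le_power2)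
    also have "\<dots> \<le> c\<^sup>2 * ((P l j)\<^sup>2 / (1 - \<theta>))"
      using P_children \<theta> j by (intro mult_left_mono tree_sum_contraction) auto
    finally have "sqrt (tree_sum (\<lambda>l j. (?p l j)\<^sup>2) M l j) \<le> sqrt (c\<^sup>2 * ((P l j)\<^sup>2 / (1 - \<theta>)))"
      by (rule real_sqrt_le_mono)
    also have "\<dots> = K * P l j" using c P_nonneg by (simp add: absorb_const_def real_sqrt_mult real_sqrt_divide)
    finally show "sqrt (tree_sum (\<lambda>l j. (?p l j)\<^sup>2) M l j) \<le> K * P l j" .
    show "tree_sum (\<lambda>l j. (?v l j)\<^sup>2) M l j \<le> E (Suc M) l j"
      using tree_sum_child[of "\<lambda>l j. (v l j)\<^sup>2" "\<lambda>j. 2 * j" M l j] by (simp del: tree_sum.simps) (smt (verit) zero_le_power2)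
    show "0 \<le> K * P l j" using K_ge P_nonneg by simp
    show "0 \<le> sqrt (tree_sum (\<lambda>l j. (?v l j)\<^sup>2) M l j)" by (intro real_sqrt_ge_zero tree_sum_nonneg) simp
  qed
  finally have 1: "tree_sum (\<lambda>l j. ?p l j * ?v l j) M l j \<le> (K * P l j) * sqrt (E (Suc M) l j)" .
  have "c * P l j * B \<le> K * P l j * B" using K_ge P_nonneg B0 by (intro mult_right_mono) auto
  then show ?thesis using increment[OF j B, of M] 1 by linarith
qed

text \<open>The square sum of the increments stands on both sides on purpose: its coefficient on the
  right is \<open>R * (P l j)\<^sup>2\<close>, which is at most 1/2 below the threshold. In the
  induction the square sums of the halves are enlarged to that of the parent, so that all three
  contributions share one factor.\<close>

lemma E_le:
  assumes j: "j < 2 ^ l" and B: "\<And>s. s \<in> {node T l j..node T l (Suc j)} \<Longrightarrow> g s \<le> B"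
  shows "E M l j \<le> R * (P l j)\<^sup>2 * (B\<^sup>2 + E M l j) + 24 * A\<^sup>2 / (16 ^ l * 4 ^ M)"
  using j B
proof (induction M arbitrary: l j)
  case 0
  have "R \<ge> 0" using \<theta> by (simp add: square_absorb_const_def)
  then show ?case by simp
next
  case (Suc M)
  let ?E = "E (Suc M) l j"
  \<comment> \<open>The number 24 solves 3 + 2 a / 16 = a / 4, which balances the error of the root
    and of the two halves against the error at depth \<open>Suc M\<close>.\<close>
  let ?a = "24 * A\<^sup>2 / (16 ^ Suc l * 4 ^ M)"
  have R: "R \<ge> 0" using \<theta> by (simp add: square_absorb_const_def)
  have B0: "B \<ge> 0" using g_bound_nonneg[OF Suc.prems(2)] .
  have E0: "?E \<ge> 0" by (rule E_nonneg)
  have part: "E M (Suc l) i \<le> R * (P (Suc l) i)\<^sup>2 * (B\<^sup>2 + ?E) + ?a"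
    if "i \<in> {2 * j, Suc (2 * j)}" for i
  proof -
    have "E M (Suc l) i \<le> R * (P (Suc l) i)\<^sup>2 * (B\<^sup>2 + E M (Suc l) i) + ?a"
      using that child_less[OF Suc.prems(1)] child_interval[of l j] Suc.prems(2)
      by (intro Suc.IH) auto
    also have "E M (Suc l) i \<le> ?E" using that E_nonneg[of M "Suc l" "2*j"] E_nonneg[of M "Suc l" "Suc (2*j)"] by auto
    finally show ?thesis using R by (simp add: mult_left_mono)
  qed
  have v: "(v l j)\<^sup>2 \<le> 3 * K\<^sup>2 * (P l j)\<^sup>2 * (B\<^sup>2 + ?E) + 3 * (A\<^sup>2 / (16 ^ l * 4 ^ M))"
  proof -
    have "(v l j)\<^sup>2 \<le> (K * P l j * B + K * P l j * sqrt ?E + A / (4 ^ l * 2 ^ M))\<^sup>2"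
      using increment'[OF Suc.prems, of M] d_nonneg by (intro power_mono) auto
    also have "\<dots> \<le> 3 * ((K * P l j * B)\<^sup>2 + (K * P l j * sqrt ?E)\<^sup>2 + (A / (4 ^ l * 2 ^ M))\<^sup>2)"
    proof -
      have "(x + y + z)\<^sup>2 \<le> 3 * (x\<^sup>2 + y\<^sup>2 + z\<^sup>2)" for x y z :: real
        using sum_squares_bound[of x y] sum_squares_bound[of x z] sum_squares_bound[of y z]
        by (simp add: power2_eq_square algebra_simps)
      then show ?thesis .
    qed
    also have "(K * P l j * sqrt ?E)\<^sup>2 = K\<^sup>2 * (P l j)\<^sup>2 * ?E"
      using E0 by (simp add: power_mult_distrib del: tree_sum.simps)
    also have "(A / (4 ^ l * 2 ^ M))\<^sup>2 = A\<^sup>2 / (16 ^ l * 4 ^ M)"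
    proof -
      have "((4::real) ^ l)\<^sup>2 = 16 ^ l" "((2::real) ^ M)\<^sup>2 = 4 ^ M"
        by (simp_all add: power2_eq_square flip: power_mult_distrib)
      then show ?thesis by (simp add: power_divide power_mult_distrib)
    qed
    finally show ?thesis by (simp add: power_mult_distrib algebra_simps)
  qed
  have "?E \<le> 3 * K\<^sup>2 * (P l j)\<^sup>2 * (B\<^sup>2 + ?E) + 3 * (A\<^sup>2 / (16 ^ l * 4 ^ M))
     + R * ((P (Suc l) (2*j))\<^sup>2 + (P (Suc l) (Suc (2*j)))\<^sup>2) * (B\<^sup>2 + ?E) + 2 * ?a"
    using v part[of "2*j"] part[of "Suc (2*j)"] unfolding tree_sum.simps(2)[of _ M l j]
    by (simp del: tree_sum.simps add: algebra_simps)
  also have "\<dots> \<le> 3 * K\<^sup>2 * (P l j)\<^sup>2 * (B\<^sup>2 + ?E) + 3 * (A\<^sup>2 / (16 ^ l * 4 ^ M))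
     + R * (\<theta> * (P l j)\<^sup>2) * (B\<^sup>2 + ?E) + 2 * ?a"
    using P_children[OF Suc.prems(1)] R E0
    by (intro add_mono order_refl mult_right_mono mult_left_mono) auto
  also have "\<dots> = (3 * K\<^sup>2 + R * \<theta>) * (P l j)\<^sup>2 * (B\<^sup>2 + ?E) + (3 * (A\<^sup>2 / (16 ^ l * 4 ^ M)) + 2 * ?a)"
    by (simp add: algebra_simps del: tree_sum.simps)
  also have "3 * K\<^sup>2 + R * \<theta> = R" using \<theta> by (simp add: square_absorb_const_def field_simps)
  also have "3 * (A\<^sup>2 / (16 ^ l * 4 ^ M)) + 2 * ?a = 24 * A\<^sup>2 / (16 ^ l * 4 ^ Suc M)"
    by (simp add: field_simps)
  finally show ?case .
qed

text \<open>On a good node the square sum is absorbed, so it is at most B^2 up to the discretization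
  error. Letting the depth \<open>M\<close> tend to infinity removes that error, and
  \<open>A\<close> with it.\<close>

lemma increment_good:
  assumes j: "j < 2 ^ l" and B: "\<And>s. s \<in> {node T l j..node T l (Suc j)} \<Longrightarrow> g s \<le> B"
    and small: "R * (P l j)\<^sup>2 \<le> 1 / 2"
  shows "v l j \<le> 2 * K * P l j * B"
proof -
  have B0: "B \<ge> 0" using g_bound_nonneg[OF B] .
  have E: "E M l j \<le> B\<^sup>2 + 48 * A\<^sup>2 / (16 ^ l * 4 ^ M)" for M
  proof -
    have "E M l j \<le> 1 / 2 * (B\<^sup>2 + E M l j) + 24 * A\<^sup>2 / (16 ^ l * 4 ^ M)"
      using E_le[OF j B, of M] mult_right_mono[OF small, of "B\<^sup>2 + E M l j"] E_nonneg[of M l j]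
        zero_le_power2[of B] by linarith
    then show ?thesis by (simp add: field_simps)
  qed
  have "v l j \<le> K * P l j * B + K * P l j * sqrt (B\<^sup>2 + 48 * A\<^sup>2 / 16 ^ l * (1 / 4) ^ Suc M) + A / 4 ^ l * (1 / 2) ^ M" for M
  proof -
    have "K * P l j * sqrt (E (Suc M) l j) \<le> K * P l j * sqrt (B\<^sup>2 + 48 * A\<^sup>2 / 16 ^ l * (1 / 4) ^ Suc M)"
      using E[of "Suc M"] K_ge P_nonneg by (intro mult_left_mono real_sqrt_le_mono) (auto simp: power_one_over divide_simps)
    moreover have "A / 4 ^ l * (1 / 2) ^ M = A / (4 ^ l * 2 ^ M)" by (simp add: power_one_over)
    ultimately show ?thesis using increment'[OF j B, of M] by linarith
  qed
  moreover have "(\<lambda>M. K * P l j * B + K * P l j * sqrt (B\<^sup>2 + 48 * A\<^sup>2 / 16 ^ l * (1 / 4) ^ Suc M) + A / 4 ^ l * (1 / 2) ^ M)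
     \<longlonglongrightarrow> K * P l j * B + K * P l j * sqrt (B\<^sup>2 + 48 * A\<^sup>2 / 16 ^ l * 0) + A / 4 ^ l * 0"
    by (intro tendsto_intros LIMSEQ_Suc LIMSEQ_realpow_zero) auto
  ultimately have "v l j \<le> K * P l j * B + K * P l j * sqrt (B\<^sup>2 + 48 * A\<^sup>2 / 16 ^ l * 0) + A / 4 ^ l * 0"
    by (intro LIMSEQ_le_const[of _ _ "v l j"]) auto
  then show ?thesis using B0 by (simp add: mult_ac)
qed

lemma P_child:
  assumes "j < 2 ^ l" "i \<in> {2 * j, Suc (2 * j)}"
  shows "P (Suc l) i \<le> sqrt \<theta> * P l j"
proof -
  have "(P (Suc l) i)\<^sup>2 \<le> \<theta> * (P l j)\<^sup>2"
    using P_children[OF assms(1)] assms(2) by (auto intro: order_trans[rotated])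
  then have "sqrt ((P (Suc l) i)\<^sup>2) \<le> sqrt (\<theta> * (P l j)\<^sup>2)" by (rule real_sqrt_le_mono)
  then show ?thesis using P_nonneg by (simp add: real_sqrt_mult)
qed

lemma P_child_le: "j < 2 ^ l \<Longrightarrow> i \<in> {2 * j, Suc (2 * j)} \<Longrightarrow> P (Suc l) i \<le> P l j"
  using P_child[of j l i] mult_right_mono[of "sqrt \<theta>" 1 "P l j"] P_nonneg[of l j] \<theta> by simp

text \<open>A dyadic point is reached by descending the tree: at each level either enter the left
  half, or cross it with \<open>increment_good\<close> and continue in the right half. Controls
  shrink by the factor \<mu> = sqrt \<theta> per level, so the costs form a geometric series; the
  induction closes because \<mu> (2 - \<mu>) <= 1.\<close>

lemma chain:
  assumes j: "j < 2 ^ l" and B: "\<And>s. s \<in> {node T l j..node T l (Suc j)} \<Longrightarrow> g s \<le> B"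
    and small: "R * (P l j)\<^sup>2 \<le> 1 / 2" and i: "i \<le> 2 ^ M"
  shows "d (node T l j) (node T (l + M) (j * 2 ^ M + i)) \<le> 2 * K * B * P l j / (1 - sqrt \<theta>)"
  using j B small i
proof (induction M arbitrary: l j i)
  case 0
  let ?\<mu> = "sqrt \<theta>"
  have B0: "B \<ge> 0" using g_bound_nonneg[OF 0(2)] .
  have \<mu>: "0 < ?\<mu>" "?\<mu> < 1" using \<theta> by auto
  have nn: "2 * K * B * P l j \<ge> 0" using K_ge P_nonneg B0 by auto
  have *: "2 * K * B * P l j \<le> 2 * K * B * P l j / (1 - ?\<mu>)"
    using nn \<mu> by (simp add: pos_le_divide_eq mult_left_le)
  have nd: "node T l j \<in> {0..T}" using 0 T node_le[of T j l] node_nonneg[of T l j] by auto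
  show ?case
  proof (cases "i = 0")
    case True
    have "d (node T l j) (node T l j) \<le> 0" using d_lipschitz[OF nd nd] by simp
    then have "d (node T l j) (node T l j) \<le> 2 * K * B * P l j / (1 - ?\<mu>)" using nn * by linarith
    then show ?thesis using True by simp
  next
    case False
    then have "i = Suc 0" using 0 by simp
    then show ?thesis using increment_good[OF 0(1-3)] * by (simp add: mult.commute mult.left_commute)
  qed
next
  case (Suc M)
  let ?\<mu> = "sqrt \<theta>" and ?z = "2 * K * B"
  have B0: "B \<ge> 0" using g_bound_nonneg[OF Suc.prems(2)] .
  have z: "?z \<ge> 0" using K_ge B0 by auto
  have \<mu>: "0 < ?\<mu>" "?\<mu> < 1" using \<theta> by auto
  have "R \<ge> 0" using \<theta> by (simp add: square_absorb_const_def)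
  have sm: "R * (P (Suc l) i)\<^sup>2 \<le> 1 / 2" if "i \<in> {2 * j, Suc (2 * j)}" for i
  proof -
    have "R * (P (Suc l) i)\<^sup>2 \<le> R * (P l j)\<^sup>2"
      using P_child_le[OF Suc.prems(1) that] P_nonneg \<open>R \<ge> 0\<close> by (intro mult_left_mono power_mono) auto
    then show ?thesis using Suc.prems by simp
  qed
  have B': "\<And>s. s \<in> {node T (Suc l) i..node T (Suc l) (Suc i)} \<Longrightarrow> g s \<le> B" if "i \<in> {2 * j, Suc (2 * j)}" for i
    using that Suc.prems(2) child_interval[of l j] by auto
  show ?case
  proof (cases "i \<le> 2 ^ M")
    case True
    have "d (node T (Suc l) (2*j)) (node T (Suc l + M) (2*j * 2 ^ M + i)) \<le> ?z * P (Suc l) (2*j) / (1 - ?\<mu>)"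
      by (rule Suc.IH[OF child_less(1)[OF Suc.prems(1)] B' sm True]) auto
    also have "\<dots> \<le> ?z * P l j / (1 - ?\<mu>)"
      using P_child_le[OF Suc.prems(1)] z \<mu> by (intro divide_right_mono mult_left_mono) auto
    also have "node T (Suc l + M) (2*j * 2 ^ M + i) = node T (l + Suc M) (j * 2 ^ Suc M + i)"
      by (simp add: mult_ac)
    finally show ?thesis by simp
  next
    case False
    define i' where "i' = i - 2 ^ M"
    have i': "i' \<le> 2 ^ M" "i = 2 ^ M + i'" using False Suc.prems by (auto simp: i'_def)
    have e: "node T (l + Suc M) (j * 2 ^ Suc M + i) = node T (Suc l + M) (Suc (2*j) * 2 ^ M + i')"
      using i' by (simp add: algebra_simps)
    have jM: "Suc (2*j) * 2 ^ M + i' \<le> 2 ^ (Suc l + M)"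
    proof -
      have "Suc (2*j) + 1 \<le> 2 ^ Suc l" using child_less[OF Suc.prems(1)] by simp
      then have "(Suc (2*j) + 1) * 2 ^ M \<le> 2 ^ Suc l * 2 ^ M" by (rule mult_le_mono1)
      then show ?thesis using i' by (simp add: power_add algebra_simps)
    qed
    have mid: "node T (Suc l) (Suc (2*j)) \<in> {0..T}" "node T l j \<in> {0..T}"
        "node T (Suc l + M) (Suc (2*j) * 2 ^ M + i') \<in> {0..T}"
      using node_le[of T "Suc (2*j)" "Suc l"] node_le[of T j l] node_nonneg[of T] T child_less[OF Suc.prems(1)]
        Suc.prems(1) node_le[OF _ jM, of T] by auto
    have "d (node T (Suc l) (2*j)) (node T (Suc l) (Suc (2*j))) \<le> 2 * K * P (Suc l) (2*j) * B"
      by (rule increment_good[OF child_less(1)[OF Suc.prems(1)] B' sm]) auto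
    also have "2 * K * P (Suc l) (2*j) * B = ?z * P (Suc l) (2*j)" by (simp only: mult_ac)
    finally have 1: "d (node T l j) (node T (Suc l) (Suc (2*j))) \<le> ?z * P (Suc l) (2*j)"
      by (simp only: node_child)
    have 2: "d (node T (Suc l) (Suc (2*j))) (node T (Suc l + M) (Suc (2*j) * 2 ^ M + i')) \<le> ?z * P (Suc l) (Suc (2*j)) / (1 - ?\<mu>)"
      by (rule Suc.IH[OF child_less(2)[OF Suc.prems(1)] B' sm i'(1)]) auto
    have "d (node T l j) (node T (l + Suc M) (j * 2 ^ Suc M + i)) \<le> ?z * P (Suc l) (2*j) + ?z * P (Suc l) (Suc (2*j)) / (1 - ?\<mu>)"
      unfolding e using d_triangle[OF mid(2,1,3)] 1 2 by linarith
    also have "\<dots> \<le> ?z * (?\<mu> * P l j) + ?z * (?\<mu> * P l j) / (1 - ?\<mu>)"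
      using P_child[OF Suc.prems(1)] z \<mu> by (intro add_mono divide_right_mono mult_left_mono) auto
    also have "\<dots> = ?z * P l j * (?\<mu> * (2 - ?\<mu>)) / (1 - ?\<mu>)" using \<mu> by (simp add: field_simps)
    also have "\<dots> \<le> ?z * P l j * 1 / (1 - ?\<mu>)"
    proof (intro divide_right_mono mult_left_mono)
      have "0 \<le> (1 - ?\<mu>)\<^sup>2" by simp
      then show "?\<mu> * (2 - ?\<mu>) \<le> 1" by (simp add: power2_eq_square algebra_simps)
    qed (use z P_nonneg \<mu> in auto)
    finally show ?thesis by (simp add: mult.commute mult.left_commute)
  qed
qed


lemma threshold_pos: "threshold > 0"
  using growth_threshold_pos[OF c \<theta>] .

lemma threshold_small:
  assumes "P l j \<le> threshold"
  shows "R * (P l j)\<^sup>2 \<le> 1 / 2" "2 * K * P l j / (1 - sqrt \<theta>) \<le> 1 / 2"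
proof -
  have R: "R \<ge> 0" using \<theta> by (simp add: square_absorb_const_def)
  have P: "P l j \<le> 1 / (1 + 2 * R)" "P l j \<le> (1 - sqrt \<theta>) / (4 * K)" "P l j \<ge> 0"
    using assms P_nonneg by (auto simp: growth_threshold_def)
  have "1 / (1 + 2 * R) \<le> 1" using R by simp
  then have "P l j \<le> 1" using P by linarith
  then have "(P l j)\<^sup>2 \<le> P l j" using P by (simp add: power2_eq_square mult_left_le)
  then have "R * (P l j)\<^sup>2 \<le> R * (1 / (1 + 2 * R))" using P R by (intro mult_left_mono) auto
  also have "\<dots> \<le> 1 / 2" using R by (simp add: field_simps)
  finally show "R * (P l j)\<^sup>2 \<le> 1 / 2" .
  have "P l j * (4 * K) \<le> 1 - sqrt \<theta>" using P K_ge by (simp add: pos_le_divide_eq)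
  then show "2 * K * P l j / (1 - sqrt \<theta>) \<le> 1 / 2"
    using \<theta> by (simp add: field_simps)
qed

text \<open>The supremum B of \<open>g\<close> on the interval is finite by the Lipschitz bound.
  Reaching dyadic points by \<open>chain\<close>, and all other points by approximation, gives B <=
  g(a) + B/2 with a the left end, hence B <= 2 g(a).\<close>

lemma growth_good:
  assumes j: "j < 2 ^ l" and small: "P l j \<le> threshold"
    and t: "t \<in> {node T l j..node T l (Suc j)}"
  shows "g t \<le> 2 * g (node T l j)"
proof -
  let ?a = "node T l j" and ?I = "{node T l j..node T l (Suc j)}"
  have I: "?I \<subseteq> {0..T}"
    using node_nonneg[of T l j] node_le[of T "Suc j" l] T j by auto
  have a: "?a \<in> ?I" using t by auto
  have \<Lambda>: "\<Lambda> \<ge> 0" using d_lipschitz[of 0 T] d_nonneg[of 0 T] T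
    by (auto simp: zero_le_mult_iff dest: order_trans)
  have "g s \<le> g ?a + \<Lambda> * T" if "s \<in> ?I" for s
  proof -
    have "s \<in> {0..T}" "?a \<in> {0..T}" using that a I by blast+
    then have "\<Lambda> * \<bar>s - ?a\<bar> \<le> \<Lambda> * T" using \<Lambda> by (intro mult_left_mono) auto
    then show ?thesis using g_le[of ?a s] d_lipschitz[of ?a s] that a I by auto
  qed
  then have bdd: "bdd_above (g ` ?I)"
    by (intro bdd_aboveI[of _ "g ?a + \<Lambda> * T"]) auto
  define B where "B = (SUP s\<in>?I. g s)"
  have B: "g s \<le> B" if "s \<in> ?I" for s using bdd that by (auto simp: B_def intro: cSUP_upper)
  have B0: "B \<ge> 0" by (rule g_bound_nonneg[OF B])
  have *: "g s \<le> g ?a + B / 2" if s: "s \<in> ?I" for s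
  proof (rule field_le_epsilon)
    fix e :: real assume e: "e > 0"
    obtain M where M: "\<Lambda> * T / e < 2 ^ M"
      using real_arch_pow[of 2 "\<Lambda> * T / e"] by auto
    \<comment> \<open>With \<open>i\<close> the integer part of \<open>x\<close>, the dyadic point
      \<open>?r\<close> lies to the left of \<open>s\<close> within T / 2^M, and \<open>M\<close>
      was chosen so that the Lipschitz bound over this distance is at most \<open>e\<close>.\<close>
    define x where "x = (s - ?a) * 2 ^ (l + M) / T"
    define i where "i = nat \<lfloor>x\<rfloor>"
    have x: "0 \<le> x" "x \<le> 2 ^ M"
    proof -
      show "0 \<le> x" using s T by (auto simp: x_def)
      have "s - ?a \<le> T / 2 ^ l" using s node_Suc_diff[of T l j] by auto
      then have "(s - ?a) * 2 ^ (l + M) / T \<le> T / 2 ^ l * 2 ^ (l + M) / T"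
        using T by (intro divide_right_mono mult_right_mono) auto
      then show "x \<le> 2 ^ M" using T by (simp add: x_def power_add)
    qed
    have i: "real i \<le> x" "x < real i + 1" using x by (auto simp: i_def)
    have "real i \<le> 2 ^ M" using i x by linarith
    then have iM: "i \<le> 2 ^ M" by (metis of_nat_le_iff of_nat_numeral of_nat_power)
    let ?r = "node T (l + M) (j * 2 ^ M + i)"
    have r: "?r = ?a + T * real i / 2 ^ (l + M)"
      by (simp add: node_def power_add field_simps)
    have s': "s = ?a + T * x / 2 ^ (l + M)" using T by (simp add: x_def)
    have "s - ?r = T * (x - real i) / 2 ^ (l + M)" unfolding r by (subst s') (simp add: field_simps)
    then have diff: "\<bar>s - ?r\<bar> \<le> T / 2 ^ M"
    proof -
      assume h: "s - ?r = T * (x - real i) / 2 ^ (l + M)"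
      have "T * (x - real i) / 2 ^ (l + M) \<le> T * 1 / 2 ^ M"
        using T i by (intro frac_le mult_left_mono) auto
      moreover have "T * (x - real i) / 2 ^ (l + M) \<ge> 0" using T i by auto
      ultimately show ?thesis using h by simp
    qed
    have rI: "?r \<in> ?I"
    proof -
      have "?r \<le> s" unfolding r by (subst s') (use i T in \<open>auto intro!: divide_right_mono mult_left_mono\<close>)
      then show ?thesis using s T by (auto simp: r)
    qed
    have "g s \<le> g ?r + d ?r s" using g_le rI s I by auto
    also have "g ?r \<le> g ?a + d ?a ?r" using g_le rI a I by auto
    also have "d ?a ?r \<le> 2 * K * B * P l j / (1 - sqrt \<theta>)"
      using chain[OF j B _ iM] threshold_small[OF small] by auto
    also have "\<dots> = B * (2 * K * P l j / (1 - sqrt \<theta>))" by simp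
    also have "\<dots> \<le> B * (1 / 2)"
      using threshold_small[OF small] B0 by (intro mult_left_mono) auto
    also have "d ?r s \<le> \<Lambda> * \<bar>s - ?r\<bar>" using d_lipschitz rI s I by auto
    also have "\<dots> \<le> \<Lambda> * (T / 2 ^ M)" using diff \<Lambda> by (intro mult_left_mono)
    also have "\<dots> \<le> e" using M e by (simp add: field_simps)
    finally show "g s \<le> g ?a + B / 2 + e" by simp
  qed
  have "B \<le> g ?a + B / 2" unfolding B_def using a *[unfolded B_def] by (intro cSUP_least) auto
  then show ?thesis using B[OF t] by simp
qed

text \<open>A stopping argument: bad intervals are halved and good ones are kept, each at the cost
  of a factor 2. In a binary tree the number of kept intervals exceeds the number of halved ones by
  one, hence the exponent 1 + count.\<close>

lemma growth_tree:
  assumes "j < 2 ^ l" and "\<And>i. i < 2 ^ (l + M) \<Longrightarrow> P (l + M) i \<le> threshold"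
    and "t \<in> {node T l j..node T l (Suc j)}"
  shows "g t \<le> 2 powr (1 + tree_sum (\<lambda>l j. of_bool (P l j > threshold)) M l j) * g (node T l j)"
  using assms
proof (induction M arbitrary: l j t)
  case 0
  then show ?case using growth_good[of j l t] by simp
next
  case (Suc M)
  let ?b = "\<lambda>l j. of_bool (P l j > threshold) :: real"
  have nn: "tree_sum ?b M' l' j' \<ge> 0" for M' l' j' by (rule tree_sum_nonneg) simp
  show ?case
  proof (cases "P l j > threshold")
    case False
    then have "g t \<le> 2 powr 1 * g (node T l j)" using growth_good[of j l t] Suc.prems by simp
    also have "\<dots> \<le> 2 powr (1 + tree_sum ?b (Suc M) l j) * g (node T l j)"
      using nn[of "Suc M" l j] g_nonneg by (intro mult_right_mono powr_mono) auto
    finally show ?thesis .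
  next
    case True
    let ?L = "tree_sum ?b M (Suc l) (2*j)" and ?R = "tree_sum ?b M (Suc l) (Suc (2*j))"
    have thr: "\<And>i. i < 2 ^ (Suc l + M) \<Longrightarrow> P (Suc l + M) i \<le> threshold" using Suc.prems by simp
    have L: "g s \<le> 2 powr (1 + ?L) * g (node T l j)" if "s \<in> {node T l j..node T (Suc l) (Suc (2*j))}" for s
      using Suc.IH[OF child_less(1)[OF Suc.prems(1)] thr, of s] that by simp
    have "g t \<le> 2 powr (1 + (1 + ?L + ?R)) * g (node T l j)"
    proof (cases "t \<le> node T (Suc l) (Suc (2*j))")
      case True
      then have "g t \<le> 2 powr (1 + ?L) * g (node T l j)" using Suc.prems L by auto
      also have "\<dots> \<le> 2 powr (1 + (1 + ?L + ?R)) * g (node T l j)"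
        using nn[of M "Suc l" "Suc (2*j)"] g_nonneg by (intro mult_right_mono powr_mono) auto
      finally show ?thesis .
    next
      case False
      have "node T (Suc l) (Suc (Suc (2 * j))) = node T l (Suc j)"
        using node_child[of T l "Suc j"] by simp
      then have "g t \<le> 2 powr (1 + ?R) * g (node T (Suc l) (Suc (2*j)))"
        using Suc.IH[OF child_less(2)[OF Suc.prems(1)] thr, of t] False Suc.prems by simp
      also have "\<dots> \<le> 2 powr (1 + ?R) * (2 powr (1 + ?L) * g (node T l j))"
        using L[of "node T (Suc l) (Suc (2*j))"] child_interval(1)[of l j] T
          node_mono[of T "2*j" "Suc (2*j)" "Suc l"] by (intro mult_left_mono) auto
      also have "\<dots> = 2 powr (1 + (1 + ?L + ?R)) * g (node T l j)"
        by (simp add: algebra_simps flip: powr_add)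
      finally show ?thesis .
    qed
    then show ?thesis using True by simp
  qed
qed

lemma P_level: "j < 2 ^ l \<Longrightarrow> P l j \<le> sqrt \<theta> ^ l * P 0 0"
proof (induction l arbitrary: j)
  case (Suc l)
  have j: "j div 2 < 2 ^ l" "j \<in> {2 * (j div 2), Suc (2 * (j div 2))}" using Suc.prems by auto
  have "P (Suc l) j \<le> sqrt \<theta> * P l (j div 2)" by (rule P_child[OF j])
  also have "\<dots> \<le> sqrt \<theta> * (sqrt \<theta> ^ l * P 0 0)" using Suc.IH[OF j(1)] \<theta> by (intro mult_left_mono) auto
  finally show ?case by simp
qed simp

text \<open>By contraction the controls tend to zero uniformly on each level, so all intervals are
  good from some depth on and the stopping argument terminates.\<close>

lemma growth:
  assumes "\<And>M. tree_sum (\<lambda>l j. of_bool (P l j > threshold)) M 0 0 \<le> b" and "t \<in> {0..T}"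
  shows "g t \<le> 2 powr (1 + b) * g 0"
proof -
  have "(\<lambda>l. sqrt \<theta> ^ l * P 0 0) \<longlonglongrightarrow> 0 * P 0 0"
    using \<theta> by (intro tendsto_intros LIMSEQ_realpow_zero) auto
  then have "\<forall>\<^sub>F l in sequentially. sqrt \<theta> ^ l * P 0 0 < threshold"
    using threshold_pos by (intro order_tendstoD) auto
  then obtain M where M: "sqrt \<theta> ^ M * P 0 0 < threshold" by (auto simp: eventually_sequentially)
  have "g t \<le> 2 powr (1 + tree_sum (\<lambda>l j. of_bool (P l j > threshold)) M 0 0) * g (node T 0 0)"
    using M assms(2) P_level by (intro growth_tree) (force simp: order.trans[OF _ less_imp_le])+
  also have "\<dots> \<le> 2 powr (1 + b) * g (node T 0 0)"
    using assms(1)[of M] g_nonneg by (intro mult_right_mono powr_mono) auto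
  finally show ?thesis by simp
qed

end

section \<open>Square integrable functions on the torus\<close>

lemma sets_torus: "sets torus = sets (restrict_space lborel {0..<2 * pi})"
  by (simp add: torus_def)

lemma space_torus [simp]: "space torus = {0..<2 * pi}"
  by (simp add: torus_def space_scale_measure)

lemma borel_measurable_torus: "f \<in> borel_measurable borel \<Longrightarrow> f \<in> borel_measurable torus"
  by (subst measurable_cong_sets[OF sets_torus refl]) (simp add: measurable_restrict_space1)

lemma emeasure_torus_space: "emeasure torus (space torus) = 1"
  by (simp add: torus_def space_scale_measure emeasure_restrict_space flip: ennreal_mult')

interpretation torus: prob_space torus
  by standard (rule emeasure_torus_space)

lemma torus_eq_density:
  "torus = density (restrict_space lborel {0..<2 * pi}) (\<lambda>_. ennreal (1 / (2 * pi)))"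
  by (rule measure_eqI) (auto simp: torus_def emeasure_density nn_integral_cmult)

lemma integral_torus:
  fixes f :: "real \<Rightarrow> 'b::{banach, second_countable_topology}"
  assumes "f \<in> borel_measurable torus"
  shows "(LINT x|torus. f x) = (1 / (2 * pi)) *\<^sub>R (LINT x:{0..<2 * pi}|lborel. f x)"
proof -
  have "f \<in> borel_measurable (restrict_space lborel {0..<2 * pi})"
    using assms by (subst measurable_cong_sets[OF sets_torus[symmetric] refl])
  then show ?thesis
    unfolding torus_eq_density
    by (subst integral_density) (auto simp: integral_restrict_space set_lebesgue_integral_def)
qed

lemma AE_torus_iff: "(AE x in torus. P x) \<longleftrightarrow> (AE x in lborel. x \<in> {0..<2 * pi} \<longrightarrow> P x)"
  unfolding torus_eq_density by (subst AE_density) (auto simp: AE_restrict_space_iff)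

section \<open>Exponentials and their orthonormality\<close>

definition emode :: "int \<Rightarrow> real \<Rightarrow> complex" where
  "emode n x = exp (\<i> * of_int n * complex_of_real x)"

lemma cnj_borel_measurable [measurable]: "cnj \<in> borel_measurable borel"
  by (intro borel_measurable_continuous_onI continuous_intros)

lemma emode_measurable [measurable]: "emode n \<in> borel_measurable borel"
  unfolding emode_def by measurable

lemma emode_measurable_torus [measurable]: "emode n \<in> borel_measurable torus"
  by (rule borel_measurable_torus) simp

lemma norm_emode [simp]: "cmod (emode n x) = 1"
  by (simp add: emode_def)

lemma emode_mult: "emode n x * emode m x = emode (n + m) x"
  by (simp add: emode_def algebra_simps flip: exp_add)

lemma cnj_emode: "cnj (emode n x) = emode (- n) x"
  by (simp add: emode_def exp_cnj)

lemma integral_emode: "(LINT x|torus. emode n x) = of_bool (n = 0)"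
proof (cases "n = 0")
  case True
  then show ?thesis by (simp add: emode_def torus.prob_space[simplified])
next
  case False
  let ?F = "\<lambda>x. exp (\<i> * of_int n * complex_of_real x) / (\<i> * of_int n)"
  have "(?F has_vector_derivative emode n x) (at x within {0..2 * pi})" for x
    unfolding emode_def using False
    by (auto intro!: derivative_eq_intros has_vector_derivative_real_field simp: field_simps)
  then have "(LBINT x:{0..2 * pi}. emode n x) = ?F (2 * pi) - ?F 0"
    unfolding set_lebesgue_integral_def
    by (intro integral_FTC_atLeastAtMost) (auto simp: emode_def intro!: continuous_intros)
  also have "exp (\<i> * of_int n * complex_of_real (2 * pi)) = 1"
    using exp_integer_2pi[of "of_int n"] by (simp add: mult_ac)
  finally have "(LBINT x:{0..2 * pi}. emode n x) = 0" by simp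
  also have "(LBINT x:{0..2 * pi}. emode n x) = (LBINT x:{0..<2 * pi}. emode n x)"
    using AE_lborel_singleton[of "2 * pi"]
    by (intro set_integral_cong_set) (auto simp: set_borel_measurable_def elim!: eventually_mono)
  finally show ?thesis using False by (simp add: integral_torus)
qed

lemma L2_torus_measurable: "f \<in> L2_torus \<Longrightarrow> f \<in> borel_measurable torus"
  by (simp add: L2_torus_def)

lemma L2_torusI:
  assumes "f \<in> borel_measurable torus" "\<And>x. x \<in> {0..<2 * pi} \<Longrightarrow> cmod (f x) \<le> B"
  shows "f \<in> L2_torus"
proof -
  have "integrable torus (\<lambda>x. (cmod (f x))\<^sup>2)"
    using assms by (intro torus.integrable_const_bound[where B = "B\<^sup>2"]) (auto intro!: power_mono)
  then show ?thesis using assms by (simp add: L2_torus_def)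
qed

lemma emode_L2 [simp]: "emode n \<in> L2_torus"
  by (rule L2_torusI[where B = 1]) auto

lemma L2_torus_mult_integrable:
  assumes "f \<in> L2_torus" "g \<in> L2_torus"
  shows "integrable torus (\<lambda>x. f x * cnj (g x))"
proof (rule Bochner_Integration.integrable_bound)
  show "integrable torus (\<lambda>x. (cmod (f x))\<^sup>2 + (cmod (g x))\<^sup>2)"
    using assms by (auto simp: L2_torus_def)
  show "(\<lambda>x. f x * cnj (g x)) \<in> borel_measurable torus"
    using assms[THEN L2_torus_measurable] by measurable
  have "a * b \<le> a\<^sup>2 + b\<^sup>2" if "a \<ge> 0" "b \<ge> 0" for a b :: real
    using sum_squares_bound[of a b] mult_nonneg_nonneg[OF that] by linarith
  then show "AE x in torus. norm (f x * cnj (g x)) \<le> norm ((cmod (f x))\<^sup>2 + (cmod (g x))\<^sup>2)"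
    by (simp add: norm_mult)
qed

lemma L2_torus_add:
  assumes "f \<in> L2_torus" "g \<in> L2_torus"
  shows "(\<lambda>x. f x + g x) \<in> L2_torus"
proof -
  have "integrable torus (\<lambda>x. (cmod (f x + g x))\<^sup>2)"
  proof (rule Bochner_Integration.integrable_bound)
    show "integrable torus (\<lambda>x. 2 * (cmod (f x))\<^sup>2 + 2 * (cmod (g x))\<^sup>2)"
      using assms by (auto simp: L2_torus_def)
    show "(\<lambda>x. (cmod (f x + g x))\<^sup>2) \<in> borel_measurable torus"
      using assms[THEN L2_torus_measurable] by measurable
    have "(cmod (a + b))\<^sup>2 \<le> 2 * (cmod a)\<^sup>2 + 2 * (cmod b)\<^sup>2" for a b
    proof -
      have "(cmod (a + b))\<^sup>2 \<le> (cmod a + cmod b)\<^sup>2" by (intro power_mono norm_triangle_ineq) auto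
      also have "\<dots> \<le> 2 * (cmod a)\<^sup>2 + 2 * (cmod b)\<^sup>2"
        using sum_squares_bound[of "cmod a" "cmod b"] by (simp add: power2_sum)
      finally show ?thesis .
    qed
    then show "AE x in torus. norm ((cmod (f x + g x))\<^sup>2) \<le> norm (2 * (cmod (f x))\<^sup>2 + 2 * (cmod (g x))\<^sup>2)"
      by simp
  qed
  then show ?thesis using assms by (auto simp: L2_torus_def)
qed

lemma L2_torus_mult_bounded:
  assumes "f \<in> L2_torus" "W \<in> borel_measurable torus" "\<And>x. x \<in> {0..<2 * pi} \<Longrightarrow> cmod (W x) \<le> N"
  shows "(\<lambda>x. W x * f x) \<in> L2_torus" "(LINT x|torus. (cmod (W x * f x))\<^sup>2) \<le> N\<^sup>2 * (LINT x|torus. (cmod (f x))\<^sup>2)"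
proof -
  have N: "(cmod (W x))\<^sup>2 \<le> N\<^sup>2" if "x \<in> {0..<2 * pi}" for x using assms(3)[OF that] by (intro power_mono) auto
  have i: "integrable torus (\<lambda>x. (cmod (f x))\<^sup>2)" using assms by (auto simp: L2_torus_def)
  have *: "integrable torus (\<lambda>x. (cmod (W x * f x))\<^sup>2)"
  proof (rule Bochner_Integration.integrable_bound)
    show "integrable torus (\<lambda>x. N\<^sup>2 * (cmod (f x))\<^sup>2)" using i by simp
    show "(\<lambda>x. (cmod (W x * f x))\<^sup>2) \<in> borel_measurable torus"
      using assms(2) assms(1)[THEN L2_torus_measurable] by measurable
    show "AE x in torus. norm ((cmod (W x * f x))\<^sup>2) \<le> norm (N\<^sup>2 * (cmod (f x))\<^sup>2)"
      using N by (intro AE_I2) (auto simp: norm_mult power_mult_distrib intro!: mult_right_mono)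
  qed
  then show "(\<lambda>x. W x * f x) \<in> L2_torus" using assms by (auto simp: L2_torus_def)
  have "(LINT x|torus. (cmod (W x * f x))\<^sup>2) \<le> (LINT x|torus. N\<^sup>2 * (cmod (f x))\<^sup>2)"
    using N i * by (intro integral_mono) (auto simp: norm_mult power_mult_distrib intro!: mult_right_mono)
  then show "(LINT x|torus. (cmod (W x * f x))\<^sup>2) \<le> N\<^sup>2 * (LINT x|torus. (cmod (f x))\<^sup>2)" by simp
qed

lemma L2_torus_cmult: "f \<in> L2_torus \<Longrightarrow> (\<lambda>x. c * f x) \<in> L2_torus"
  by (rule L2_torus_mult_bounded[of f "\<lambda>x. c" "cmod c"]) auto

lemma L2_torus_sum: "finite F \<Longrightarrow> (\<And>n. n \<in> F \<Longrightarrow> f n \<in> L2_torus) \<Longrightarrow> (\<lambda>x. \<Sum>n\<in>F. f n x) \<in> L2_torus"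
proof (induction F rule: finite_induct)
  case empty
  then show ?case by (auto intro: L2_torusI[where B = 0])
next
  case (insert n F)
  then show ?case using L2_torus_add[of "f n" "\<lambda>x. \<Sum>n\<in>F. f n x"] by auto
qed

lemma L2_torus_diff: "f \<in> L2_torus \<Longrightarrow> g \<in> L2_torus \<Longrightarrow> (\<lambda>x. f x - g x) \<in> L2_torus"
  using L2_torus_add[of f "\<lambda>x. - 1 * g x"] L2_torus_cmult[of g "- 1"] by simp

section \<open>Inner product, Bessel's inequality and the triangle inequality\<close>

lemma fourier_coeff_eq: "fourier_coeff f n = L2_inner f (emode n)"
  by (simp add: fourier_coeff_def L2_inner_def emode_def exp_cnj)

lemma L2_inner_add: "f \<in> L2_torus \<Longrightarrow> g \<in> L2_torus \<Longrightarrow> h \<in> L2_torus \<Longrightarrow>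
    L2_inner (\<lambda>x. f x + g x) h = L2_inner f h + L2_inner g h"
  unfolding L2_inner_def by (simp add: L2_torus_mult_integrable distrib_right)

lemma L2_inner_cmult: "L2_inner (\<lambda>x. c * f x) h = c * L2_inner f h"
  unfolding L2_inner_def by (simp add: mult.assoc)

lemma L2_inner_diff: "f \<in> L2_torus \<Longrightarrow> g \<in> L2_torus \<Longrightarrow> h \<in> L2_torus \<Longrightarrow>
    L2_inner (\<lambda>x. f x - g x) h = L2_inner f h - L2_inner g h"
  unfolding L2_inner_def by (simp add: L2_torus_mult_integrable left_diff_distrib)

lemma L2_inner_cnj: "L2_inner g f = cnj (L2_inner f g)"
proof -
  have "cnj (L2_inner f g) = (LINT x|torus. cnj (f x * cnj (g x)))"
    unfolding L2_inner_def by (simp del: complex_cnj_mult)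
  also have "\<dots> = L2_inner g f"
    unfolding L2_inner_def by (intro Bochner_Integration.integral_cong refl) (simp only: complex_cnj_mult complex_cnj_cnj mult.commute)
  finally show ?thesis ..
qed

lemma L2_inner_sum: "finite F \<Longrightarrow> (\<And>n. n \<in> F \<Longrightarrow> f n \<in> L2_torus) \<Longrightarrow> h \<in> L2_torus \<Longrightarrow>
    L2_inner (\<lambda>x. \<Sum>n\<in>F. f n x) h = (\<Sum>n\<in>F. L2_inner (f n) h)"
proof (induction F rule: finite_induct)
  case empty
  then show ?case by (simp add: L2_inner_def)
next
  case (insert n F)
  then show ?case using L2_inner_add[of "f n" "\<lambda>x. \<Sum>n\<in>F. f n x"] L2_torus_sum[of F f] by auto
qed

lemma L2_inner_self: "L2_inner f f = of_real ((L2_norm f)\<^sup>2)"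
  unfolding L2_inner_def L2_norm_def complex_norm_square[symmetric] integral_complex_of_real by simp

lemma L2_norm_nonneg: "L2_norm f \<ge> 0"
  by (simp add: L2_norm_def)

lemma L2_norm_power2: "(L2_norm f)\<^sup>2 = (LINT x|torus. (cmod (f x))\<^sup>2)"
  by (simp add: L2_norm_def)

lemma L2_norm_mult_bounded:
  assumes "f \<in> L2_torus" "W \<in> borel_measurable torus" "\<And>x. x \<in> {0..<2 * pi} \<Longrightarrow> cmod (W x) \<le> N" "N \<ge> 0"
  shows "L2_norm (\<lambda>x. W x * f x) \<le> N * L2_norm f"
proof -
  have "(L2_norm (\<lambda>x. W x * f x))\<^sup>2 \<le> (N * L2_norm f)\<^sup>2"
    using L2_torus_mult_bounded(2)[OF assms(1-3)] by (simp add: L2_norm_power2 power_mult_distrib)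
  then show ?thesis by (rule power2_le_imp_le) (use assms L2_norm_nonneg in auto)
qed

lemma emode_orthonormal: "L2_inner (emode n) (emode m) = of_bool (n = m)"
  by (simp add: L2_inner_def cnj_emode emode_mult integral_emode)

lemma trig_poly_L2: "finite F \<Longrightarrow> (\<lambda>x. \<Sum>n\<in>F. c n * emode n x) \<in> L2_torus"
  by (intro L2_torus_sum L2_torus_cmult) auto

lemma fourier_coeff_trig_poly:
  "finite F \<Longrightarrow> fourier_coeff (\<lambda>x. \<Sum>n\<in>F. c n * emode n x) m = (if m \<in> F then c m else 0)"
  by (simp add: fourier_coeff_eq L2_inner_sum L2_torus_cmult L2_inner_cmult emode_orthonormal
      if_distrib[of "\<lambda>x. _ * x"] of_bool_def sum.delta cong: if_cong)

lemma L2_norm_diff_power2: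
  assumes "f \<in> L2_torus" "g \<in> L2_torus"
  shows "(L2_norm (\<lambda>x. f x - g x))\<^sup>2 = (L2_norm f)\<^sup>2 - 2 * Re (L2_inner f g) + (L2_norm g)\<^sup>2"
proof -
  have "L2_inner (\<lambda>x. f x - g x) (\<lambda>x. f x - g x) =
    L2_inner f f - L2_inner f g - (L2_inner g f - L2_inner g g)"
    using assms L2_torus_diff[OF assms]
    by (subst L2_inner_diff, simp_all, subst (1 2) L2_inner_cnj) (simp add: L2_inner_diff L2_inner_self, metis L2_inner_cnj complex_cnj_cnj)
  then have "Re (L2_inner (\<lambda>x. f x - g x) (\<lambda>x. f x - g x)) =
    Re (L2_inner f f) - Re (L2_inner f g) - (Re (L2_inner g f) - Re (L2_inner g g))" by simp
  moreover have "Re (L2_inner g f) = Re (L2_inner f g)" by (subst L2_inner_cnj) simp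
  ultimately show ?thesis unfolding L2_inner_self by simp
qed

lemma L2_inner_trig_poly:
  assumes "finite F" "f \<in> L2_torus"
  shows "L2_inner f (\<lambda>x. \<Sum>n\<in>F. c n * emode n x) = (\<Sum>n\<in>F. cnj (c n) * fourier_coeff f n)"
  using assms by (subst L2_inner_cnj) (simp add: L2_inner_sum L2_torus_cmult L2_inner_cmult
     fourier_coeff_eq L2_inner_cnj[of f])

lemma L2_norm_trig_poly:
  assumes "finite F"
  shows "(L2_norm (\<lambda>x. \<Sum>n\<in>F. c n * emode n x))\<^sup>2 = (\<Sum>n\<in>F. (cmod (c n))\<^sup>2)"
proof -
  have "complex_of_real ((L2_norm (\<lambda>x. \<Sum>n\<in>F. c n * emode n x))\<^sup>2) = of_real (\<Sum>n\<in>F. (cmod (c n))\<^sup>2)"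
    unfolding L2_inner_self[symmetric] using assms
    by (simp add: L2_inner_trig_poly trig_poly_L2 fourier_coeff_trig_poly mult.commute complex_norm_square del: of_real_power)
  then show ?thesis by (simp only: of_real_eq_iff)
qed

text \<open>Completing the square. With the Fourier coefficients as \<open>c\<close> it yields
  Bessel's inequality; for arbitrary \<open>c\<close> it says that no trigonometric polynomial over
  \<open>F\<close> is closer to \<open>f\<close> than the partial sum, which is the key to
  Parseval.\<close>

lemma L2_norm_diff_trig_poly:
  assumes "finite F" "f \<in> L2_torus"
  shows "(L2_norm (\<lambda>x. f x - (\<Sum>n\<in>F. c n * emode n x)))\<^sup>2 =
    (L2_norm f)\<^sup>2 - (\<Sum>n\<in>F. (cmod (fourier_coeff f n))\<^sup>2) + (\<Sum>n\<in>F. (cmod (fourier_coeff f n - c n))\<^sup>2)"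
proof -
  have "(cmod (a - b))\<^sup>2 = (cmod a)\<^sup>2 - 2 * Re (cnj b * a) + (cmod b)\<^sup>2" for a b
    unfolding cmod_power2 by (simp add: power2_eq_square algebra_simps)
  then have "(\<Sum>n\<in>F. (cmod (fourier_coeff f n - c n))\<^sup>2) = (\<Sum>n\<in>F. (cmod (fourier_coeff f n))\<^sup>2)
      - 2 * (\<Sum>n\<in>F. Re (cnj (c n) * fourier_coeff f n)) + (\<Sum>n\<in>F. (cmod (c n))\<^sup>2)"
    by (simp add: sum.distrib sum_subtractf sum_distrib_left del: Re_divide times_complex.sel)
  then show ?thesis
    using assms by (simp add: L2_norm_diff_power2 trig_poly_L2 L2_inner_trig_poly L2_norm_trig_poly del: times_complex.sel)
qed

lemma bessel:
  assumes "finite F" "f \<in> L2_torus"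
  shows "(\<Sum>n\<in>F. (cmod (fourier_coeff f n))\<^sup>2) \<le> (L2_norm f)\<^sup>2"
  using L2_norm_diff_trig_poly[OF assms, of "fourier_coeff f"]
    zero_le_power2[of "L2_norm (\<lambda>x. f x - (\<Sum>n\<in>F. fourier_coeff f n * emode n x))"] by simp

text \<open>Integrate |a + b|^2 <= (1 + r) |a|^2 + (1 + 1/r) |b|^2 and optimize in r.\<close>

lemma L2_norm_triangle:
  assumes "f \<in> L2_torus" "g \<in> L2_torus"
  shows "L2_norm (\<lambda>x. f x + g x) \<le> L2_norm f + L2_norm g"
proof -
  have i: "integrable torus (\<lambda>x. (cmod (f x))\<^sup>2)" "integrable torus (\<lambda>x. (cmod (g x))\<^sup>2)"
    using assms by (auto simp: L2_torus_def)
  have m: "f \<in> borel_measurable torus" "g \<in> borel_measurable torus" using assms L2_torus_measurable by auto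
  have s: "(LINT x|torus. (cmod (f x + g x))\<^sup>2) \<le> (1 + r) * (L2_norm f)\<^sup>2 + (1 + 1 / r) * (L2_norm g)\<^sup>2"
    if "r > 0" for r
  proof -
    have p: "(cmod (a + b))\<^sup>2 \<le> (1 + r) * (cmod a)\<^sup>2 + (1 + 1 / r) * (cmod b)\<^sup>2" for a b
    proof -
      have "(cmod (a + b))\<^sup>2 \<le> (cmod a + cmod b)\<^sup>2" by (intro power_mono norm_triangle_ineq) auto
      moreover have "0 \<le> (sqrt r * cmod a - cmod b / sqrt r)\<^sup>2" by simp
      ultimately show ?thesis using that by (simp add: power2_sum power2_diff power_mult_distrib power_divide algebra_simps)
    qed
    have "(LINT x|torus. (cmod (f x + g x))\<^sup>2) \<le> (LINT x|torus. (1 + r) * (cmod (f x))\<^sup>2 + (1 + 1 / r) * (cmod (g x))\<^sup>2)"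
      using L2_torus_add[OF assms] i by (intro integral_mono p) (auto simp: L2_torus_def)
    then show ?thesis using i by (simp add: L2_norm_power2)
  qed
  show ?thesis
  proof (rule field_le_epsilon)
    fix e :: real assume e: "e > 0"
    \<comment> \<open>The best r is the quotient of the two norms; adding e/2 to both keeps it
      defined when a norm vanishes.\<close>
    define a b where "a = L2_norm f + e / 2" and "b = L2_norm g + e / 2"
    have ab: "a > 0" "b > 0" "L2_norm f \<le> a" "L2_norm g \<le> b"
      using e L2_norm_nonneg[of f] L2_norm_nonneg[of g] unfolding a_def b_def by linarith+
    have "(L2_norm (\<lambda>x. f x + g x))\<^sup>2 \<le> (1 + b / a) * (L2_norm f)\<^sup>2 + (1 + 1 / (b / a)) * (L2_norm g)\<^sup>2"
      using s[of "b / a"] ab by (simp add: L2_norm_power2)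
    also have "\<dots> \<le> (1 + b / a) * a\<^sup>2 + (1 + 1 / (b / a)) * b\<^sup>2"
      using ab L2_norm_nonneg by (intro add_mono mult_left_mono power_mono) auto
    also have "\<dots> = (a + b)\<^sup>2" using ab by (simp add: power2_eq_square field_simps)
    finally have "L2_norm (\<lambda>x. f x + g x) \<le> a + b"
      by (rule power2_le_imp_le) (use ab in linarith)
    then show "L2_norm (\<lambda>x. f x + g x) \<le> L2_norm f + L2_norm g + e" by (simp add: a_def b_def)
  qed
qed

section \<open>Parseval's identity\<close>

definition trig_poly :: "(real \<Rightarrow> complex) \<Rightarrow> bool" where
  "trig_poly q \<longleftrightarrow> (\<exists>F c. finite F \<and> q = (\<lambda>x. \<Sum>n\<in>F. c n * emode n x))"

lemma trig_poly_add:
  assumes "trig_poly p" "trig_poly q" shows "trig_poly (\<lambda>x. p x + q x)"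
proof -
  obtain F c where F: "finite F" "p = (\<lambda>x. \<Sum>n\<in>F. c n * emode n x)" using assms by (auto simp: trig_poly_def)
  obtain G d where G: "finite G" "q = (\<lambda>x. \<Sum>n\<in>G. d n * emode n x)" using assms by (auto simp: trig_poly_def)
  have "p x = (\<Sum>n\<in>F \<union> G. (if n \<in> F then c n else 0) * emode n x)" for x
    unfolding F(2) using F(1) G(1) by (intro sum.mono_neutral_cong_left) auto
  moreover have "q x = (\<Sum>n\<in>F \<union> G. (if n \<in> G then d n else 0) * emode n x)" for x
    unfolding G(2) using F(1) G(1) by (intro sum.mono_neutral_cong_left) auto
  ultimately have *: "(\<lambda>x. p x + q x) = (\<lambda>x. \<Sum>n\<in>F \<union> G. ((if n \<in> F then c n else 0) + (if n \<in> G then d n else 0)) * emode n x)"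
    by (simp add: sum.distrib distrib_right)
  show ?thesis unfolding trig_poly_def
  proof (intro exI conjI)
    show "finite (F \<union> G)" using F(1) G(1) by simp
  qed (rule *)
qed

lemma trig_poly_emode_mult: "trig_poly p \<Longrightarrow> trig_poly (\<lambda>x. a * emode n x * p x)"
proof -
  assume "trig_poly p"
  then obtain F c where F: "finite F" "p = (\<lambda>x. \<Sum>n\<in>F. c n * emode n x)" by (auto simp: trig_poly_def)
  have *: "a * emode n x * p x = (\<Sum>k\<in>(+) n ` F. (a * c (k - n)) * emode k x)" for x
    unfolding F(2) by (subst sum.reindex) (auto simp: sum_distrib_left emode_mult[symmetric] mult_ac)
  show ?thesis unfolding trig_poly_def
  proof (intro exI conjI)
    show "finite ((+) n ` F)" using F(1) by simp
  qed (rule ext, rule *)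
qed

lemma trig_poly_emode: "trig_poly (\<lambda>x. a * emode n x)"
  unfolding trig_poly_def by (intro exI[of _ "{n}"] exI[of _ "\<lambda>_. a"]) auto

lemma trig_poly_const: "trig_poly (\<lambda>x. a)"
  using trig_poly_emode[of a 0] by (simp add: emode_def)

lemma trig_poly_mult:
  assumes "trig_poly p" "trig_poly q" shows "trig_poly (\<lambda>x. p x * q x)"
proof -
  obtain F c where F: "finite F" "p = (\<lambda>x. \<Sum>n\<in>F. c n * emode n x)" using assms by (auto simp: trig_poly_def)
  have "trig_poly (\<lambda>x. (\<Sum>n\<in>F. c n * emode n x) * q x)"
    using F(1)
  proof induction
    case empty
    then show ?case using trig_poly_const[of 0] by simp
  next
    case (insert n F)
    then show ?case
      using trig_poly_add[OF trig_poly_emode_mult[OF assms(2), of "c n" n] insert.IH] by (simp add: distrib_right)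
  qed
  then show ?thesis using F by simp
qed

lemma trig_poly_L2_torus: "trig_poly p \<Longrightarrow> p \<in> L2_torus"
  by (auto simp: trig_poly_def trig_poly_L2)

lemma emode_cis: "emode n x = cis (of_int n * x)"
  by (simp add: emode_def cis_conv_exp mult_ac)

text \<open>Stone-Weierstrass on the unit circle, where \<open>Re\<close> and \<open>Im\<close>
  separate points and are trigonometric polynomials in the angle. The equality of the end values
  makes \<open>g\<close> descend to a function \<open>G\<close> on the circle. \<open>G\<close> is
  continuous because the preimage of a closed set under it is the image under \<open>cis\<close> of
  a compact set.\<close>

lemma trig_poly_uniform_approx_real:
  fixes g :: "real \<Rightarrow> real"
  assumes g: "continuous_on {0..2 * pi} g" "g 0 = g (2 * pi)" and e: "e > 0"
  shows "\<exists>q. trig_poly q \<and> (\<forall>x\<in>{0..<2 * pi}. cmod (of_real (g x) - q x) < e)"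
proof -
  define G where "G z = g (Arg2pi z)" for z
  have Arg: "Arg2pi (cis x) = x" if "x \<in> {0..<2 * pi}" for x
    using that by (intro Arg2pi_unique[of 1]) (auto simp: cis_conv_exp mult_ac)
  have Gcis: "G (cis x) = g x" if "x \<in> {0..2 * pi}" for x
  proof (cases "x = 2 * pi")
    case True
    have "G (cis x) = G (cis 0)" using True by simp
    then show ?thesis using Arg[of 0] True g by (simp add: G_def)
  next
    case False
    then show ?thesis using that by (simp add: G_def Arg)
  qed
  have sph: "\<exists>x\<in>{0..<2 * pi}. z = cis x" if "z \<in> sphere 0 1" for z
    using that Arg2pi[of z] by (intro bexI[of _ "Arg2pi z"]) (auto simp: is_Arg_def cis_conv_exp mult_ac)
  have contG: "continuous_on (sphere 0 1) G"
    unfolding continuous_on_closed_vimage[OF closed_sphere]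
  proof (intro allI impI)
    fix B :: "real set" assume "closed B"
    have "G -` B \<inter> sphere 0 1 = cis ` ({0..2 * pi} \<inter> g -` B)"
    proof safe
      fix z assume z: "z \<in> sphere (0::complex) 1" "G z \<in> B"
      then obtain x where "x \<in> {0..<2 * pi}" "z = cis x" using sph by blast
      then show "z \<in> cis ` ({0..2 * pi} \<inter> g -` B)" using z Gcis by auto
    qed (use Gcis in auto)
    moreover have "compact ({0..2 * pi} \<inter> g -` B)"
      using continuous_closed_preimage[OF g(1) _ \<open>closed B\<close>] compact_Icc
      by (metis closed_atLeastAtMost compact_Int_closed inf_left_idem)
    then have "compact (cis ` ({0..2 * pi} \<inter> g -` B))"
      by (intro compact_continuous_image continuous_intros)
    ultimately show "closed (G -` B \<inter> sphere 0 1)" by (simp add: compact_imp_closed)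
  qed
  define P where "P h \<longleftrightarrow> continuous_on (sphere 0 1) h \<and> trig_poly (\<lambda>x. of_real (h (cis x)))" for h
  have "\<exists>h. P h \<and> (\<forall>z\<in>sphere 0 1. \<bar>G z - h z\<bar> < e)"
  proof (rule Stone_Weierstrass_HOL[OF _ _ _ _ _ _ contG e])
    show "P (\<lambda>x. c)" for c by (auto simp: P_def trig_poly_const)
    show "P h \<Longrightarrow> continuous_on (sphere 0 1) h" for h by (simp add: P_def)
    show "P h \<and> P k \<Longrightarrow> P (\<lambda>x. h x + k x)" for h k
      by (auto simp: P_def intro!: continuous_intros dest: trig_poly_add)
    show "P h \<and> P k \<Longrightarrow> P (\<lambda>x. h x * k x)" for h k
      by (auto simp: P_def intro!: continuous_intros dest: trig_poly_mult)
    fix x y :: complex assume xy: "x \<in> sphere 0 1 \<and> y \<in> sphere 0 1 \<and> x \<noteq> y"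
    have Re_cis: "of_real (Re (cis t)) = 1 / 2 * emode 1 t + 1 / 2 * emode (- 1) t" for t
      by (simp add: emode_cis complex_eq_iff)
    have "P Re" unfolding P_def Re_cis by (intro conjI continuous_intros trig_poly_add trig_poly_emode)
    have Im_cis: "of_real (Im (cis t)) = (- \<i> / 2) * emode 1 t + (\<i> / 2) * emode (- 1) t" for t
      by (simp add: emode_cis complex_eq_iff)
    have "P Im" unfolding P_def Im_cis by (intro conjI continuous_intros trig_poly_add trig_poly_emode)
    then show "\<exists>f. P f \<and> f x \<noteq> f y" using \<open>P Re\<close> xy complex_eq_iff by blast
  qed auto
  then obtain h where h: "P h" "\<And>z. z \<in> sphere 0 1 \<Longrightarrow> \<bar>G z - h z\<bar> < e" by blast
  have "cmod (of_real (g x) - of_real (h (cis x))) < e" if "x \<in> {0..<2 * pi}" for x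
    using h(2)[of "cis x"] Gcis[of x] that by (simp flip: of_real_diff)
  then show ?thesis using h(1) unfolding P_def by blast
qed

lemma trig_poly_uniform_approx:
  fixes g :: "real \<Rightarrow> complex"
  assumes g: "continuous_on {0..2 * pi} g" "g 0 = g (2 * pi)" and e: "e > 0"
  shows "\<exists>q. trig_poly q \<and> (\<forall>x\<in>{0..<2 * pi}. cmod (g x - q x) < e)"
proof -
  have g': "continuous_on {0..2 * pi} (\<lambda>x. Re (g x))" "continuous_on {0..2 * pi} (\<lambda>x. Im (g x))"
    using g by (auto intro: continuous_intros)
  have e2: "e / 2 > 0" using e by simp
  obtain q1 where q1: "trig_poly q1" "\<And>x. x \<in> {0..<2 * pi} \<Longrightarrow> cmod (of_real (Re (g x)) - q1 x) < e / 2"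
    using trig_poly_uniform_approx_real[OF g'(1) _ e2] g(2) by metis
  obtain q2 where q2: "trig_poly q2" "\<And>x. x \<in> {0..<2 * pi} \<Longrightarrow> cmod (of_real (Im (g x)) - q2 x) < e / 2"
    using trig_poly_uniform_approx_real[OF g'(2) _ e2] g(2) by metis
  have "cmod (g x - (q1 x + \<i> * q2 x)) < e" if "x \<in> {0..<2 * pi}" for x
  proof -
    have "g x - (q1 x + \<i> * q2 x) = (of_real (Re (g x)) - q1 x) + \<i> * (of_real (Im (g x)) - q2 x)"
      by (subst complex_eq[of "g x"]) (simp add: algebra_simps)
    then have "cmod (g x - (q1 x + \<i> * q2 x)) \<le> cmod (of_real (Re (g x)) - q1 x) + cmod (\<i> * (of_real (Im (g x)) - q2 x))"
      by (metis norm_triangle_ineq)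
    also have "\<dots> < e / 2 + e / 2" using q1(2)[OF that] q2(2)[OF that] by (simp add: norm_mult)
    finally show ?thesis by simp
  qed
  moreover have "trig_poly (\<lambda>x. q1 x + \<i> * q2 x)"
    by (intro trig_poly_add trig_poly_mult trig_poly_const q1 q2)
  ultimately show ?thesis by blast
qed

lemma L2_norm_le:
  assumes "f \<in> borel_measurable torus" "\<And>x. x \<in> {0..<2 * pi} \<Longrightarrow> cmod (f x) \<le> B" "B \<ge> 0"
  shows "L2_norm f \<le> B"
proof -
  have "(LINT x|torus. (cmod (f x))\<^sup>2) \<le> (LINT x|torus. B\<^sup>2)"
    using L2_torusI[OF assms(1,2)] assms by (intro integral_mono power_mono) (auto simp: L2_torus_def)
  then have "(L2_norm f)\<^sup>2 \<le> B\<^sup>2" using torus.prob_space by (simp add: L2_norm_power2)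
  then show ?thesis by (rule power2_le_imp_le) fact
qed

definition trig_approx :: "(real \<Rightarrow> complex) \<Rightarrow> bool" where
  "trig_approx f \<longleftrightarrow> f \<in> L2_torus \<and> (\<forall>e>0. \<exists>q. trig_poly q \<and> L2_norm (\<lambda>x. f x - q x) < e)"

lemma trig_approx_limit:
  assumes "f \<in> L2_torus" "\<And>n. trig_approx (g n)" "(\<lambda>n. (L2_norm (\<lambda>x. f x - g n x))\<^sup>2) \<longlonglongrightarrow> 0"
  shows "trig_approx f"
  unfolding trig_approx_def
proof (intro conjI allI impI assms(1))
  fix e :: real assume e: "e > 0"
  have "\<forall>\<^sub>F n in sequentially. (L2_norm (\<lambda>x. f x - g n x))\<^sup>2 < (e / 2)\<^sup>2"
    using e by (intro order_tendstoD[OF assms(3)]) auto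
  then obtain n where "(L2_norm (\<lambda>x. f x - g n x))\<^sup>2 < (e / 2)\<^sup>2" by (auto simp: eventually_sequentially)
  then have 1: "L2_norm (\<lambda>x. f x - g n x) < e / 2" by (rule power2_less_imp_less) (use e in simp)
  obtain q where q: "trig_poly q" "L2_norm (\<lambda>x. g n x - q x) < e / 2"
    using assms(2)[of n] e unfolding trig_approx_def by (metis half_gt_zero)
  have gn: "g n \<in> L2_torus" using assms(2)[of n] by (simp add: trig_approx_def)
  have "L2_norm (\<lambda>x. (f x - g n x) + (g n x - q x)) \<le> L2_norm (\<lambda>x. f x - g n x) + L2_norm (\<lambda>x. g n x - q x)"
    using assms(1) gn trig_poly_L2_torus[OF q(1)] by (intro L2_norm_triangle L2_torus_diff)
  then show "\<exists>q. trig_poly q \<and> L2_norm (\<lambda>x. f x - q x) < e" using 1 q by (intro exI[of _ q]) simp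
qed

lemma trig_approx_continuous:
  fixes g :: "real \<Rightarrow> complex"
  assumes g: "continuous_on UNIV g" "g 0 = g (2 * pi)"
  shows "trig_approx g"
proof -
  have m: "g \<in> borel_measurable torus"
    using g by (intro borel_measurable_torus borel_measurable_continuous_onI)
  have c: "continuous_on {0..2 * pi} g" using g continuous_on_subset by blast
  then have "bounded (g ` {0..2 * pi})" by (intro compact_imp_bounded compact_continuous_image) auto
  then obtain B where "\<forall>y\<in>g ` {0..2 * pi}. cmod y \<le> B" by (auto simp: bounded_iff)
  then have L2: "g \<in> L2_torus" using m by (intro L2_torusI[of _ B]) auto
  have "\<exists>q. trig_poly q \<and> L2_norm (\<lambda>x. g x - q x) < e" if "e > 0" for e
  proof -
    obtain q where q: "trig_poly q" "\<And>x. x \<in> {0..<2 * pi} \<Longrightarrow> cmod (g x - q x) < e / 2"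
      using trig_poly_uniform_approx[OF c g(2), of "e / 2"] half_gt_zero[OF \<open>e > 0\<close>] by metis
    have "q \<in> borel_measurable torus" using q(1) trig_poly_L2_torus L2_torus_measurable by blast
    then have "L2_norm (\<lambda>x. g x - q x) \<le> e / 2"
      using m q(2) that by (intro L2_norm_le) (auto intro: less_imp_le)
    then show ?thesis using q(1) that by (intro exI[of _ q]) auto
  qed
  then show ?thesis using L2 by (simp add: trig_approx_def)
qed

text \<open>A measurable function is almost everywhere a limit of continuous ones. Clamping these to
  the disc of radius \<open>B\<close> permits dominated convergence, and the factor
  \<open>cut\<close>, which vanishes at both ends and tends to 1 inside, makes them
  periodic.\<close>

lemma trig_approx_bounded:
  assumes f: "f \<in> borel_measurable torus" "\<And>x. x \<in> {0..<2 * pi} \<Longrightarrow> cmod (f x) \<le> B" and B: "B > 0"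
  shows "trig_approx f"
proof -
  let ?f = "\<lambda>x. indicator {0..<2 * pi} x *\<^sub>R f x"
  have "f \<in> borel_measurable (restrict_space lborel {0..<2 * pi})"
    using f(1) by (subst measurable_cong_sets[OF sets_torus[symmetric] refl])
  then have "?f \<in> borel_measurable borel"
    by (subst (asm) borel_measurable_restrict_space_iff) auto
  then have "?f \<in> borel_measurable lebesgue" by (intro measurable_completion) simp
  then have "?f measurable_on UNIV"
    using lebesgue_measurable_imp_measurable_on[of ?f UNIV] by simp
  then obtain N g where N: "negligible N" and g: "\<And>n. continuous_on UNIV (g n)"
      and lim: "\<And>x. x \<notin> N \<Longrightarrow> (\<lambda>n. g n x) \<longlonglongrightarrow> ?f x"
    by (auto simp: measurable_on_def)
  define clamp where "clamp z = z / of_real (max 1 (cmod z / B))" for z :: complex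
  have clamp_cont: "continuous_on UNIV clamp" unfolding clamp_def
    using B by (intro continuous_intros) (auto simp: max_def)
  have clamp_id: "clamp z = z" if "cmod z \<le> B" for z using that B by (simp add: clamp_def max_def field_simps)
  have clamp_le: "cmod (clamp z) \<le> B" for z using B by (auto simp: clamp_def max_def norm_divide field_simps)
  define cut where "cut n x = max 0 (min 1 (real n * (x * (2 * pi - x))))" for n x
  have cut_lim: "(\<lambda>n. cut n x) \<longlonglongrightarrow> 1" if "x \<in> {0<..<2 * pi}" for x
  proof -
    have p: "x * (2 * pi - x) > 0" using that by auto
    obtain n0 :: nat where n0: "1 / (x * (2 * pi - x)) < real n0" using reals_Archimedean2 by blast
    have "cut n x = 1" if "n \<ge> n0" for n
    proof -
      have "real n > 1 / (x * (2 * pi - x))" using n0 that by linarith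
      then have "real n * (x * (2 * pi - x)) > 1" using p by (simp only: pos_divide_less_eq)
      then show ?thesis by (simp add: cut_def)
    qed
    then show ?thesis by (intro tendsto_eventually) (auto simp: eventually_sequentially)
  qed
  define h where "h n x = of_real (cut n x) * clamp (g n x)" for n x
  have h_cont: "continuous_on UNIV (h n)" for n
    unfolding h_def cut_def by (intro continuous_intros continuous_on_compose2[OF clamp_cont g]) auto
  have "trig_approx (h n)" for n
    by (rule trig_approx_continuous[OF h_cont]) (simp add: h_def cut_def)
  moreover have "(\<lambda>n. (L2_norm (\<lambda>x. f x - h n x))\<^sup>2) \<longlonglongrightarrow> (LINT x|torus. 0)"
    unfolding L2_norm_power2
  proof (rule integral_dominated_convergence)
    have hm: "h n \<in> borel_measurable torus" for n
      using h_cont by (intro borel_measurable_torus borel_measurable_continuous_onI)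
    show "(\<lambda>x. (cmod (f x - h n x))\<^sup>2) \<in> borel_measurable torus" for n
      using f(1) hm[of n] by measurable
    show "integrable torus (\<lambda>x. (2 * B)\<^sup>2)" by simp
    show "AE x in torus. norm ((cmod (f x - h n x))\<^sup>2) \<le> (2 * B)\<^sup>2" for n
    proof (rule AE_I2)
      fix x assume x: "x \<in> space torus"
      have "cmod (h n x) \<le> 1 * B" unfolding h_def norm_mult
        by (intro mult_mono clamp_le) (auto simp: cut_def)
      then have "cmod (f x - h n x) \<le> 2 * B"
        using f(2)[of x] x norm_triangle_ineq4[of "f x" "h n x"] by simp
      then show "norm ((cmod (f x - h n x))\<^sup>2) \<le> (2 * B)\<^sup>2"
        using power_mono[of "cmod (f x - h n x)" "2 * B" 2] by simp
    qed
    have "AE x in lebesgue. x \<notin> N" using N by (intro AE_not_in) (simp add: negligible_iff_null_sets)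
    then have "AE x in lborel. x \<notin> N" by (simp add: AE_completion_iff)
    moreover have "AE x in lborel. x \<noteq> (0::real)" by (rule AE_lborel_singleton)
    ultimately have "AE x in lborel. x \<in> {0..<2 * pi} \<longrightarrow> (\<lambda>n. (cmod (f x - h n x))\<^sup>2) \<longlonglongrightarrow> 0"
    proof eventually_elim
      case (elim x)
      show ?case
      proof
        assume x: "x \<in> {0..<2 * pi}"
        have "(\<lambda>n. clamp (g n x)) \<longlonglongrightarrow> clamp (f x)"
          using continuous_on_tendsto_compose[OF clamp_cont lim[OF elim(1)]] x by simp
        then have "(\<lambda>n. h n x) \<longlonglongrightarrow> of_real 1 * clamp (f x)"
          unfolding h_def using cut_lim[of x] x elim by (intro tendsto_intros) auto
        then have "(\<lambda>n. h n x) \<longlonglongrightarrow> f x" using clamp_id f(2) x by simp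
        then have "(\<lambda>n. (cmod (f x - h n x))\<^sup>2) \<longlonglongrightarrow> (cmod (f x - f x))\<^sup>2" by (intro tendsto_intros)
        then show "(\<lambda>n. (cmod (f x - h n x))\<^sup>2) \<longlonglongrightarrow> 0" by simp
      qed
    qed
    then show "AE x in torus. (\<lambda>n. (cmod (f x - h n x))\<^sup>2) \<longlonglongrightarrow> 0" unfolding AE_torus_iff .
  qed simp
  ultimately show ?thesis
    using L2_torusI[OF f] by (intro trig_approx_limit[of f h]) auto
qed

lemma trig_approx_L2:
  assumes f: "f \<in> L2_torus"
  shows "trig_approx f"
proof (rule trig_approx_limit[OF f])
  let ?g = "\<lambda>n x. if cmod (f x) \<le> real n then f x else 0"
  have fm: "f \<in> borel_measurable torus" using f by (rule L2_torus_measurable)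
  have gm: "?g n \<in> borel_measurable torus" for n using fm by measurable
  show "trig_approx (?g n)" for n
    by (rule trig_approx_bounded[OF gm, of _ "real n + 1"]) auto
  have "(\<lambda>n. (L2_norm (\<lambda>x. f x - ?g n x))\<^sup>2) \<longlonglongrightarrow> (LINT x|torus. 0)"
    unfolding L2_norm_power2
  proof (rule integral_dominated_convergence)
    show "(\<lambda>x. (cmod (f x - ?g n x))\<^sup>2) \<in> borel_measurable torus" for n using fm gm[of n] by measurable
    show "integrable torus (\<lambda>x. (cmod (f x))\<^sup>2)" using f by (simp add: L2_torus_def)
    show "AE x in torus. norm ((cmod (f x - ?g n x))\<^sup>2) \<le> (cmod (f x))\<^sup>2" for n by auto
    show "AE x in torus. (\<lambda>n. (cmod (f x - ?g n x))\<^sup>2) \<longlonglongrightarrow> 0"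
    proof (rule AE_I2)
      fix x
      obtain n0 :: nat where "cmod (f x) \<le> real n0" using real_arch_simple by blast
      then have "(cmod (f x - ?g n x))\<^sup>2 = 0" if "n \<ge> n0" for n using that by auto
      then show "(\<lambda>n. (cmod (f x - ?g n x))\<^sup>2) \<longlonglongrightarrow> 0"
        by (intro tendsto_eventually) (auto simp only: eventually_sequentially)
    qed
  qed simp
  then show "(\<lambda>n. (L2_norm (\<lambda>x. f x - ?g n x))\<^sup>2) \<longlonglongrightarrow> 0" by simp
qed

lemma parseval:
  assumes f: "f \<in> L2_torus"
  shows "((\<lambda>n. (cmod (fourier_coeff f n))\<^sup>2) has_sum (L2_norm f)\<^sup>2) UNIV"
  unfolding has_sum_def
proof (rule tendstoI)
  fix e :: real assume e: "e > 0"
  obtain q where q: "trig_poly q" "L2_norm (\<lambda>x. f x - q x) < sqrt e"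
    using trig_approx_L2[OF f] e unfolding trig_approx_def by (metis real_sqrt_gt_zero)
  then obtain F c where F: "finite F" "q = (\<lambda>x. \<Sum>n\<in>F. c n * emode n x)" by (auto simp: trig_poly_def)
  have "dist (\<Sum>n\<in>G. (cmod (fourier_coeff f n))\<^sup>2) ((L2_norm f)\<^sup>2) < e" if G: "finite G" "F \<subseteq> G" for G
  proof -
    \<comment> \<open>Padded with zeros, \<open>q\<close> competes with the partial sum over
      \<open>G\<close>, so its distance to \<open>f\<close> bounds the missing mass from
      above.\<close>
    have "q x = (\<Sum>n\<in>G. (if n \<in> F then c n else 0) * emode n x)" for x
      unfolding F(2) using G by (intro sum.mono_neutral_cong_left) auto
    then have "(L2_norm (\<lambda>x. f x - q x))\<^sup>2 \<ge> (L2_norm f)\<^sup>2 - (\<Sum>n\<in>G. (cmod (fourier_coeff f n))\<^sup>2)"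
      using L2_norm_diff_trig_poly[OF G(1) f, of "\<lambda>n. if n \<in> F then c n else 0"] by (simp add: sum_nonneg)
    moreover have "(L2_norm (\<lambda>x. f x - q x))\<^sup>2 < (sqrt e)\<^sup>2" using q L2_norm_nonneg by (intro power_strict_mono) auto
    ultimately show ?thesis using bessel[OF G(1) f] e by (simp add: dist_real_def)
  qed
  then show "\<forall>\<^sub>F G in finite_subsets_at_top UNIV. dist (\<Sum>n\<in>G. (cmod (fourier_coeff f n))\<^sup>2) ((L2_norm f)\<^sup>2) < e"
    using F(1) by (auto simp: eventually_finite_subsets_at_top)
qed

section \<open>Plancherel's inequality\<close>

lemma holder_sum:
  fixes f g :: "'a \<Rightarrow> real"
  assumes "\<And>x. x \<in> A \<Longrightarrow> f x \<ge> 0" "\<And>x. x \<in> A \<Longrightarrow> g x \<ge> 0" and s: "0 < s" "s < 1"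
  shows "(\<Sum>x\<in>A. f x powr (1 - s) * g x powr s) \<le> (\<Sum>x\<in>A. f x) powr (1 - s) * (\<Sum>x\<in>A. g x) powr s"
proof (cases "finite A")
  case fin: True
  let ?F = "\<Sum>x\<in>A. f x" and ?G = "\<Sum>x\<in>A. g x"
  have nn: "?F \<ge> 0" "?G \<ge> 0" using assms by (auto intro: sum_nonneg)
  consider "?F = 0" | "?G = 0" | "?F > 0" "?G > 0" using nn by linarith
  then show ?thesis
  proof cases
    case 1
    then have "f x = 0" if "x \<in> A" for x using assms fin that by (simp add: sum_nonneg_eq_0_iff)
    then show ?thesis using s by simp
  next
    case 2
    then have "g x = 0" if "x \<in> A" for x using assms fin that by (simp add: sum_nonneg_eq_0_iff)
    then show ?thesis using s by simp
  next
    case 3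
    have "(\<Sum>x\<in>A. (f x / ?F) powr (1 - s) * (g x / ?G) powr s) \<le> (\<Sum>x\<in>A. (1 - s) * (f x / ?F) + s * (g x / ?G))"
    proof (rule sum_mono)
      fix x assume x: "x \<in> A"
      show "(f x / ?F) powr (1 - s) * (g x / ?G) powr s \<le> (1 - s) * (f x / ?F) + s * (g x / ?G)"
      proof (cases "f x = 0 \<or> g x = 0")
        case True
        then show ?thesis using assms(1,2)[OF x] s 3 by auto
      next
        case False
        then have "f x > 0" "g x > 0" using assms(1,2)[OF x] by auto
        then show ?thesis using s 3 by (intro Youngs_inequality_0) auto
      qed
    qed
    also have "\<dots> = (1 - s) * (?F / ?F) + s * (?G / ?G)"
      by (simp only: sum.distrib sum_distrib_left[symmetric] sum_divide_distrib[symmetric])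
    also have "\<dots> = 1" using 3 by simp
    finally have "(\<Sum>x\<in>A. (f x powr (1 - s) * g x powr s) / (?F powr (1 - s) * ?G powr s)) \<le> 1"
      using assms(1,2) nn by (simp add: powr_divide cong: sum.cong)
    then show ?thesis using 3 by (simp add: sum_divide_distrib[symmetric] divide_le_eq)
  qed
qed simp

lemma holder_sum_powr:
  fixes g :: "'a \<Rightarrow> real"
  assumes "\<And>x. x \<in> A \<Longrightarrow> g x \<ge> 0" and s: "0 < s" "s < 1"
  shows "(\<Sum>x\<in>A. g x powr s) \<le> real (card A) powr (1 - s) * (\<Sum>x\<in>A. g x) powr s"
  using holder_sum[of A "\<lambda>_. 1" g s] assms by simp

text \<open>The line is tiled by the integer translates of [0, 1), and all tiles are moved onto [0,
  1). Integers are enumerated by \<open>int_decode\<close> because the series runs over natural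
  numbers.\<close>

lemma nn_integral_periodize:
  fixes h :: "real \<Rightarrow> ennreal"
  assumes h [measurable]: "h \<in> borel_measurable borel"
    and bound: "\<And>\<theta>. (\<Sum>i. h (\<theta> + of_int (int_decode i))) \<le> C"
  shows "(\<integral>\<^sup>+\<xi>. h \<xi> \<partial>lborel) \<le> C"
proof -
  define A where "A i = {real_of_int (int_decode i)..<real_of_int (int_decode i) + 1}" for i
  have A [measurable]: "A i \<in> sets borel" for i by (simp add: A_def)
  have floor: "x \<in> A i \<longleftrightarrow> i = int_encode \<lfloor>x\<rfloor>" for x i
  proof -
    have "x \<in> A i \<longleftrightarrow> \<lfloor>x\<rfloor> = int_decode i" unfolding A_def by (auto simp: floor_eq_iff)
    then show ?thesis by (metis int_decode_inverse int_encode_inverse)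
  qed
  then have disj: "disjoint_family A" and UN: "(\<Union>i. A i) = UNIV"
    by (auto simp: disjoint_family_on_def)
  have "(\<integral>\<^sup>+\<xi>. h \<xi> \<partial>lborel) = (\<integral>\<^sup>+\<xi>. (\<Sum>i. h \<xi> * indicator (A i) \<xi>) \<partial>lborel)"
    by (simp add: suminf_indicator[OF disj] UN)
  also have "\<dots> = (\<Sum>i. \<integral>\<^sup>+\<xi>. h \<xi> * indicator (A i) \<xi> \<partial>lborel)"
    by (intro nn_integral_suminf) measurable
  also have "\<dots> = (\<Sum>i. \<integral>\<^sup>+\<theta>. h (\<theta> + of_int (int_decode i)) * indicator {0..<1} \<theta> \<partial>lborel)"
  proof (intro suminf_cong)
    fix i
    have "(\<integral>\<^sup>+\<xi>. h \<xi> * indicator (A i) \<xi> \<partial>lborel) = \<bar>1::real\<bar> *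
        (\<integral>\<^sup>+\<theta>. h (of_int (int_decode i) + 1 * \<theta>) * indicator (A i) (of_int (int_decode i) + 1 * \<theta>) \<partial>lborel)"
      by (rule nn_integral_real_affine) auto
    also have "\<dots> = (\<integral>\<^sup>+\<theta>. h (\<theta> + of_int (int_decode i)) * indicator {0..<1} \<theta> \<partial>lborel)"
      by (simp add: A_def add.commute) (auto intro!: nn_integral_cong simp: indicator_def)
    finally show "(\<integral>\<^sup>+\<xi>. h \<xi> * indicator (A i) \<xi> \<partial>lborel) =
      (\<integral>\<^sup>+\<theta>. h (\<theta> + of_int (int_decode i)) * indicator {0..<1} \<theta> \<partial>lborel)" .
  qed
  also have "\<dots> = (\<integral>\<^sup>+\<theta>. (\<Sum>i. h (\<theta> + of_int (int_decode i)) * indicator {0..<1} \<theta>) \<partial>lborel)"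
    by (intro nn_integral_suminf[symmetric]) measurable
  also have "\<dots> \<le> (\<integral>\<^sup>+\<theta>. C * indicator {0..<1::real} \<theta> \<partial>lborel)"
    using bound by (intro nn_integral_mono) (auto simp: indicator_def)
  also have "\<dots> = C" by (simp add: nn_integral_cmult)
  finally show ?thesis .
qed

lemma borel_measurable_pair_torus:
  assumes "f \<in> borel_measurable (borel \<Otimes>\<^sub>M borel)"
  shows "f \<in> borel_measurable (borel \<Otimes>\<^sub>M torus)"
proof -
  have "(\<lambda>x. x) \<in> torus \<rightarrow>\<^sub>M borel" by (rule borel_measurable_torus) simp
  then have "(\<lambda>z. snd z) \<in> borel \<Otimes>\<^sub>M torus \<rightarrow>\<^sub>M borel"
    by (rule measurable_compose[OF measurable_snd])
  then have "(\<lambda>z. (fst z, snd z)) \<in> borel \<Otimes>\<^sub>M torus \<rightarrow>\<^sub>M borel \<Otimes>\<^sub>M borel"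
    by (intro measurable_Pair measurable_fst)
  from measurable_compose[OF this assms] show ?thesis by (simp only: prod.collapse)
qed

lemma fourier_transform_measurable:
  assumes [measurable]: "f \<in> borel_measurable borel"
  shows "(\<lambda>\<xi>. LINT x|torus. cis (- (\<xi> * x)) * f x) \<in> borel_measurable borel"
proof -
  have "(\<lambda>(\<xi>, x). cis (- (\<xi> * x)) * f x) \<in> borel_measurable (borel \<Otimes>\<^sub>M borel)"
    unfolding cis_conv_exp by measurable
  from borel_measurable_pair_torus[OF this] show ?thesis
    by (rule torus.borel_measurable_lebesgue_integral)
qed

text \<open>Bessel's inequality for the frequencies \<open>\<theta> + \<int>\<close>, integrated over \<open>\<theta> \<in> [0, 1)\<close>.\<close>

lemma plancherel_torus:
  assumes f: "f \<in> L2_torus" and mf: "f \<in> borel_measurable borel"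
  shows "(\<integral>\<^sup>+\<xi>. ennreal ((cmod (LINT x|torus. cis (- (\<xi> * x)) * f x))\<^sup>2) \<partial>lborel) \<le> ennreal ((L2_norm f)\<^sup>2)"
proof (rule nn_integral_periodize)
  have [measurable]: "(\<lambda>\<xi>. LINT x|torus. cis (- (\<xi> * x)) * f x) \<in> borel_measurable borel"
    by (rule fourier_transform_measurable[OF mf])
  show "(\<lambda>\<xi>. ennreal ((cmod (LINT x|torus. cis (- (\<xi> * x)) * f x))\<^sup>2)) \<in> borel_measurable borel"
    by measurable
  fix \<theta> :: real
  let ?g = "\<lambda>x. cis (- (\<theta> * x)) * f x"
  have cm: "(\<lambda>x. cis (- (\<theta> * x))) \<in> borel_measurable torus"
    unfolding cis_conv_exp by (rule borel_measurable_torus) measurable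
  have g: "?g \<in> L2_torus" using cm by (intro L2_torus_mult_bounded[OF f, of _ 1]) auto
  have ng: "L2_norm ?g = L2_norm f" by (simp add: L2_norm_def norm_mult)
  have eq: "(LINT x|torus. cis (- ((\<theta> + of_int n) * x)) * f x) = fourier_coeff ?g n" for n
    unfolding fourier_coeff_def
    by (intro Bochner_Integration.integral_cong refl)
       (simp add: cis_conv_exp algebra_simps exp_diff exp_minus exp_add field_simps)
  show "(\<Sum>i. ennreal ((cmod (LINT x|torus. cis (- ((\<theta> + of_int (int_decode i)) * x)) * f x))\<^sup>2)) \<le> ennreal ((L2_norm f)\<^sup>2)"
  proof (rule suminf_le_const)
    fix n
    have "(\<Sum>i<n. ennreal ((cmod (LINT x|torus. cis (- ((\<theta> + of_int (int_decode i)) * x)) * f x))\<^sup>2))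
       = ennreal (\<Sum>i\<in>int_decode ` {..<n}. (cmod (fourier_coeff ?g i))\<^sup>2)"
      by (subst sum.reindex[OF inj_int_decode]) (simp add: eq)
    also have "\<dots> \<le> ennreal ((L2_norm ?g)\<^sup>2)" by (intro ennreal_leI bessel g) auto
    finally show "(\<Sum>i<n. ennreal ((cmod (LINT x|torus. cis (- ((\<theta> + of_int (int_decode i)) * x)) * f x))\<^sup>2)) \<le> ennreal ((L2_norm f)\<^sup>2)"
      unfolding ng .
  qed (rule summableI)
qed

text \<open>The substitution s = c x with c = T / (2 pi) maps the torus onto [0, T), and \<xi> = c
  \<nu> k turns the integral over k into one over \<xi>. The factors T^2 (square of the integral), 1
  / (c |\<nu>|) (Jacobian) and 1 / T (normalized measure) multiply to 2 pi / |\<nu>|, independently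
  of \<open>T\<close>.\<close>

lemma plancherel_interval:
  fixes f :: "real \<Rightarrow> complex"
  assumes f: "f \<in> borel_measurable borel" "\<And>s. cmod (f s) \<le> B" and \<nu>: "\<nu> \<noteq> 0" and T: "T > 0"
    and ab: "{a..<b} \<subseteq> {0..<T}"
  shows "(\<integral>\<^sup>+k. ennreal ((cmod (LINT s:{a..<b}|lborel. cis (- (k * \<nu> * s)) * f s))\<^sup>2) \<partial>lborel)
    \<le> ennreal (2 * pi / \<bar>\<nu>\<bar> * (LINT s:{a..<b}|lborel. (cmod (f s))\<^sup>2))"
proof -
  define c where "c = T / (2 * pi)"
  have c: "c > 0" using T by (simp add: c_def)
  define g where "g x = indicator {a..<b} (c * x) * f (c * x)" for x
  have mg [measurable]: "g \<in> borel_measurable borel" unfolding g_def using f(1) by measurable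
  have B: "B \<ge> 0" using f(2)[of 0] norm_ge_zero order_trans by blast
  have gL2: "g \<in> L2_torus"
    using f(2) B by (intro L2_torusI[of _ B] borel_measurable_torus mg) (auto simp: g_def indicator_def)
  have g0: "g x = 0" if "x \<notin> {0..<2 * pi}" for x
  proof -
    have "c * x \<notin> {0..<T}"
    proof
      assume "c * x \<in> {0..<T}"
      then have "x \<ge> 0" "x * T < 2 * pi * T" using c by (auto simp: c_def zero_le_mult_iff field_simps)
      then show False using that T by auto
    qed
    then show ?thesis using ab by (auto simp: g_def indicator_def)
  qed
  have torus_int: "(LINT x|torus. h x) = (1 / T) *\<^sub>R (LINT s:{a..<b}|lborel. h' s)"
    if "h \<in> borel_measurable borel" "\<And>x. x \<notin> {0..<2 * pi} \<Longrightarrow> h x = 0" "\<And>x. h x = indicator {a..<b} (c * x) *\<^sub>R h' (c * x)"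
    for h h' :: "real \<Rightarrow> 'b::{banach, second_countable_topology}"
  proof -
    have "(LINT s:{a..<b}|lborel. h' s) = \<bar>c\<bar> *\<^sub>R (LINT x|lborel. indicator {a..<b} (0 + c * x) *\<^sub>R h' (0 + c * x))"
      unfolding set_lebesgue_integral_def using c by (intro lborel_integral_real_affine) auto
    also have "\<dots> = c *\<^sub>R (LINT x|lborel. h x)" using c that(3) by simp
    also have "(LINT x|lborel. h x) = (LINT x:{0..<2 * pi}|lborel. h x)"
      unfolding set_lebesgue_integral_def using that(2) by (intro Bochner_Integration.integral_cong) (auto simp: indicator_def)
    also have "(LINT x:{0..<2 * pi}|lborel. h x) = (2 * pi) *\<^sub>R (LINT x|torus. h x)"
      using integral_torus[OF borel_measurable_torus[OF that(1)]] by simp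
    finally show ?thesis using T by (simp add: c_def)
  qed
  have norm_g: "(L2_norm g)\<^sup>2 = (1 / T) *\<^sub>R (LINT s:{a..<b}|lborel. (cmod (f s))\<^sup>2)"
    unfolding L2_norm_power2
  proof (rule torus_int)
    show "(cmod (g x))\<^sup>2 = indicator {a..<b} (c * x) *\<^sub>R (cmod (f (c * x)))\<^sup>2" for x
      by (simp add: g_def indicator_def)
  qed (simp_all add: g0)
  have trans: "(LINT s:{a..<b}|lborel. cis (- (k * \<nu> * s)) * f s) = T *\<^sub>R (LINT x|torus. cis (- ((0 + c * \<nu> * k) * x)) * g x)" for k
  proof -
    have "(\<lambda>x. cis (- ((0 + c * \<nu> * k) * x)) * g x) \<in> borel_measurable borel"
      unfolding cis_conv_exp by measurable
    moreover have "cis (- ((0 + c * \<nu> * k) * x)) * g x = indicator {a..<b} (c * x) *\<^sub>R (cis (- (k * \<nu> * (c * x))) * f (c * x))" for x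
      by (simp add: g_def indicator_def mult_ac)
    ultimately show ?thesis
      using T by (subst torus_int[of _ "\<lambda>s. cis (- (k * \<nu> * s)) * f s"]) (simp_all add: g0)
  qed
  let ?\<Phi> = "\<lambda>\<xi>. ennreal ((cmod (LINT x|torus. cis (- (\<xi> * x)) * g x))\<^sup>2)"
  have [measurable]: "(\<lambda>\<xi>. LINT x|torus. cis (- (\<xi> * x)) * g x) \<in> borel_measurable borel"
    by (rule fourier_transform_measurable[OF mg])
  have m\<Phi>: "?\<Phi> \<in> borel_measurable borel" by measurable
  have "(\<integral>\<^sup>+\<xi>. ?\<Phi> \<xi> \<partial>lborel) = \<bar>c * \<nu>\<bar> * (\<integral>\<^sup>+k. ?\<Phi> (0 + c * \<nu> * k) \<partial>lborel)"
    using c \<nu> by (intro nn_integral_real_affine m\<Phi>) auto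
  then have *: "\<bar>c * \<nu>\<bar> * (\<integral>\<^sup>+k. ?\<Phi> (0 + c * \<nu> * k) \<partial>lborel) \<le> ennreal ((L2_norm g)\<^sup>2)"
    using plancherel_torus[OF gL2 mg] by simp
  have "(\<integral>\<^sup>+k. ennreal ((cmod (LINT s:{a..<b}|lborel. cis (- (k * \<nu> * s)) * f s))\<^sup>2) \<partial>lborel)
      = (\<integral>\<^sup>+k. ennreal (T\<^sup>2) * ?\<Phi> (0 + c * \<nu> * k) \<partial>lborel)"
    by (intro nn_integral_cong) (simp only: trans, simp add: power_mult_distrib ennreal_mult)
  also have "\<dots> = ennreal (T\<^sup>2) * (\<integral>\<^sup>+k. ?\<Phi> (0 + c * \<nu> * k) \<partial>lborel)"
    by (intro nn_integral_cmult measurable_compose[OF _ m\<Phi>]) simp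
  also have "\<dots> = ennreal (T\<^sup>2 / \<bar>c * \<nu>\<bar>) * (\<bar>c * \<nu>\<bar> * (\<integral>\<^sup>+k. ?\<Phi> (0 + c * \<nu> * k) \<partial>lborel))"
    using c \<nu> by (simp add: mult.assoc[symmetric] ennreal_mult[symmetric])
  also have "\<dots> \<le> ennreal (T\<^sup>2 / \<bar>c * \<nu>\<bar>) * ennreal ((L2_norm g)\<^sup>2)" by (intro mult_left_mono *) simp
  also have "\<dots> = ennreal (T\<^sup>2 / \<bar>c * \<nu>\<bar> * ((1 / T) * (LINT s:{a..<b}|lborel. (cmod (f s))\<^sup>2)))"
    using T by (simp add: norm_g set_lebesgue_integral_def flip: ennreal_mult)
  also have "T\<^sup>2 / \<bar>c * \<nu>\<bar> * ((1 / T) * (LINT s:{a..<b}|lborel. (cmod (f s))\<^sup>2)) = 2 * pi / \<bar>\<nu>\<bar> * (LINT s:{a..<b}|lborel. (cmod (f s))\<^sup>2)"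
    using T by (simp add: c_def abs_mult power2_eq_square field_simps)
  finally show ?thesis .
qed

section \<open>Energies of the oscillatory integrals\<close>

lemma set_integrable_bounded_interval:
  fixes f :: "real \<Rightarrow> 'b::{banach, second_countable_topology}"
  assumes "f \<in> borel_measurable borel" "\<And>s. norm (f s) \<le> B"
  shows "set_integrable lborel {a..<b} f"
  unfolding set_integrable_def
  by (rule integrableI_bounded_set_indicator[where B = B])
     (use assms emeasure_bounded_finite[of "{a..<b}"] in auto)

definition zeta :: real where
  "zeta = (\<Sum>i. (1 + \<bar>real_of_int (int_decode i)\<bar>) powr - (3 / 2))"

text \<open>The enumeration alternates between nonnegative and negative integers, so
  |\<open>int_decode i\<close>| is about i/2. This transfers the convergence of the series to the
  enumerated integers.\<close>

lemma int_decode_ge: "real i + 1 \<le> 2 * (1 + \<bar>real_of_int (int_decode i)\<bar>)"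
proof (cases "sum_decode i")
  case (Inl a)
  then have "i = sum_encode (Inl a)" by (metis sum_decode_inverse)
  then show ?thesis using Inl by (simp add: int_decode_def sum_encode_def)
next
  case (Inr b)
  then have "i = sum_encode (Inr b)" by (metis sum_decode_inverse)
  then show ?thesis using Inr by (simp add: int_decode_def sum_encode_def)
qed

lemma summable_zeta: "summable (\<lambda>i. (1 + \<bar>real_of_int (int_decode i)\<bar>) powr - (3 / 2))"
proof (rule summable_comparison_test')
  have "summable (\<lambda>i. real i powr - (3 / 2))" by (subst summable_real_powr_iff) auto
  then have "summable (\<lambda>i. real (Suc i) powr - (3 / 2))" by (subst summable_Suc_iff)
  then show "summable (\<lambda>i. (1 / 2) powr - (3 / 2) * real (Suc i) powr - (3 / 2))" by (rule summable_mult)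
  fix i :: nat
  have "(1 + \<bar>real_of_int (int_decode i)\<bar>) powr - (3 / 2) \<le> (1 / 2 * real (Suc i)) powr - (3 / 2)"
    using int_decode_ge[of i] by (intro powr_mono2') auto
  also have "\<dots> = (1 / 2) powr - (3 / 2) * real (Suc i) powr - (3 / 2)" by (simp only: powr_mult)
  finally show "norm ((1 + \<bar>real_of_int (int_decode i)\<bar>) powr - (3 / 2)) \<le> (1 / 2) powr - (3 / 2) * real (Suc i) powr - (3 / 2)"
    by simp
qed

lemma zeta_nonneg: "zeta \<ge> 0"
  unfolding zeta_def by (intro suminf_nonneg summable_zeta) simp

lemma suminf_zeta: "(\<Sum>i. ennreal ((1 + \<bar>real_of_int (int_decode i)\<bar>) powr - (3 / 2))) = ennreal zeta"
  unfolding zeta_def by (intro suminf_ennreal2 summable_zeta) simp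

text \<open>A version of the potential that is Borel on the whole plane and bounded everywhere, so
  that every time section may be used. Such a version is supplied by
  \<open>truncation\<close>.\<close>

locale potential =
  fixes W :: "real \<times> real \<Rightarrow> complex" and T N :: real
  assumes W_measurable [measurable]: "W \<in> borel_measurable (borel \<Otimes>\<^sub>M borel)"
    and W_le: "cmod (W z) \<le> N" and T_pos: "T > 0"
begin

lemma N_nonneg: "N \<ge> 0"
  using W_le[of undefined] norm_ge_zero order_trans by blast

definition vhat :: "int \<Rightarrow> real \<Rightarrow> complex" where
  "vhat n s = fourier_coeff (\<lambda>x. W (x, s)) n"

lemma W_section_measurable [measurable]: "(\<lambda>x. W (x, s)) \<in> borel_measurable borel"
  by measurable

lemma W_section_torus: "(\<lambda>x. W (x, s)) \<in> borel_measurable torus"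
  by (rule borel_measurable_torus) simp

lemma W_section_L2: "(\<lambda>x. W (x, s)) \<in> L2_torus"
  by (rule L2_torusI[OF W_section_torus]) (rule W_le)

lemma vhat_measurable [measurable]: "vhat n \<in> borel_measurable borel"
proof -
  have "(\<lambda>(s, x). W (x, s) * exp (- (\<i> * of_int n * complex_of_real x))) \<in> borel_measurable (borel \<Otimes>\<^sub>M borel)"
    by measurable
  then have "(\<lambda>(s, x). W (x, s) * exp (- (\<i> * of_int n * complex_of_real x))) \<in> borel_measurable (borel \<Otimes>\<^sub>M torus)"
    by (rule borel_measurable_pair_torus)
  then show ?thesis
    unfolding vhat_def fourier_coeff_def by (rule torus.borel_measurable_lebesgue_integral)
qed

lemma vhat_bessel: "finite F \<Longrightarrow> (\<Sum>n\<in>F. (cmod (vhat n s))\<^sup>2) \<le> N\<^sup>2"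
proof -
  assume F: "finite F"
  have "L2_norm (\<lambda>x. W (x, s)) \<le> N"
    using W_section_torus W_le N_nonneg by (rule L2_norm_le)
  then have "(L2_norm (\<lambda>x. W (x, s)))\<^sup>2 \<le> N\<^sup>2" using L2_norm_nonneg by (intro power_mono)
  then show ?thesis unfolding vhat_def using bessel[OF F W_section_L2[of s]] by linarith
qed

lemma vhat_le: "cmod (vhat n s) \<le> N"
  by (rule power2_le_imp_le) (use vhat_bessel[of "{n}" s] N_nonneg in auto)

definition osc :: "int \<Rightarrow> int \<Rightarrow> real \<Rightarrow> real \<Rightarrow> real \<Rightarrow> complex" where
  "osc n m a b k = (LINT s:{a..<b}|lborel. cis (- (k * of_int (n\<^sup>2 - m\<^sup>2) * s)) * vhat (n - m) s)"

lemma osc_measurable [measurable]: "osc n m a b \<in> borel_measurable borel"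
  unfolding osc_def set_lebesgue_integral_def cis_conv_exp
  by (rule lborel.borel_measurable_lebesgue_integral) measurable

text \<open>
  Any exponent strictly between \<open>1\<close> and \<open>2\<close> may replace \<open>3 / 2\<close>: the weight has to be summable in \<open>m\<close>,
  and its loss has to be compensated by the weight of \<open>H\<^sup>\<alpha>\<close> at \<open>m\<close> in \<open>jump_pairing\<close>.
\<close>

definition energy_term :: "int \<Rightarrow> int \<Rightarrow> real \<Rightarrow> real \<Rightarrow> real \<Rightarrow> real" where
  "energy_term n m a b k = (if n \<noteq> 0 \<and> 2 * \<bar>m\<bar> \<le> \<bar>n\<bar>
     then (real_of_int n)\<^sup>2 * (1 + \<bar>real_of_int m\<bar>) powr - (3 / 2) * (cmod (osc n m a b k))\<^sup>2 else 0)"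

text \<open>This is e_I(k) for I = [a, b): the outer sum runs over the sources, the inner one over
  the targets. It may be infinite for exceptional \<open>k\<close>.\<close>

definition energy :: "real \<Rightarrow> real \<Rightarrow> real \<Rightarrow> ennreal" where
  "energy a b k = (\<Sum>i. \<Sum>j. ennreal (energy_term (int_decode j) (int_decode i) a b k))"

lemma energy_term_nonneg: "energy_term n m a b k \<ge> 0"
  by (simp add: energy_term_def)

lemma energy_term_measurable [measurable]: "energy_term n m a b \<in> borel_measurable borel"
  unfolding energy_term_def by (cases "n \<noteq> 0 \<and> 2 * \<bar>m\<bar> \<le> \<bar>n\<bar>") simp_all

lemma energy_measurable [measurable]: "energy a b \<in> borel_measurable borel"
  unfolding energy_def by measurable

lemma sum_le_energy:
  assumes "finite A" "finite B"
  shows "ennreal (\<Sum>m\<in>B. \<Sum>n\<in>A. energy_term n m a b k) \<le> energy a b k"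
proof -
  have "ennreal (\<Sum>m\<in>B. \<Sum>n\<in>A. energy_term n m a b k) = (\<Sum>m\<in>B. \<Sum>n\<in>A. ennreal (energy_term n m a b k))"
    by (simp add: energy_term_nonneg sum_nonneg flip: sum_ennreal)
  also have "\<dots> = (\<Sum>i\<in>int_encode ` B. \<Sum>j\<in>int_encode ` A. ennreal (energy_term (int_decode j) (int_decode i) a b k))"
    by (simp add: sum.reindex inj_int_encode)
  also have "\<dots> \<le> (\<Sum>i\<in>int_encode ` B. \<Sum>j. ennreal (energy_term (int_decode j) (int_decode i) a b k))"
    using assms by (intro sum_mono sum_le_suminf summableI) auto
  also have "\<dots> \<le> energy a b k" unfolding energy_def
    using assms by (intro sum_le_suminf summableI) auto
  finally show ?thesis .
qed

lemma nn_integral_energy_term: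
  assumes ab: "0 \<le> a" "a \<le> b" "b \<le> T"
  shows "(\<integral>\<^sup>+k. ennreal (energy_term n m a b k) \<partial>lborel) \<le>
    ennreal (9 * (1 + \<bar>real_of_int m\<bar>) powr - (3 / 2)) * (\<integral>\<^sup>+s. ennreal ((cmod (vhat (n - m) s))\<^sup>2) * indicator {a..<b} s \<partial>lborel)"
proof (cases "n \<noteq> 0 \<and> 2 * \<bar>m\<bar> \<le> \<bar>n\<bar>")
  case False
  then have "energy_term n m a b k = 0" for k by (auto simp: energy_term_def)
  then show ?thesis by simp
next
  case True
  let ?w = "(1 + \<bar>real_of_int m\<bar>) powr - (3 / 2)" and ?\<nu> = "real_of_int (n\<^sup>2 - m\<^sup>2)"
  let ?J = "LINT s:{a..<b}|lborel. (cmod (vhat (n - m) s))\<^sup>2"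
  have nm: "4 * (real_of_int m)\<^sup>2 \<le> (real_of_int n)\<^sup>2"
  proof -
    have "\<bar>2 * real_of_int m\<bar> \<le> \<bar>real_of_int n\<bar>" using True by linarith
    then have "(2 * real_of_int m)\<^sup>2 \<le> (real_of_int n)\<^sup>2" by (simp only: abs_le_square_iff)
    then show ?thesis by (simp add: power_mult_distrib)
  qed
  have n: "(real_of_int n)\<^sup>2 > 0" using True by simp
  have \<nu>: "?\<nu> \<ge> 3 / 4 * (real_of_int n)\<^sup>2" "?\<nu> > 0"
  proof -
    have "?\<nu> = (real_of_int n)\<^sup>2 - (real_of_int m)\<^sup>2" by simp
    then show "?\<nu> \<ge> 3 / 4 * (real_of_int n)\<^sup>2" "?\<nu> > 0" using nm n by linarith+
  qed
  have J: "?J \<ge> 0" by (simp add: set_lebesgue_integral_def)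
  have "(\<integral>\<^sup>+k. ennreal (energy_term n m a b k) \<partial>lborel) =
    (\<integral>\<^sup>+k. ennreal ((real_of_int n)\<^sup>2 * ?w) * ennreal ((cmod (osc n m a b k))\<^sup>2) \<partial>lborel)"
    using True by (simp add: energy_term_def ennreal_mult)
  also have "\<dots> = ennreal ((real_of_int n)\<^sup>2 * ?w) * (\<integral>\<^sup>+k. ennreal ((cmod (osc n m a b k))\<^sup>2) \<partial>lborel)"
    by (intro nn_integral_cmult) measurable
  also have "\<dots> \<le> ennreal ((real_of_int n)\<^sup>2 * ?w) * ennreal (2 * pi / \<bar>?\<nu>\<bar> * ?J)"
    unfolding osc_def using \<nu> ab T_pos vhat_le[of "n - m"]
    by (intro mult_left_mono plancherel_interval) auto
  also have "\<dots> = ennreal (((real_of_int n)\<^sup>2 * ?w) * (2 * pi / \<bar>?\<nu>\<bar> * ?J))"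
    using J by (intro ennreal_mult[symmetric]) auto
  also have "\<dots> \<le> ennreal (9 * ?w * ?J)"
  proof (intro ennreal_leI)
    \<comment> \<open>The constant 9 comes from 2 pi <= 27/4, that is 2 pi / (3/4) <= 9.\<close>
    have "(real_of_int n)\<^sup>2 * (2 * pi) \<le> (real_of_int n)\<^sup>2 * (9 * (3 / 4))"
      using pi_less_4 pi_approx by (intro mult_left_mono) auto
    also have "\<dots> = 9 * (3 / 4 * (real_of_int n)\<^sup>2)" by simp
    also have "\<dots> \<le> 9 * ?\<nu>" by (intro mult_left_mono \<nu>) simp
    finally have "(real_of_int n)\<^sup>2 * (2 * pi / \<bar>?\<nu>\<bar>) \<le> 9" using \<nu> by (simp add: divide_le_eq)
    then have "(real_of_int n)\<^sup>2 * (2 * pi / \<bar>?\<nu>\<bar>) * (?w * ?J) \<le> 9 * (?w * ?J)"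
      using J by (intro mult_right_mono) auto
    then show "(real_of_int n)\<^sup>2 * ?w * (2 * pi / \<bar>?\<nu>\<bar> * ?J) \<le> 9 * ?w * ?J" by (simp only: mult_ac)
  qed
  also have "\<dots> = ennreal (9 * ?w) * ennreal ?J" using J by (simp add: ennreal_mult)
  also have "ennreal ?J = (\<integral>\<^sup>+s. ennreal (indicator {a..<b} s *\<^sub>R (cmod (vhat (n - m) s))\<^sup>2) \<partial>lborel)"
    unfolding set_lebesgue_integral_def
  proof (rule nn_integral_eq_integral[symmetric])
    have "(cmod (vhat (n - m) s))\<^sup>2 \<le> N\<^sup>2" for s by (intro power_mono vhat_le) simp
    then have "set_integrable lborel {a..<b} (\<lambda>s. (cmod (vhat (n - m) s))\<^sup>2)"
      by (intro set_integrable_bounded_interval[of _ "N\<^sup>2"]) auto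
    then show "integrable lborel (\<lambda>s. indicator {a..<b} s *\<^sub>R (cmod (vhat (n - m) s))\<^sup>2)"
      by (simp add: set_integrable_def)
  qed simp
  also have "\<dots> = (\<integral>\<^sup>+s. ennreal ((cmod (vhat (n - m) s))\<^sup>2) * indicator {a..<b} s \<partial>lborel)"
    by (intro nn_integral_cong) (simp add: indicator_def)
  finally show ?thesis .
qed

text \<open>For a fixed source the sum over all targets is bounded by N^2, by Bessel's inequality
  for \<open>W\<close> at each time. The sum over sources costs only the sum \<open>zeta\<close> of
  the weights.\<close>

lemma nn_integral_energy:
  assumes ab: "0 \<le> a" "a \<le> b" "b \<le> T"
  shows "(\<integral>\<^sup>+k. energy a b k \<partial>lborel) \<le> ennreal (9 * zeta * N\<^sup>2 * (b - a))"
proof -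
  let ?w = "\<lambda>i. (1 + \<bar>real_of_int (int_decode i)\<bar>) powr - (3 / 2)"
  have "(\<integral>\<^sup>+k. energy a b k \<partial>lborel) = (\<Sum>i. \<Sum>j. \<integral>\<^sup>+k. ennreal (energy_term (int_decode j) (int_decode i) a b k) \<partial>lborel)"
    unfolding energy_def by (simp add: nn_integral_suminf)
  also have "\<dots> \<le> (\<Sum>i. \<Sum>j. ennreal (9 * ?w i) * (\<integral>\<^sup>+s. ennreal ((cmod (vhat (int_decode j - int_decode i) s))\<^sup>2) * indicator {a..<b} s \<partial>lborel))"
    by (intro suminf_le summableI nn_integral_energy_term assms)
  also have "\<dots> = (\<Sum>i. ennreal (9 * ?w i) * (\<integral>\<^sup>+s. (\<Sum>j. ennreal ((cmod (vhat (int_decode j - int_decode i) s))\<^sup>2)) * indicator {a..<b} s \<partial>lborel))"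
    by (simp add: ennreal_suminf_cmult nn_integral_suminf[symmetric] ennreal_suminf_multc)
  also have "\<dots> \<le> (\<Sum>i. ennreal (9 * ?w i) * (\<integral>\<^sup>+s. ennreal (N\<^sup>2) * indicator {a..<b} s \<partial>lborel))"
  proof (intro suminf_le summableI mult_left_mono nn_integral_mono mult_right_mono)
    fix i s
    show "(\<Sum>j. ennreal ((cmod (vhat (int_decode j - int_decode i) s))\<^sup>2)) \<le> ennreal (N\<^sup>2)"
    proof (rule suminf_le_const)
      fix M
      have inj: "inj_on (\<lambda>j. int_decode j - int_decode i) {..<M}"
        by (auto simp: inj_on_def int_decode_eq)
      have "(\<Sum>j<M. ennreal ((cmod (vhat (int_decode j - int_decode i) s))\<^sup>2)) =
        ennreal (\<Sum>n\<in>(\<lambda>j. int_decode j - int_decode i) ` {..<M}. (cmod (vhat n s))\<^sup>2)"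
        by (subst sum.reindex[OF inj]) simp
      also have "\<dots> \<le> ennreal (N\<^sup>2)" by (intro ennreal_leI vhat_bessel) simp
      finally show "(\<Sum>j<M. ennreal ((cmod (vhat (int_decode j - int_decode i) s))\<^sup>2)) \<le> ennreal (N\<^sup>2)" .
    qed (rule summableI)
  qed auto
  also have "(\<integral>\<^sup>+s. ennreal (N\<^sup>2) * indicator {a..<b} s \<partial>lborel) = ennreal (N\<^sup>2 * (b - a))"
    using ab by (simp add: nn_integral_cmult ennreal_mult)
  also have "(\<Sum>i. ennreal (9 * ?w i) * ennreal (N\<^sup>2 * (b - a))) = ennreal (9 * zeta * N\<^sup>2 * (b - a))"
    using ab zeta_nonneg
    by (simp add: ennreal_suminf_multc ennreal_suminf_cmult ennreal_mult suminf_zeta mult.assoc)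
  finally show ?thesis .
qed

text \<open>The bound on the mean of the energies of one level is the same on every level, because
  the interval lengths add up to T. The factor |I|^r makes the sum over the levels
  geometric.\<close>

definition scaled_energy :: "real \<Rightarrow> nat \<Rightarrow> nat \<Rightarrow> real \<Rightarrow> ennreal" where
  "scaled_energy r l j k = ennreal ((T / 2 ^ l) powr r) * energy (node T l j) (node T l (Suc j)) k"

text \<open>The sum over all dyadic descendants of a node, itself included; at the root it is H(k).
  Unlike a single energy, it dominates the sum of its values on the two halves.\<close>

definition total_energy :: "real \<Rightarrow> nat \<Rightarrow> nat \<Rightarrow> real \<Rightarrow> ennreal" where
  "total_energy r l j k = (\<Sum>e. \<Sum>i<2 ^ e. scaled_energy r (l + e) (j * 2 ^ e + i) k)"

lemma scaled_energy_measurable [measurable]: "scaled_energy r l j \<in> borel_measurable borel"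
  unfolding scaled_energy_def by measurable

lemma total_energy_measurable [measurable]: "total_energy r l j \<in> borel_measurable borel"
  unfolding total_energy_def by measurable

lemma total_energy_rec:
  "total_energy r l j k = scaled_energy r l j k + (total_energy r (Suc l) (2 * j) k + total_energy r (Suc l) (Suc (2 * j)) k)"
proof -
  let ?f = "\<lambda>e. \<Sum>i<2 ^ e. scaled_energy r (l + e) (j * 2 ^ e + i) k"
  have "?f (Suc e) = (\<Sum>i<2 ^ e. scaled_energy r (Suc l + e) (2 * j * 2 ^ e + i) k)
       + (\<Sum>i<2 ^ e. scaled_energy r (Suc l + e) (Suc (2 * j) * 2 ^ e + i) k)" for e
  proof -
    have "{..<2 ^ Suc e} = {..<2 ^ e} \<union> (+) (2 ^ e) ` {..<2 ^ e :: nat}"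
      by (simp add: mult_2 image_add_atLeastLessThan lessThan_atLeast0 ivl_disj_un_two)
    then have "?f (Suc e) = (\<Sum>i\<in>{..<2 ^ e}. scaled_energy r (l + Suc e) (j * 2 ^ Suc e + i) k)
        + (\<Sum>i\<in>(+) (2 ^ e) ` {..<2 ^ e}. scaled_energy r (l + Suc e) (j * 2 ^ Suc e + i) k)"
      by (simp only:) (intro sum.union_disjoint, auto)
    then show ?thesis by (simp add: sum.reindex algebra_simps)
  qed
  moreover have "(\<Sum>e. ?f e) = ?f 0 + (\<Sum>e. ?f (Suc e))"
    using suminf_offset[of ?f 1] by (simp add: summableI)
  ultimately show ?thesis
    unfolding total_energy_def by (simp add: suminf_add[symmetric] summableI)
qed

lemma nn_integral_total_energy:
  assumes r: "r > 0"
  shows "(\<integral>\<^sup>+k. total_energy r 0 0 k \<partial>lborel) \<le> ennreal (9 * zeta / (1 - 2 powr - r) * (N\<^sup>2 * T powr (1 + r)))"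
proof -
  have sc: "(\<integral>\<^sup>+k. scaled_energy r e i k \<partial>lborel) \<le> ennreal (9 * zeta * N\<^sup>2 * (T / 2 ^ e) powr (1 + r))"
    if "i < 2 ^ e" for e i
  proof -
    have "(\<integral>\<^sup>+k. scaled_energy r e i k \<partial>lborel) = ennreal ((T / 2 ^ e) powr r) * (\<integral>\<^sup>+k. energy (node T e i) (node T e (Suc i)) k \<partial>lborel)"
      unfolding scaled_energy_def by (intro nn_integral_cmult) measurable
    also have "\<dots> \<le> ennreal ((T / 2 ^ e) powr r) * ennreal (9 * zeta * N\<^sup>2 * (node T e (Suc i) - node T e i))"
      using that T_pos node_le[of T "Suc i" e] by (intro mult_left_mono nn_integral_energy node_nonneg node_mono) auto
    also have "\<dots> = ennreal ((T / 2 ^ e) powr r * (9 * zeta * N\<^sup>2 * (T / 2 ^ e)))"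
      unfolding node_Suc_diff using zeta_nonneg T_pos by (intro ennreal_mult[symmetric]) auto
    also have "(T / 2 ^ e) powr r * (9 * zeta * N\<^sup>2 * (T / 2 ^ e)) = 9 * zeta * N\<^sup>2 * (T / 2 ^ e) powr (1 + r)"
      using T_pos by (simp add: powr_add)
    finally show ?thesis .
  qed
  let ?q = "2 powr - r :: real"
  have q: "0 < ?q" "?q < 1" using r powr_less_mono[of "- r" 0 2] by auto
  have "(\<integral>\<^sup>+k. total_energy r 0 0 k \<partial>lborel) = (\<Sum>e. \<Sum>i<2 ^ e. \<integral>\<^sup>+k. scaled_energy r e i k \<partial>lborel)"
    unfolding total_energy_def by (simp add: nn_integral_suminf nn_integral_sum)
  also have "\<dots> \<le> (\<Sum>e. \<Sum>i<2 ^ e :: nat. ennreal (9 * zeta * N\<^sup>2 * (T / 2 ^ e) powr (1 + r)))"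
    using sc by (intro suminf_le summableI sum_mono) auto
  also have "\<dots> = (\<Sum>e. ennreal (9 * zeta * N\<^sup>2 * T powr (1 + r) * ?q ^ e))"
  proof (intro suminf_cong)
    fix e
    have "2 ^ e * (T / 2 ^ e) powr (1 + r) = T powr (1 + r) * ?q ^ e"
    proof -
      have "(2 ^ e :: real) powr (1 + r) = 2 ^ e * (2 powr r) ^ e"
        by (simp add: powr_add) (simp add: powr_powr mult.commute flip: powr_realpow)
      then show ?thesis using T_pos by (simp add: powr_divide powr_minus power_inverse field_simps)
    qed
    then have "(\<Sum>i<2 ^ e :: nat. 9 * zeta * N\<^sup>2 * (T / 2 ^ e) powr (1 + r)) = 9 * zeta * N\<^sup>2 * T powr (1 + r) * ?q ^ e"
      by (simp add: mult_ac)
    then show "(\<Sum>i<2 ^ e :: nat. ennreal (9 * zeta * N\<^sup>2 * (T / 2 ^ e) powr (1 + r))) = ennreal (9 * zeta * N\<^sup>2 * T powr (1 + r) * ?q ^ e)"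
      using zeta_nonneg by (subst sum_ennreal) simp_all
  qed
  also have "\<dots> = ennreal (\<Sum>e. 9 * zeta * N\<^sup>2 * T powr (1 + r) * ?q ^ e)"
    using zeta_nonneg q by (intro suminf_ennreal2 summable_mult summable_geometric) auto
  also have "(\<Sum>e. 9 * zeta * N\<^sup>2 * T powr (1 + r) * ?q ^ e) = 9 * zeta / (1 - ?q) * (N\<^sup>2 * T powr (1 + r))"
    using q by (simp add: suminf_mult suminf_geometric summable_geometric)
  finally show ?thesis .
qed

end

section \<open>Frequency blocks\<close>

lemma set_integral_finite_sum:
  fixes f :: "'i \<Rightarrow> 'a \<Rightarrow> 'b::{banach, second_countable_topology}"
  assumes "finite F" "\<And>i. i \<in> F \<Longrightarrow> set_integrable M A (f i)"
  shows "(LINT x:A|M. \<Sum>i\<in>F. f i x) = (\<Sum>i\<in>F. LINT x:A|M. f i x)"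
  unfolding set_lebesgue_integral_def scaleR_sum_right
  by (rule Bochner_Integration.integral_sum) (use assms in \<open>simp add: set_integrable_def\<close>)

lemma set_integrable_finite_sum:
  fixes f :: "'i \<Rightarrow> 'a \<Rightarrow> 'b::{banach, second_countable_topology}"
  assumes "finite F" "\<And>i. i \<in> F \<Longrightarrow> set_integrable M A (f i)"
  shows "set_integrable M A (\<lambda>x. \<Sum>i\<in>F. f i x)"
  unfolding set_integrable_def scaleR_sum_right
  by (rule Bochner_Integration.integrable_sum) (use assms in \<open>simp add: set_integrable_def\<close>)

text \<open>The infinite sum has the default value 0 when it diverges, so bounds on
  \<open>ell2\<close> are proved together with \<open>ell2_summable\<close>.\<close>

definition ell2 :: "(int \<Rightarrow> complex) \<Rightarrow> real" where
  "ell2 x = sqrt (\<Sum>\<^sub>\<infinity>n. (cmod (x n))\<^sup>2)"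

abbreviation ell2_summable :: "(int \<Rightarrow> complex) \<Rightarrow> bool" where
  "ell2_summable x \<equiv> (\<lambda>n. (cmod (x n))\<^sup>2) summable_on UNIV"

abbreviation norm_on :: "(int \<Rightarrow> complex) \<Rightarrow> int set \<Rightarrow> real" where
  "norm_on x F \<equiv> L2_set (\<lambda>n. cmod (x n)) F"

lemma ell2_nonneg: "ell2 x \<ge> 0"
  by (simp add: ell2_def infsum_nonneg)

lemma ell2_power2: "(ell2 x)\<^sup>2 = (\<Sum>\<^sub>\<infinity>n. (cmod (x n))\<^sup>2)"
  by (simp add: ell2_def infsum_nonneg)

lemma norm_on_le_ell2:
  assumes "ell2_summable x" "finite F"
  shows "norm_on x F \<le> ell2 x"
  unfolding L2_set_def ell2_def
  using assms by (intro real_sqrt_le_mono finite_sum_le_infsum) auto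

lemma ell2_leI:
  assumes "\<And>F. finite F \<Longrightarrow> norm_on x F \<le> B"
  shows "ell2_summable x" "ell2 x \<le> B"
proof -
  have B: "B \<ge> 0" using assms[of "{}"] by simp
  have *: "(\<Sum>n\<in>F. (cmod (x n))\<^sup>2) \<le> B\<^sup>2" if "finite F" for F
    using assms[OF that] by (simp add: L2_set_def sqrt_le_D)
  then show s: "ell2_summable x"
    by (intro nonneg_bdd_above_summable_on bdd_aboveI2[where M = "B\<^sup>2"]) auto
  have "(\<Sum>\<^sub>\<infinity>n. (cmod (x n))\<^sup>2) \<le> B\<^sup>2" using s * by (intro infsum_le_finite_sums) auto
  then show "ell2 x \<le> B" using B by (simp add: ell2_def real_le_lsqrt)
qed

lemma ell2_add:
  assumes "ell2_summable x" "ell2_summable y"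
  shows "ell2_summable (\<lambda>n. x n + y n)" "ell2 (\<lambda>n. x n + y n) \<le> ell2 x + ell2 y"
proof -
  have "norm_on (\<lambda>n. x n + y n) F \<le> ell2 x + ell2 y" if F: "finite F" for F
  proof -
    have "norm_on (\<lambda>n. x n + y n) F \<le> L2_set (\<lambda>n. cmod (x n) + cmod (y n)) F"
      by (intro L2_set_mono norm_triangle_ineq) auto
    also have "\<dots> \<le> norm_on x F + norm_on y F" by (rule L2_set_triangle_ineq)
    finally show ?thesis
      using norm_on_le_ell2[OF assms(1) F] norm_on_le_ell2[OF assms(2) F] by linarith
  qed
  from ell2_leI[OF this] show "ell2_summable (\<lambda>n. x n + y n)" "ell2 (\<lambda>n. x n + y n) \<le> ell2 x + ell2 y" by auto
qed

lemma norm_sum_le_norm_on: "cmod (\<Sum>n\<in>F. \<phi> n * x n) \<le> norm_on \<phi> F * norm_on x F"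
proof -
  have "cmod (\<Sum>n\<in>F. \<phi> n * x n) \<le> (\<Sum>n\<in>F. cmod (\<phi> n) * cmod (x n))"
    using norm_sum[of "\<lambda>n. \<phi> n * x n" F] by (simp add: norm_mult)
  also have "\<dots> \<le> norm_on \<phi> F * norm_on x F"
    using L2_set_mult_ineq[of "\<lambda>n. cmod (\<phi> n)" "\<lambda>n. cmod (x n)" F] by simp
  finally show ?thesis .
qed

text \<open>Tested with the conjugate of \<open>x\<close> itself. Norms of time integrals are
  estimated in this dual form, because a pairing with a fixed \<phi> turns them into scalar
  integrals.\<close>

lemma norm_on_dual:
  assumes "\<And>\<phi>. cmod (\<Sum>n\<in>F. \<phi> n * x n) \<le> B * norm_on \<phi> F" "B \<ge> 0"
  shows "norm_on x F \<le> B"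
proof -
  have "(\<Sum>n\<in>F. cnj (x n) * x n) = of_real (\<Sum>n\<in>F. (cmod (x n))\<^sup>2)"
    by (simp add: complex_norm_square mult.commute del: of_real_power)
  then have "(\<Sum>n\<in>F. (cmod (x n))\<^sup>2) \<le> B * norm_on x F"
    using assms(1)[of "\<lambda>n. cnj (x n)"] by (simp add: sum_nonneg del: of_real_sum)
  then have "norm_on x F * norm_on x F \<le> B * norm_on x F"
    by (simp add: L2_set_def sum_nonneg)
  then show ?thesis using assms(2) L2_set_nonneg[of "\<lambda>n. cmod (x n)" F]
    by (metis mult_le_cancel_right order_le_less not_less)
qed

lemma norm_on_subset: "finite G \<Longrightarrow> F \<subseteq> G \<Longrightarrow> norm_on x F \<le> norm_on x G"
  unfolding L2_set_def by (intro real_sqrt_le_mono sum_mono2) auto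

lemma norm_on_cmult: "norm_on (\<lambda>n. c * x n) F = cmod c * norm_on x F"
  by (simp add: L2_set_def norm_mult power_mult_distrib real_sqrt_mult flip: sum_distrib_left)

lemma norm_on_unimodular: "(\<And>n. cmod (c n) = 1) \<Longrightarrow> norm_on (\<lambda>n. c n * x n) F = norm_on x F"
  by (simp add: L2_set_def norm_mult)

text \<open>The number of binary digits of |n|, with value 0 at n = 0.\<close>

definition log_size :: "int \<Rightarrow> nat" where
  "log_size n = (LEAST j. \<bar>n\<bar> < 2 ^ j)"

lemma abs_less_log_size: "\<bar>n\<bar> < 2 ^ log_size n"
proof -
  have "\<bar>n\<bar> < 2 ^ nat \<bar>n\<bar>"
    using of_nat_less_two_power[of "nat \<bar>n\<bar>", where ?'a = int] by simp
  then show ?thesis unfolding log_size_def by (rule LeastI)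
qed

lemma less_log_size: "i < log_size n \<Longrightarrow> 2 ^ i \<le> \<bar>n\<bar>"
  unfolding log_size_def using not_less_Least not_less by blast

lemma finite_log_size: "finite {n. log_size n \<le> j}"
proof (rule finite_subset)
  show "{n. log_size n \<le> j} \<subseteq> {- (2 ^ j)..2 ^ j}"
  proof safe
    fix n assume "log_size n \<le> j"
    then have "(2::int) ^ log_size n \<le> 2 ^ j" by (simp add: power_increasing)
    then show "n \<in> {- (2 ^ j)..2 ^ j}" using abs_less_log_size[of n]
      unfolding atLeastAtMost_iff by linarith
  qed
qed simp

text \<open>
  All frequencies from \<open>2 ^ (L - 1)\<close> on form a single block, which makes the weights bounded and the
  sets of source frequencies of jumps finite. All estimates are uniform in \<open>L\<close>.
\<close>

definition block :: "nat \<Rightarrow> int \<Rightarrow> nat" where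
  "block L n = min (log_size n) L"

definition weight :: "real \<Rightarrow> nat \<Rightarrow> int \<Rightarrow> real" where
  "weight \<alpha> L n = 2 powr (\<alpha> * real (block L n))"

text \<open>The sources of jumps into block \<open>i\<close>. A distance of two blocks is required
  since frequencies in adjacent blocks may be almost equal, with no oscillation to exploit.\<close>

definition low :: "nat \<Rightarrow> nat \<Rightarrow> int set" where
  "low L i = {m. block L m + 2 \<le> i}"

lemma block_le: "block L n \<le> L" "block L n \<le> log_size n"
  by (auto simp: block_def)

lemma low_log_size: "i \<le> L \<Longrightarrow> m \<in> low L i \<Longrightarrow> block L m = log_size m"
  unfolding low_def block_def mem_Collect_eq by linarith

lemma finite_low: "i \<le> L \<Longrightarrow> finite (low L i)"
  by (rule finite_subset[OF _ finite_log_size[of L]]) (auto simp: low_def block_def min_def split: if_splits)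

lemma low_mono: "i \<le> j \<Longrightarrow> low L i \<subseteq> low L j"
  by (auto simp: low_def)

text \<open>A source lies at least two blocks below the cap, so its block is its true dyadic size
  even if the block of \<open>n\<close> is capped.\<close>

lemma jump_abs:
  assumes "m \<in> low L (block L n)"
  shows "n \<noteq> 0" "2 * \<bar>m\<bar> \<le> \<bar>n\<bar>"
proof -
  have b: "block L m = log_size m" using low_log_size[OF block_le(1) assms] .
  then have "Suc (log_size m) < log_size n" using assms block_le(2)[of L n] by (auto simp: low_def)
  then have "2 ^ Suc (log_size m) \<le> \<bar>n\<bar>" by (rule less_log_size)
  then show "n \<noteq> 0" "2 * \<bar>m\<bar> \<le> \<bar>n\<bar>" using abs_less_log_size[of m] by auto
qed

lemma weight_pos: "weight \<alpha> L n > 0"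
  by (simp add: weight_def)

lemma weight_power2_le:
  assumes "n \<noteq> 0" "\<alpha> > 0"
  shows "(weight \<alpha> L n)\<^sup>2 \<le> 4 powr \<alpha> * ((real_of_int n)\<^sup>2) powr \<alpha>"
proof -
  have "log_size n > 0" using assms abs_less_log_size[of n] by (cases "log_size n") auto
  then have "2 ^ (log_size n - 1) \<le> \<bar>n\<bar>" by (intro less_log_size) simp
  then have "(2::real) ^ (log_size n - 1) \<le> \<bar>real_of_int n\<bar>"
    by (metis of_int_abs of_int_le_iff of_int_numeral of_int_power)
  then have "(2::real) * 2 ^ (log_size n - 1) \<le> 2 * \<bar>real_of_int n\<bar>" by simp
  also have "(2::real) * 2 ^ (log_size n - 1) = 2 powr real (log_size n)"
    using \<open>log_size n > 0\<close> by (simp add: powr_realpow flip: power_Suc)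
  finally have 1: "2 powr real (log_size n) \<le> 2 * \<bar>real_of_int n\<bar>" .
  have "weight \<alpha> L n \<le> 2 powr (\<alpha> * real (log_size n))"
    unfolding weight_def using block_le(2)[of L n] assms by (intro powr_mono mult_left_mono) auto
  also have "\<dots> = (2 powr real (log_size n)) powr \<alpha>" by (simp add: powr_powr mult.commute)
  also have "\<dots> \<le> (2 * \<bar>real_of_int n\<bar>) powr \<alpha>" using 1 assms by (intro powr_mono2) auto
  finally have "(weight \<alpha> L n)\<^sup>2 \<le> ((2 * \<bar>real_of_int n\<bar>) powr \<alpha>)\<^sup>2"
    using weight_pos[of \<alpha> L n] by (intro power_mono) auto
  also have "\<dots> = ((2 * \<bar>real_of_int n\<bar>)\<^sup>2) powr \<alpha>"
    by (simp only: power2_eq_square powr_mult)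
  also have "(2 * \<bar>real_of_int n\<bar>)\<^sup>2 = 4 * (real_of_int n)\<^sup>2" by (simp add: power_mult_distrib)
  also have "(4 * (real_of_int n)\<^sup>2) powr \<alpha> = 4 powr \<alpha> * ((real_of_int n)\<^sup>2) powr \<alpha>"
    by (rule powr_mult)
  finally show ?thesis .
qed

text \<open>2^\<alpha> compares the weight at \<open>n\<close> with |n|^\<alpha>. The geometric
  series runs over the blocks of the source: its weight gains 2^(-\<alpha> j), while the factor 3/2
  in the exponent of the energy costs 2^(3 \<alpha> j / 4), which leaves 2^(-\<alpha> j /
  4).\<close>

definition jump_const :: "real \<Rightarrow> real" where
  "jump_const \<alpha> = 2 powr \<alpha> / (1 - 2 powr - (\<alpha> / 4))"

lemma jump_const_pos: "0 < \<alpha> \<Longrightarrow> jump_const \<alpha> > 0"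
  using powr_less_mono[of "- (\<alpha> / 4)" 0 2] by (simp add: jump_const_def)

section \<open>Jumps between frequency blocks: the two endpoint bounds and their
  interpolation\<close>

context potential
begin

definition osc_kernel :: "real \<Rightarrow> int \<Rightarrow> int \<Rightarrow> real \<Rightarrow> complex" where
  "osc_kernel k n m s = cis (- (k * of_int (n\<^sup>2 - m\<^sup>2) * s)) * vhat (n - m) s"

lemma osc_kernel_measurable [measurable]: "osc_kernel k n m \<in> borel_measurable borel"
  unfolding osc_kernel_def cis_conv_exp by measurable

lemma osc_kernel_le: "cmod (osc_kernel k n m s) \<le> N"
  by (simp add: osc_kernel_def norm_mult vhat_le)

lemma osc_kernel_integrable: "set_integrable lborel {a..<b} (osc_kernel k n m)"
  by (rule set_integrable_bounded_interval[of _ N]) (auto simp: osc_kernel_le)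

lemma osc_eq: "osc n m a b k = (LINT s:{a..<b}|lborel. osc_kernel k n m s)"
  by (simp add: osc_def osc_kernel_def)

lemma W_mult_L2: "z \<in> L2_torus \<Longrightarrow> (\<lambda>x. W (x, s) * z x) \<in> L2_torus"
  by (rule L2_torus_mult_bounded(1)[OF _ W_section_torus W_le])

lemma W_pairing:
  assumes "finite F" "z \<in> L2_torus" "\<And>n. cmod (c n) = 1"
  shows "cmod (\<Sum>n\<in>F. \<phi> n * (c n * fourier_coeff (\<lambda>x. W (x, s) * z x) n)) \<le> N * L2_norm z * norm_on \<phi> F"
proof -
  have "cmod (\<Sum>n\<in>F. \<phi> n * (c n * fourier_coeff (\<lambda>x. W (x, s) * z x) n)) \<le>
      norm_on \<phi> F * norm_on (fourier_coeff (\<lambda>x. W (x, s) * z x)) F"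
    using norm_sum_le_norm_on[of \<phi> "\<lambda>n. c n * fourier_coeff (\<lambda>x. W (x, s) * z x) n" F]
    by (simp add: norm_on_unimodular[OF assms(3)])
  also have "norm_on \<phi> F * norm_on (fourier_coeff (\<lambda>x. W (x, s) * z x)) F \<le> norm_on \<phi> F * (N * L2_norm z)"
  proof (rule mult_left_mono[OF _ L2_set_nonneg])
    have "norm_on (fourier_coeff (\<lambda>x. W (x, s) * z x)) F \<le> L2_norm (\<lambda>x. W (x, s) * z x)"
      using bessel[OF assms(1) W_mult_L2[OF assms(2), of s]] L2_norm_nonneg
      by (simp add: L2_set_def real_le_lsqrt)
    also have "\<dots> \<le> N * L2_norm z"
      by (rule L2_norm_mult_bounded[OF assms(2) W_section_torus W_le N_nonneg])
    finally show "norm_on (fourier_coeff (\<lambda>x. W (x, s) * z x)) F \<le> N * L2_norm z" .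
  qed
  finally show ?thesis by (simp only: mult_ac)
qed

lemma fourier_coeff_W_emode: "fourier_coeff (\<lambda>x. W (x, s) * (c * emode m x)) n = c * vhat (n - m) s"
proof -
  have "fourier_coeff (\<lambda>x. W (x, s) * (c * emode m x)) n = (LINT x|torus. c * (W (x, s) * exp (- (\<i> * of_int (n - m) * complex_of_real x))))"
    unfolding fourier_coeff_def emode_def
    by (intro Bochner_Integration.integral_cong refl) (simp add: algebra_simps flip: exp_add)
  then show ?thesis by (simp add: vhat_def fourier_coeff_def)
qed

lemma fourier_coeff_W_trig_poly:
  assumes "finite B"
  shows "fourier_coeff (\<lambda>x. W (x, s) * (\<Sum>m\<in>B. c m * emode m x)) n = (\<Sum>m\<in>B. c m * vhat (n - m) s)"
proof -
  have "fourier_coeff (\<lambda>x. W (x, s) * (\<Sum>m\<in>B. c m * emode m x)) n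
    = (\<Sum>m\<in>B. fourier_coeff (\<lambda>x. W (x, s) * (c m * emode m x)) n)"
    unfolding fourier_coeff_eq sum_distrib_left
    by (intro L2_inner_sum assms W_mult_L2 L2_torus_cmult emode_L2)
  then show ?thesis by (simp add: fourier_coeff_W_emode)
qed

text \<open>The phase is a product of one factor in \<open>n\<close> and one in \<open>m\<close>. At
  a fixed time the kernel is therefore multiplication by \<open>W\<close> between two diagonal
  unitary operators, with norm at most \<open>N\<close> on any set of sources and targets.\<close>

lemma osc_kernel_pairing:
  assumes "finite F" "finite B"
  shows "cmod (\<Sum>n\<in>F. \<phi> n * (\<Sum>m\<in>B. osc_kernel k n m s * x m)) \<le> N * norm_on x B * norm_on \<phi> F"
proof -
  let ?c = "\<lambda>m. cis (k * (real_of_int m)\<^sup>2 * s) * x m"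
  let ?z = "\<lambda>y. \<Sum>m\<in>B. ?c m * emode m y"
  have "(\<Sum>m\<in>B. osc_kernel k n m s * x m) = cis (- (k * (real_of_int n)\<^sup>2 * s)) * fourier_coeff (\<lambda>y. W (y, s) * ?z y) n" for n
  proof -
    have "cis (- (k * (real_of_int n)\<^sup>2 * s)) * fourier_coeff (\<lambda>y. W (y, s) * ?z y) n
        = (\<Sum>m\<in>B. cis (- (k * (real_of_int n)\<^sup>2 * s)) * (?c m * vhat (n - m) s))"
      by (subst fourier_coeff_W_trig_poly[OF assms(2)]) (rule sum_distrib_left)
    moreover have "osc_kernel k n m s * x m = cis (- (k * (real_of_int n)\<^sup>2 * s)) * (?c m * vhat (n - m) s)" for m
    proof -
      have "cis (- (k * of_int (n\<^sup>2 - m\<^sup>2) * s)) = cis (- (k * (real_of_int n)\<^sup>2 * s)) * cis (k * (real_of_int m)\<^sup>2 * s)"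
        by (simp add: cis_mult algebra_simps)
      then show ?thesis by (simp add: osc_kernel_def mult_ac)
    qed
    ultimately show ?thesis by (simp only:)
  qed
  moreover have "L2_norm ?z = norm_on x B"
    using L2_norm_trig_poly[OF assms(2), of ?c] L2_norm_nonneg[of ?z]
    by (simp add: L2_set_def norm_mult real_sqrt_unique[symmetric])
  ultimately show ?thesis
    using W_pairing[OF assms(1) trig_poly_L2[OF assms(2)], of "\<lambda>n. cis (- (k * (real_of_int n)\<^sup>2 * s))" \<phi> s ?c] by simp
qed

lemma osc_pairing:
  assumes "finite F" "finite B" "a \<le> b"
  shows "cmod (\<Sum>n\<in>F. \<phi> n * (\<Sum>m\<in>B. osc n m a b k * x m)) \<le> N * (b - a) * norm_on x B * norm_on \<phi> F"
proof -
  let ?f = "\<lambda>s. \<Sum>n\<in>F. \<phi> n * (\<Sum>m\<in>B. osc_kernel k n m s * x m)"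
  have "(\<Sum>n\<in>F. \<phi> n * (\<Sum>m\<in>B. osc n m a b k * x m)) = (LINT s:{a..<b}|lborel. ?f s)"
  proof -
    have i: "set_integrable lborel {a..<b} (\<lambda>s. osc_kernel k n m s * x m)" for n m
      by (intro set_integrable_mult_left osc_kernel_integrable)
    have "(LINT s:{a..<b}|lborel. ?f s) = (\<Sum>n\<in>F. LINT s:{a..<b}|lborel. \<phi> n * (\<Sum>m\<in>B. osc_kernel k n m s * x m))"
      by (intro set_integral_finite_sum set_integrable_mult_right set_integrable_finite_sum assms i)
    also have "\<dots> = (\<Sum>n\<in>F. \<phi> n * (\<Sum>m\<in>B. LINT s:{a..<b}|lborel. osc_kernel k n m s * x m))"
      by (intro sum.cong refl, subst set_integral_mult_right, subst set_integral_finite_sum[OF assms(2) i]) simp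
    finally show ?thesis by (simp add: osc_eq)
  qed
  moreover have "cmod (LINT s:{a..<b}|lborel. ?f s) \<le> (LINT s:{a..<b}|lborel. N * norm_on x B * norm_on \<phi> F)"
    unfolding set_lebesgue_integral_def
  proof (rule Bochner_Integration.integral_norm_bound_integral)
    show "integrable lborel (\<lambda>s. indicator {a..<b} s *\<^sub>R ?f s)"
      unfolding set_integrable_def[symmetric]
      by (intro set_integrable_mult_right set_integrable_mult_left set_integrable_finite_sum assms osc_kernel_integrable)
    show "integrable lborel (\<lambda>s. indicator {a..<b} s *\<^sub>R (N * norm_on x B * norm_on \<phi> F))"
      unfolding set_integrable_def[symmetric] by (rule set_integrable_bounded_interval) auto
    show "norm (indicator {a..<b} s *\<^sub>R ?f s) \<le> indicator {a..<b} s *\<^sub>R (N * norm_on x B * norm_on \<phi> F)" for s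
      using osc_kernel_pairing[OF assms(1,2), of \<phi> k s x] by (simp add: indicator_def)
  qed
  ultimately show ?thesis using assms(3) by (simp add: set_lebesgue_integral_def mult_ac)
qed

text \<open>The endpoint with one full power of |n|: Cauchy-Schwarz over the sources bounds the
  operator by its Hilbert-Schmidt norm, and 2^(3 j / 2) undoes the weight (1 + |m|)^(-3/2) on the
  block \<open>j\<close>.\<close>

lemma osc_block_energy:
  assumes F: "finite F" "\<And>n. n \<in> F \<Longrightarrow> j + 2 \<le> block L n" and B: "finite B" "\<And>m. m \<in> B \<Longrightarrow> log_size m = j"
    and e: "energy a b k \<le> ennreal e" "e \<ge> 0" and jL: "j + 2 \<le> L"
  shows "(\<Sum>n\<in>F. (real_of_int n)\<^sup>2 * (cmod (\<Sum>m\<in>B. osc n m a b k * x m))\<^sup>2)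
    \<le> 2 powr (3 / 2 * real j) * e * (norm_on x B)\<^sup>2"
proof -
  have osc: "(real_of_int n)\<^sup>2 * (cmod (osc n m a b k))\<^sup>2 \<le> 2 powr (3 / 2 * real j) * energy_term n m a b k"
    if n: "n \<in> F" and m: "m \<in> B" for n m
  proof -
    have "m \<in> low L (block L n)" using F(2)[OF n] B(2)[OF m] block_le(2)[of L m] by (simp add: low_def)
    note j = jump_abs[OF this]
    have "\<bar>m\<bar> < 2 ^ j" using abs_less_log_size[of m] B(2)[OF m] by simp
    then have "1 + \<bar>m\<bar> \<le> 2 ^ j" by simp
    then have "real_of_int (1 + \<bar>m\<bar>) \<le> real_of_int (2 ^ j)" by (simp only: of_int_le_iff)
    then have "1 + \<bar>real_of_int m\<bar> \<le> 2 powr real j" by (simp add: powr_realpow)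
    then have "(1 + \<bar>real_of_int m\<bar>) powr (3 / 2) \<le> (2 powr real j) powr (3 / 2)" by (intro powr_mono2) auto
    also have "\<dots> = 2 powr (3 / 2 * real j)" by (simp add: powr_powr mult.commute)
    finally have "(1 + \<bar>real_of_int m\<bar>) powr (3 / 2) * energy_term n m a b k \<le> 2 powr (3 / 2 * real j) * energy_term n m a b k"
      using energy_term_nonneg by (intro mult_right_mono)
    moreover have "(1 + \<bar>real_of_int m\<bar>) powr (3 / 2) * energy_term n m a b k = (real_of_int n)\<^sup>2 * (cmod (osc n m a b k))\<^sup>2"
      using j by (simp add: energy_term_def powr_minus field_simps)
    ultimately show ?thesis by simp
  qed
  have "(\<Sum>n\<in>F. (real_of_int n)\<^sup>2 * (cmod (\<Sum>m\<in>B. osc n m a b k * x m))\<^sup>2)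
     \<le> (\<Sum>n\<in>F. (\<Sum>m\<in>B. 2 powr (3 / 2 * real j) * energy_term n m a b k) * (norm_on x B)\<^sup>2)"
  proof (rule sum_mono)
    fix n assume n: "n \<in> F"
    have "(cmod (\<Sum>m\<in>B. osc n m a b k * x m))\<^sup>2 \<le> (norm_on (\<lambda>m. osc n m a b k) B * norm_on x B)\<^sup>2"
      by (intro power_mono norm_sum_le_norm_on) auto
    also have "\<dots> = (\<Sum>m\<in>B. (cmod (osc n m a b k))\<^sup>2) * (norm_on x B)\<^sup>2"
      by (simp add: power_mult_distrib L2_set_def sum_nonneg)
    finally have "(real_of_int n)\<^sup>2 * (cmod (\<Sum>m\<in>B. osc n m a b k * x m))\<^sup>2 \<le>
      (real_of_int n)\<^sup>2 * ((\<Sum>m\<in>B. (cmod (osc n m a b k))\<^sup>2) * (norm_on x B)\<^sup>2)" by (intro mult_left_mono) auto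
    also have "\<dots> = (\<Sum>m\<in>B. (real_of_int n)\<^sup>2 * (cmod (osc n m a b k))\<^sup>2) * (norm_on x B)\<^sup>2"
      by (simp add: sum_distrib_left mult.assoc)
    also have "\<dots> \<le> (\<Sum>m\<in>B. 2 powr (3 / 2 * real j) * energy_term n m a b k) * (norm_on x B)\<^sup>2"
      using osc n by (intro mult_right_mono sum_mono) auto
    finally show "(real_of_int n)\<^sup>2 * (cmod (\<Sum>m\<in>B. osc n m a b k * x m))\<^sup>2 \<le>
      (\<Sum>m\<in>B. 2 powr (3 / 2 * real j) * energy_term n m a b k) * (norm_on x B)\<^sup>2" .
  qed
  also have "\<dots> = 2 powr (3 / 2 * real j) * (\<Sum>m\<in>B. \<Sum>n\<in>F. energy_term n m a b k) * (norm_on x B)\<^sup>2"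
    by (subst sum.swap) (simp add: sum_distrib_left sum_distrib_right)
  also have "\<dots> \<le> 2 powr (3 / 2 * real j) * e * (norm_on x B)\<^sup>2"
  proof -
    have "(\<Sum>m\<in>B. \<Sum>n\<in>F. energy_term n m a b k) \<le> e"
      using order_trans[OF sum_le_energy[OF F(1) B(1)] e(1)] e(2) by (simp add: ennreal_le_iff)
    then show ?thesis by (intro mult_right_mono mult_left_mono) auto
  qed
  finally show ?thesis .
qed

lemma osc_block_l2:
  assumes "finite F" "finite B" "a \<le> b"
  shows "(\<Sum>n\<in>F. (cmod (\<Sum>m\<in>B. osc n m a b k * x m))\<^sup>2) \<le> (N * (b - a))\<^sup>2 * (norm_on x B)\<^sup>2"
proof -
  have "norm_on (\<lambda>n. \<Sum>m\<in>B. osc n m a b k * x m) F \<le> N * (b - a) * norm_on x B"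
    using osc_pairing[OF assms] N_nonneg assms(3) by (intro norm_on_dual) (auto intro!: mult_nonneg_nonneg L2_set_nonneg)
  then have "(norm_on (\<lambda>n. \<Sum>m\<in>B. osc n m a b k * x m) F)\<^sup>2 \<le> (N * (b - a) * norm_on x B)\<^sup>2"
    by (intro power_mono L2_set_nonneg)
  moreover have "(norm_on (\<lambda>n. \<Sum>m\<in>B. osc n m a b k * x m) F)\<^sup>2 = (\<Sum>n\<in>F. (cmod (\<Sum>m\<in>B. osc n m a b k * x m))\<^sup>2)"
    unfolding L2_set_def by (simp add: sum_nonneg)
  ultimately show ?thesis by (simp add: power_mult_distrib)
qed

text \<open>Interpolation between \<open>osc_block_l2\<close> and \<open>osc_block_energy\<close>:
  the weighted square is at most 4^\<alpha> (|y|^2)^(1-\<alpha>) (n^2 |y|^2)^\<alpha>, and Hoelder's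
  inequality with these exponents separates the two endpoint sums.\<close>

lemma osc_block_weighted:
  assumes F: "finite F" "\<And>n. n \<in> F \<Longrightarrow> j + 2 \<le> block L n" and B: "finite B" "\<And>m. m \<in> B \<Longrightarrow> log_size m = j"
    and e: "energy a b k \<le> ennreal e" "e \<ge> 0" and jL: "j + 2 \<le> L" and ab: "a \<le> b"
    and \<alpha>: "0 < \<alpha>" "\<alpha> < 1"
  shows "norm_on (\<lambda>n. of_real (weight \<alpha> L n) * (\<Sum>m\<in>B. osc n m a b k * x m)) F
    \<le> 2 powr \<alpha> * (N * (b - a)) powr (1 - \<alpha>) * e powr (\<alpha> / 2) * 2 powr (3 / 4 * \<alpha> * real j) * norm_on x B"
proof -
  let ?y = "\<lambda>n. \<Sum>m\<in>B. osc n m a b k * x m" and ?X = "norm_on x B"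
  have X: "?X \<ge> 0" by (rule L2_set_nonneg)
  have nN: "N * (b - a) \<ge> 0" using N_nonneg ab by simp
  have "(\<Sum>n\<in>F. (cmod (of_real (weight \<alpha> L n) * ?y n))\<^sup>2) \<le> (\<Sum>n\<in>F. 4 powr \<alpha> * (((cmod (?y n))\<^sup>2) powr (1 - \<alpha>) * ((real_of_int n)\<^sup>2 * (cmod (?y n))\<^sup>2) powr \<alpha>))"
  proof (rule sum_mono)
    fix n assume n: "n \<in> F"
    have "n \<noteq> 0"
    proof
      assume "n = 0"
      then have "log_size n = 0" using less_log_size[of 0 n] by auto
      then show False using F(2)[OF n] block_le(2)[of L n] by simp
    qed
    have "(cmod (of_real (weight \<alpha> L n) * ?y n))\<^sup>2 = (weight \<alpha> L n)\<^sup>2 * (cmod (?y n))\<^sup>2"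
      by (simp add: norm_mult power_mult_distrib)
    also have "\<dots> \<le> (4 powr \<alpha> * ((real_of_int n)\<^sup>2) powr \<alpha>) * (cmod (?y n))\<^sup>2"
      using weight_power2_le[OF \<open>n \<noteq> 0\<close> \<alpha>(1)] by (intro mult_right_mono) auto
    also have "(cmod (?y n))\<^sup>2 = ((cmod (?y n))\<^sup>2) powr (1 - \<alpha>) * ((cmod (?y n))\<^sup>2) powr \<alpha>"
      by (cases "?y n = 0") (simp_all flip: powr_add)
    finally show "(cmod (of_real (weight \<alpha> L n) * ?y n))\<^sup>2 \<le> 4 powr \<alpha> * (((cmod (?y n))\<^sup>2) powr (1 - \<alpha>) * ((real_of_int n)\<^sup>2 * (cmod (?y n))\<^sup>2) powr \<alpha>)"
      by (simp only: powr_mult mult_ac)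
  qed
  also have "\<dots> \<le> 4 powr \<alpha> * ((\<Sum>n\<in>F. (cmod (?y n))\<^sup>2) powr (1 - \<alpha>) * (\<Sum>n\<in>F. (real_of_int n)\<^sup>2 * (cmod (?y n))\<^sup>2) powr \<alpha>)"
    unfolding sum_distrib_left[symmetric] using \<alpha> by (intro mult_left_mono holder_sum) auto
  also have "\<dots> \<le> 4 powr \<alpha> * (((N * (b - a))\<^sup>2 * ?X\<^sup>2) powr (1 - \<alpha>) * (2 powr (3 / 2 * real j) * e * ?X\<^sup>2) powr \<alpha>)"
    using osc_block_l2[OF F(1) B(1) ab] osc_block_energy[OF F B e jL] \<alpha>
    by (intro mult_left_mono mult_mono powr_mono2 sum_nonneg) auto
  also have "\<dots> = (2 powr \<alpha> * (N * (b - a)) powr (1 - \<alpha>) * e powr (\<alpha> / 2) * 2 powr (3 / 4 * \<alpha> * real j) * ?X)\<^sup>2"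
  proof -
    have sq: "(y\<^sup>2) powr c = (y powr c)\<^sup>2" for y c :: real by (simp only: power2_eq_square powr_mult)
    have X2: "(?X powr (1 - \<alpha>) * ?X powr \<alpha>)\<^sup>2 = ?X\<^sup>2"
      using X by (cases "?X = 0") (simp_all add: powr_add[symmetric])
    have e2: "(e powr (\<alpha> / 2))\<^sup>2 = e powr \<alpha>" by (simp add: power2_eq_square flip: powr_add)
    have j2: "(2 powr (3 / 4 * \<alpha> * real j))\<^sup>2 = (2 powr (3 / 2 * real j)) powr \<alpha>"
      by (simp add: power2_eq_square powr_powr mult_ac flip: powr_add)
    have f2: "(2 powr \<alpha>)\<^sup>2 = 4 powr \<alpha>" using sq[of 2 \<alpha>] by simp
    have "4 powr \<alpha> * (((N * (b - a))\<^sup>2 * ?X\<^sup>2) powr (1 - \<alpha>) * (2 powr (3 / 2 * real j) * e * ?X\<^sup>2) powr \<alpha>)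
      = (2 powr \<alpha> * (N * (b - a)) powr (1 - \<alpha>) * e powr (\<alpha> / 2) * 2 powr (3 / 4 * \<alpha> * real j))\<^sup>2 * (?X powr (1 - \<alpha>) * ?X powr \<alpha>)\<^sup>2"
      unfolding powr_mult sq power_mult_distrib e2 j2 f2 by (simp only: mult_ac)
    then show ?thesis unfolding X2 by (simp only: power_mult_distrib)
  qed
  finally have "sqrt (\<Sum>n\<in>F. (cmod (of_real (weight \<alpha> L n) * ?y n))\<^sup>2) \<le>
     2 powr \<alpha> * (N * (b - a)) powr (1 - \<alpha>) * e powr (\<alpha> / 2) * 2 powr (3 / 4 * \<alpha> * real j) * ?X"
    using X by (intro real_le_lsqrt) (auto intro!: mult_nonneg_nonneg sum_nonneg)
  then show ?thesis by (simp only: L2_set_def)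
qed

text \<open>The sources are decomposed into blocks. On block \<open>j\<close> the norm of
  \<open>x\<close> is 2^(-\<alpha> j) times its weighted norm, which beats the factor 2^(3 \<alpha>
  j / 4) of \<open>osc_block_weighted\<close>, so the blocks sum up geometrically and uniformly in
  \<open>L\<close>.\<close>

lemma jump_pairing:
  assumes F: "finite F" and e: "energy a b k \<le> ennreal e" "e \<ge> 0" and ab: "a \<le> b" and \<alpha>: "0 < \<alpha>" "\<alpha> < 1"
  shows "cmod (\<Sum>n\<in>F. \<phi> n * (of_real (weight \<alpha> L n) * (\<Sum>m\<in>low L (block L n). osc n m a b k * x m)))
    \<le> jump_const \<alpha> * (N * (b - a)) powr (1 - \<alpha>) * e powr (\<alpha> / 2) * norm_on (\<lambda>m. of_real (weight \<alpha> L m) * x m) (low L L) * norm_on \<phi> F"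
proof -
  define Bl where "Bl j = {m. block L m = j}" for j
  define Fj where "Fj j = {n \<in> F. j + 2 \<le> block L n}" for j
  let ?w = "weight \<alpha> L"
  let ?D = "2 powr \<alpha> * (N * (b - a)) powr (1 - \<alpha>) * e powr (\<alpha> / 2)"
  let ?Y = "norm_on (\<lambda>m. of_real (?w m) * x m) (low L L)"
  have Y: "?Y \<ge> 0" by (rule L2_set_nonneg)
  have D: "?D \<ge> 0" by simp
  have low_UN: "low L i = (\<Union>j\<in>{j. j + 2 \<le> i}. Bl j)" for i by (auto simp: low_def Bl_def)
  have finBl: "finite (Bl j)" if "j + 2 \<le> L" for j
    by (rule finite_subset[OF _ finite_low[of L L]]) (use that in \<open>auto simp: Bl_def low_def\<close>)
  have fin_j: "finite {j. j + 2 \<le> i}" for i :: nat by (rule finite_subset[of _ "{..i}"]) auto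
  have sub: "j + 2 \<le> L" if "j + 2 \<le> block L n" for j n using that block_le(1)[of L n] by simp
  have "(\<Sum>m\<in>low L (block L n). osc n m a b k * x m) = (\<Sum>j\<in>{j. j + 2 \<le> block L n}. \<Sum>m\<in>Bl j. osc n m a b k * x m)" for n
    unfolding low_UN by (rule sum.UNION_disjoint[OF fin_j]) (use finBl sub in \<open>auto simp: Bl_def\<close>)
  also have "(\<Sum>j\<in>{j. j + 2 \<le> block L n}. \<Sum>m\<in>Bl j. osc n m a b k * x m) =
      (\<Sum>j\<in>{j. j + 2 \<le> L}. of_bool (j + 2 \<le> block L n) * (\<Sum>m\<in>Bl j. osc n m a b k * x m))" for n
    by (rule sum.mono_neutral_cong_left[OF fin_j]) (use sub in auto)
  finally have "(\<Sum>n\<in>F. \<phi> n * (of_real (?w n) * (\<Sum>m\<in>low L (block L n). osc n m a b k * x m)))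
     = (\<Sum>n\<in>F. \<Sum>j\<in>{j. j + 2 \<le> L}. of_bool (j + 2 \<le> block L n) * (\<phi> n * (of_real (?w n) * (\<Sum>m\<in>Bl j. osc n m a b k * x m))))"
    by (simp add: sum_distrib_left mult_ac)
  also have "\<dots> = (\<Sum>j\<in>{j. j + 2 \<le> L}. \<Sum>n\<in>F. of_bool (j + 2 \<le> block L n) * (\<phi> n * (of_real (?w n) * (\<Sum>m\<in>Bl j. osc n m a b k * x m))))"
    by (rule sum.swap)
  also have "\<dots> = (\<Sum>j\<in>{j. j + 2 \<le> L}. \<Sum>n\<in>Fj j. \<phi> n * (of_real (?w n) * (\<Sum>m\<in>Bl j. osc n m a b k * x m)))"
    unfolding Fj_def by (intro sum.cong refl sum.mono_neutral_cong_right F) auto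
  finally have split: "(\<Sum>n\<in>F. \<phi> n * (of_real (?w n) * (\<Sum>m\<in>low L (block L n). osc n m a b k * x m)))
     = (\<Sum>j\<in>{j. j + 2 \<le> L}. \<Sum>n\<in>Fj j. \<phi> n * (of_real (?w n) * (\<Sum>m\<in>Bl j. osc n m a b k * x m)))" .
  have "cmod (\<Sum>j\<in>{j. j + 2 \<le> L}. \<Sum>n\<in>Fj j. \<phi> n * (of_real (?w n) * (\<Sum>m\<in>Bl j. osc n m a b k * x m))) \<le> (\<Sum>j\<in>{j. j + 2 \<le> L}. norm_on \<phi> F * (?D * ?Y) * (2 powr - (\<alpha> / 4)) ^ j)"
  proof (rule sum_norm_le)
    fix j assume "j \<in> {j. j + 2 \<le> L}"
    then have j: "j + 2 \<le> L" by simp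
    have ls: "log_size m = j" if "m \<in> Bl j" for m using that j by (auto simp: Bl_def block_def min_def split: if_splits)
    have finF: "finite (Fj j)" using F by (simp add: Fj_def)
    have "norm_on (\<lambda>n. of_real (?w n) * (\<Sum>m\<in>Bl j. osc n m a b k * x m)) (Fj j)
      \<le> ?D * 2 powr (3 / 4 * \<alpha> * real j) * norm_on x (Bl j)"
      by (rule osc_block_weighted[OF finF _ finBl[OF j] ls e j ab \<alpha>]) (auto simp: Fj_def)
    also have "norm_on x (Bl j) \<le> 2 powr - (\<alpha> * real j) * ?Y"
    proof -
      have "norm_on x (Bl j) = norm_on (\<lambda>m. of_real (2 powr - (\<alpha> * real j)) * (of_real (?w m) * x m)) (Bl j)"
        by (intro L2_set_cong refl) (simp add: Bl_def weight_def norm_mult flip: powr_add mult.assoc)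
      also have "\<dots> = 2 powr - (\<alpha> * real j) * norm_on (\<lambda>m. of_real (?w m) * x m) (Bl j)"
        by (subst norm_on_cmult) simp
      also have "\<dots> \<le> 2 powr - (\<alpha> * real j) * ?Y"
        using j by (intro mult_left_mono norm_on_subset finite_low) (auto simp: Bl_def low_def)
      finally show ?thesis .
    qed
    also have "?D * 2 powr (3 / 4 * \<alpha> * real j) * (2 powr - (\<alpha> * real j) * ?Y) = ?D * ?Y * (2 powr - (\<alpha> / 4)) ^ j"
    proof -
      have "2 powr (3 / 4 * \<alpha> * real j) * 2 powr - (\<alpha> * real j) = 2 powr (- (\<alpha> / 4) * real j)"
        by (simp add: algebra_simps flip: powr_add)
      also have "\<dots> = (2 powr - (\<alpha> / 4)) ^ j" by (simp only: powr_powr[symmetric] powr_realpow powr_gt_zero)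
      finally have "?D * ?Y * (2 powr (3 / 4 * \<alpha> * real j) * 2 powr - (\<alpha> * real j)) = ?D * ?Y * (2 powr - (\<alpha> / 4)) ^ j"
        by (simp only:)
      then show ?thesis by (simp only: mult_ac)
    qed
    finally have 1: "norm_on (\<lambda>n. of_real (?w n) * (\<Sum>m\<in>Bl j. osc n m a b k * x m)) (Fj j) \<le> ?D * ?Y * (2 powr - (\<alpha> / 4)) ^ j"
      by (simp add: mult_left_mono)
    have "cmod (\<Sum>n\<in>Fj j. \<phi> n * (of_real (?w n) * (\<Sum>m\<in>Bl j. osc n m a b k * x m)))
       \<le> norm_on \<phi> (Fj j) * norm_on (\<lambda>n. of_real (?w n) * (\<Sum>m\<in>Bl j. osc n m a b k * x m)) (Fj j)"
      by (rule norm_sum_le_norm_on)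
    also have "\<dots> \<le> norm_on \<phi> F * (?D * ?Y * (2 powr - (\<alpha> / 4)) ^ j)"
      using 1 F by (intro mult_mono norm_on_subset L2_set_nonneg) (auto simp: Fj_def)
    finally show "cmod (\<Sum>n\<in>Fj j. \<phi> n * (of_real (?w n) * (\<Sum>m\<in>Bl j. osc n m a b k * x m)))
      \<le> norm_on \<phi> F * (?D * ?Y) * (2 powr - (\<alpha> / 4)) ^ j" by (simp only: mult_ac)
  qed
  also have "\<dots> = norm_on \<phi> F * (?D * ?Y) * (\<Sum>j\<in>{j. j + 2 \<le> L}. (2 powr - (\<alpha> / 4)) ^ j)"
    by (simp only: sum_distrib_left)
  also have "\<dots> \<le> norm_on \<phi> F * (?D * ?Y) * (1 / (1 - 2 powr - (\<alpha> / 4)))"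
  proof (intro mult_left_mono)
    have q: "2 powr - (\<alpha> / 4) < (1::real)" using powr_less_mono[of "- (\<alpha> / 4)" 0 2] \<alpha> by simp
    have "(\<Sum>j\<in>{j. j + 2 \<le> L}. (2 powr - (\<alpha> / 4)) ^ j) \<le> (\<Sum>j. (2 powr - (\<alpha> / 4) :: real) ^ j)"
      using q by (intro sum_le_suminf summable_geometric fin_j) auto
    then show "(\<Sum>j\<in>{j. j + 2 \<le> L}. (2 powr - (\<alpha> / 4)) ^ j) \<le> 1 / (1 - 2 powr - (\<alpha> / 4) :: real)"
      using q by (simp add: suminf_geometric)
  qed (use D Y in \<open>simp add: L2_set_nonneg\<close>)
  finally show ?thesis unfolding split by (simp add: jump_const_def mult_ac)
qed

end

section \<open>The mild solution as a dyadic growth process\<close>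

lemma set_integral_norm_bound_AE:
  fixes f :: "real \<Rightarrow> complex"
  assumes "set_integrable lborel {a..<b} f" "AE s in lborel. s \<in> {a..<b} \<longrightarrow> norm (f s) \<le> C" "a \<le> b"
  shows "norm (LINT s:{a..<b}|lborel. f s) \<le> C * (b - a)"
proof -
  have "norm (LINT s:{a..<b}|lborel. f s) \<le> (LINT s|lborel. norm (indicator {a..<b} s *\<^sub>R f s))"
    unfolding set_lebesgue_integral_def by (rule integral_norm_bound)
  also have "\<dots> \<le> (LINT s|lborel. indicator {a..<b} s *\<^sub>R C)"
  proof (rule integral_mono_AE)
    show "integrable lborel (\<lambda>s. norm (indicator {a..<b} s *\<^sub>R f s))"
      using assms(1) unfolding set_integrable_def by (rule integrable_norm)
    show "integrable lborel (\<lambda>s. indicator {a..<b} s *\<^sub>R C)"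
      using set_integrable_bounded_interval[of "\<lambda>_. C" "\<bar>C\<bar>" a b] unfolding set_integrable_def by simp
    show "AE s in lborel. norm (indicator {a..<b} s *\<^sub>R f s) \<le> indicator {a..<b} s *\<^sub>R C"
      using assms(2) by eventually_elim (auto simp: indicator_def)
  qed
  also have "\<dots> = C * (b - a)" using assms(3) by simp
  finally show ?thesis .
qed

lemma set_integrable_bounded_mult:
  fixes f h :: "real \<Rightarrow> complex"
  assumes [measurable]: "f \<in> borel_measurable borel" and "\<And>s. cmod (f s) \<le> B" and h: "set_integrable lborel A h"
  shows "set_integrable lborel A (\<lambda>s. f s * h s)"
proof -
  have hm: "(\<lambda>s. indicator A s *\<^sub>R h s) \<in> borel_measurable borel"
    using borel_measurable_integrable[OF h[unfolded set_integrable_def]] by simp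
  have B: "B \<ge> 0" using assms(2)[of 0] norm_ge_zero order_trans by blast
  have "integrable lborel (\<lambda>s. f s * (indicator A s *\<^sub>R h s))"
  proof (rule Bochner_Integration.integrable_bound)
    show "integrable lborel (\<lambda>s. of_real B * (indicator A s *\<^sub>R h s))"
      using h unfolding set_integrable_def by (intro integrable_mult_right)
    show "(\<lambda>s. f s * (indicator A s *\<^sub>R h s)) \<in> borel_measurable lborel"
      unfolding measurable_cong_sets[OF sets_lborel refl] by (rule borel_measurable_times[OF assms(1) hm])
    show "AE s in lborel. norm (f s * (indicator A s *\<^sub>R h s)) \<le> norm (of_real B * (indicator A s *\<^sub>R h s))"
      using assms(2) B by (intro AE_I2) (simp add: norm_mult indicator_def mult_right_mono)
  qed
  then show ?thesis unfolding set_integrable_def by simp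
qed

lemma has_sum_finite_sum:
  fixes f :: "'i \<Rightarrow> 'a \<Rightarrow> 'b::topological_comm_monoid_add"
  assumes "finite I" "\<And>i. i \<in> I \<Longrightarrow> (f i has_sum S i) A"
  shows "((\<lambda>x. \<Sum>i\<in>I. f i x) has_sum (\<Sum>i\<in>I. S i)) A"
  using assms by (induction I rule: finite_induct) (auto intro: has_sum_add has_sum_0)

lemma weight_block: "weight \<alpha> L n = (2 powr \<alpha>) ^ block L n"
  by (simp add: weight_def powr_powr[symmetric] powr_realpow)

text \<open>Its square times 4^(\<alpha> b) bounds the geometric sum of 4^(\<alpha> i) over i <= b +
  1, which collects the target blocks that block b reaches without a jump.\<close>

definition nonjump_const :: "real \<Rightarrow> real" where
  "nonjump_const \<alpha> = sqrt (4 powr \<alpha> / (1 - 4 powr - \<alpha>))"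

definition growth_const :: "real \<Rightarrow> real" where
  "growth_const \<alpha> = 1 + nonjump_const \<alpha> + jump_const \<alpha>"

lemma nonjump_const_nonneg: "\<alpha> > 0 \<Longrightarrow> nonjump_const \<alpha> \<ge> 0"
  using powr_less_mono[of "- \<alpha>" 0 4] by (simp add: nonjump_const_def)

lemma growth_const_ge: "\<alpha> > 0 \<Longrightarrow> growth_const \<alpha> \<ge> 1"
  using nonjump_const_nonneg jump_const_pos by (simp add: growth_const_def less_imp_le)

text \<open>The interaction picture for one \<open>k\<close>. The right-hand side is represented by
  \<gamma>, which is integrable and obeys the formula for almost every time; integrability is what
  Duhamel's formula provides. The bound \<open>R\<close> is qualitative and, like \<open>L\<close>,
  must not appear in the final estimate.\<close>

locale mild_system = potential W T N for W :: "real \<times> real \<Rightarrow> complex" and T N :: real +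
  fixes k R \<alpha> :: real and L :: nat and U :: "real \<Rightarrow> real \<Rightarrow> complex" and \<gamma> :: "int \<Rightarrow> real \<Rightarrow> complex"
    and e :: "nat \<Rightarrow> nat \<Rightarrow> real"
  assumes \<alpha>: "0 < \<alpha>" "\<alpha> < 1"
    and U_L2: "t \<in> {0..T} \<Longrightarrow> U t \<in> L2_torus" and U_le: "t \<in> {0..T} \<Longrightarrow> L2_norm (U t) \<le> R"
    and \<gamma>_integrable: "set_integrable lborel {0..T} (\<gamma> n)"
    and \<gamma>_eq: "AE s in lborel. s \<in> {0..T} \<longrightarrow>
      (\<forall>n. \<gamma> n s = cis (- (k * (real_of_int n)\<^sup>2 * s)) * fourier_coeff (\<lambda>x. W (x, s) * U s x) n)"
    and solution: "t \<in> {0..T} \<Longrightarrow>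
      cis (- (k * (real_of_int n)\<^sup>2 * t)) * fourier_coeff (U t) n = of_bool (n = 0) - \<i> * (LINT s:{0..<t}|lborel. \<gamma> n s)"
    and e: "j < 2 ^ l \<Longrightarrow> energy (node T l j) (node T l (Suc j)) k \<le> ennreal (e l j)" "e l j \<ge> 0"
begin

abbreviation "w \<equiv> weight \<alpha> L"

definition \<psi> :: "int \<Rightarrow> real \<Rightarrow> complex" where
  "\<psi> n t = cis (- (k * (real_of_int n)\<^sup>2 * t)) * fourier_coeff (U t) n"

definition g :: "real \<Rightarrow> real" where
  "g t = ell2 (\<lambda>n. of_real (w n) * \<psi> n t)"

definition d :: "real \<Rightarrow> real \<Rightarrow> real" where
  "d s t = ell2 (\<lambda>n. of_real (w n) * \<psi> n t - of_real (w n) * \<psi> n s)"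

lemma R_nonneg: "R \<ge> 0"
  using U_le[of 0] T_pos L2_norm_nonneg[of "U 0"] by simp

lemma w_le: "w n \<le> 2 powr (\<alpha> * L)"
  unfolding weight_def using block_le(1)[of L n] \<alpha> by (intro powr_mono mult_left_mono) auto

lemma w_nonneg: "w n \<ge> 0"
  using weight_pos less_imp_le by blast

lemma norm_on_weight_le:
  assumes "finite F" "norm_on x F \<le> B"
  shows "norm_on (\<lambda>n. of_real (w n) * x n) F \<le> 2 powr (\<alpha> * L) * B"
proof -
  have "norm_on (\<lambda>n. of_real (w n) * x n) F \<le> norm_on (\<lambda>n. of_real (2 powr (\<alpha> * L)) * x n) F"
    using w_le w_nonneg by (intro L2_set_mono) (auto simp: norm_mult intro!: mult_right_mono)
  also have "\<dots> = 2 powr (\<alpha> * L) * norm_on x F" by (subst norm_on_cmult) simp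
  also have "\<dots> \<le> 2 powr (\<alpha> * L) * B" using assms(2) by (intro mult_left_mono) auto
  finally show ?thesis .
qed

lemma norm_on_\<psi>:
  assumes "finite F" "t \<in> {0..T}" shows "norm_on (\<lambda>n. \<psi> n t) F \<le> R"
proof -
  have "norm_on (\<lambda>n. \<psi> n t) F = norm_on (fourier_coeff (U t)) F"
    unfolding \<psi>_def by (rule norm_on_unimodular) simp
  also have "\<dots> \<le> L2_norm (U t)"
    using bessel[OF assms(1) U_L2[OF assms(2)]] L2_norm_nonneg by (simp add: L2_set_def real_le_lsqrt)
  finally show ?thesis using U_le[OF assms(2)] by simp
qed

lemma weighted_summable: "t \<in> {0..T} \<Longrightarrow> ell2_summable (\<lambda>n. of_real (w n) * \<psi> n t)"
  by (rule ell2_leI(1), rule norm_on_weight_le, assumption, rule norm_on_\<psi>)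

lemma weighted_diff_summable:
  assumes "s \<in> {0..T}" "t \<in> {0..T}"
  shows "ell2_summable (\<lambda>n. of_real (w n) * \<psi> n t - of_real (w n) * \<psi> n s)"
proof -
  have "ell2_summable (\<lambda>n. - (of_real (w n) * \<psi> n s))" using weighted_summable[OF assms(1)] by simp
  from ell2_add(1)[OF weighted_summable[OF assms(2)] this] show ?thesis by simp
qed

lemma \<gamma>_sub_integrable: "0 \<le> a \<Longrightarrow> b \<le> T \<Longrightarrow> set_integrable lborel {a..<b} (\<gamma> n)"
  by (rule set_integrable_subset[OF \<gamma>_integrable]) auto

lemma \<psi>_diff:
  assumes "0 \<le> a" "a \<le> b" "b \<le> T"
  shows "\<psi> n b - \<psi> n a = - \<i> * (LINT s:{a..<b}|lborel. \<gamma> n s)"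
proof -
  have "{0..<b} = {0..<a} \<union> {a..<b}" using assms by auto
  then have "(LINT s:{0..<b}|lborel. \<gamma> n s) = (LINT s:{0..<a}|lborel. \<gamma> n s) + (LINT s:{a..<b}|lborel. \<gamma> n s)"
    using assms \<gamma>_sub_integrable by (simp only:) (intro set_integral_Un, auto)
  moreover have "b \<in> {0..T}" "a \<in> {0..T}" using assms by auto
  ultimately show ?thesis
    unfolding \<psi>_def by (simp only: solution) (simp add: algebra_simps)
qed

lemma \<psi>_diff_pairing:
  assumes "0 \<le> a" "a \<le> b" "b \<le> T" "finite F"
  shows "(\<Sum>n\<in>F. \<phi> n * (\<psi> n b - \<psi> n a)) = - \<i> * (LINT s:{a..<b}|lborel. \<Sum>n\<in>F. \<phi> n * \<gamma> n s)"
proof -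
  have "(LINT s:{a..<b}|lborel. \<Sum>n\<in>F. \<phi> n * \<gamma> n s) = (\<Sum>n\<in>F. LINT s:{a..<b}|lborel. \<phi> n * \<gamma> n s)"
    using assms by (intro set_integral_finite_sum set_integrable_mult_right \<gamma>_sub_integrable)
  then show ?thesis using assms by (simp add: \<psi>_diff sum_distrib_left mult_ac)
qed

text \<open>Removing the free evolution leaves only the bounded multiplication by \<open>W\<close>,
  so the coefficients are Lipschitz into \<ell>^2. The constant feeds the discretization error and
  the finiteness of suprema.\<close>

lemma \<psi>_lipschitz:
  assumes "0 \<le> a" "a \<le> b" "b \<le> T" "finite F"
  shows "norm_on (\<lambda>n. \<psi> n b - \<psi> n a) F \<le> N * R * (b - a)"
proof (rule norm_on_dual)
  fix \<phi>
  have "AE s in lborel. s \<in> {a..<b} \<longrightarrow> cmod (\<Sum>n\<in>F. \<phi> n * \<gamma> n s) \<le> N * R * norm_on \<phi> F"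
    using \<gamma>_eq
  proof eventually_elim
    case (elim s)
    show ?case
    proof
      assume "s \<in> {a..<b}"
      then have s: "s \<in> {0..T}" using assms by auto
      have "cmod (\<Sum>n\<in>F. \<phi> n * \<gamma> n s) \<le> N * L2_norm (U s) * norm_on \<phi> F"
        using W_pairing[OF assms(4) U_L2[OF s], of "\<lambda>n. cis (- (k * (real_of_int n)\<^sup>2 * s))" \<phi> s] elim s by simp
      also have "\<dots> \<le> N * R * norm_on \<phi> F"
        using U_le[OF s] N_nonneg by (intro mult_right_mono mult_left_mono L2_set_nonneg)
      finally show "cmod (\<Sum>n\<in>F. \<phi> n * \<gamma> n s) \<le> N * R * norm_on \<phi> F" .
    qed
  qed
  then have "cmod (LINT s:{a..<b}|lborel. \<Sum>n\<in>F. \<phi> n * \<gamma> n s) \<le> N * R * norm_on \<phi> F * (b - a)"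
    using assms by (intro set_integral_norm_bound_AE set_integrable_finite_sum set_integrable_mult_right \<gamma>_sub_integrable)
  then show "cmod (\<Sum>n\<in>F. \<phi> n * (\<psi> n b - \<psi> n a)) \<le> N * R * (b - a) * norm_on \<phi> F"
    unfolding \<psi>_diff_pairing[OF assms] by (simp add: norm_mult mult_ac)
qed (use assms N_nonneg R_nonneg in auto)

lemma d_lipschitz':
  assumes "s \<in> {0..T}" "t \<in> {0..T}"
  shows "d s t \<le> 2 powr (\<alpha> * L) * (N * R) * \<bar>t - s\<bar>"
  unfolding d_def
proof (rule ell2_leI(2))
  fix F :: "int set" assume F: "finite F"
  have "norm_on (\<lambda>n. \<psi> n t - \<psi> n s) F \<le> N * R * \<bar>t - s\<bar>"
  proof (cases "s \<le> t")
    case True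
    then show ?thesis using \<psi>_lipschitz[of s t F] assms F by simp
  next
    case False
    then have "norm_on (\<lambda>n. \<psi> n s - \<psi> n t) F \<le> N * R * (s - t)" using \<psi>_lipschitz[of t s F] assms F by simp
    then show ?thesis using False by (simp add: norm_minus_commute[of "\<psi> _ t"])
  qed
  then have "norm_on (\<lambda>n. of_real (w n) * (\<psi> n t - \<psi> n s)) F \<le> 2 powr (\<alpha> * L) * (N * R * \<bar>t - s\<bar>)"
    by (rule norm_on_weight_le[OF F])
  then show "norm_on (\<lambda>n. of_real (w n) * \<psi> n t - of_real (w n) * \<psi> n s) F \<le> 2 powr (\<alpha> * L) * (N * R) * \<bar>t - s\<bar>"
    by (simp add: right_diff_distrib mult_ac)
qed

lemma \<psi>_continuous: "continuous_on {0..T} (\<psi> n)"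
proof (rule continuous_onI)
  fix t \<epsilon> :: real assume t: "t \<in> {0..T}" and \<epsilon>: "\<epsilon> > 0"
  have nr: "N * R + 1 > 0" using N_nonneg R_nonneg by (simp add: add_nonneg_pos)
  show "\<exists>\<delta>>0. \<forall>s\<in>{0..T}. dist s t < \<delta> \<longrightarrow> dist (\<psi> n s) (\<psi> n t) \<le> \<epsilon>"
  proof (intro exI[of _ "\<epsilon> / (N * R + 1)"] conjI ballI impI)
    show "\<epsilon> / (N * R + 1) > 0" using \<epsilon> nr by simp
    fix s assume s: "s \<in> {0..T}" "dist s t < \<epsilon> / (N * R + 1)"
    have "cmod (\<psi> n s - \<psi> n t) \<le> N * R * \<bar>s - t\<bar>"
      using \<psi>_lipschitz[of s t "{n}"] \<psi>_lipschitz[of t s "{n}"] s t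
      by (cases "s \<le> t") (auto simp: norm_minus_commute)
    also have "\<dots> \<le> (N * R + 1) * \<bar>s - t\<bar>" by (intro mult_right_mono) auto
    also have "\<dots> \<le> \<epsilon>" using s nr by (simp add: dist_real_def pos_less_divide_eq mult.commute)
    finally show "dist (\<psi> n s) (\<psi> n t) \<le> \<epsilon>" by (simp add: dist_norm)
  qed
qed

lemma \<psi>_integrable: "0 \<le> a \<Longrightarrow> b \<le> T \<Longrightarrow> set_integrable lborel {a..<b} (\<psi> n)"
  using borel_integrable_atLeastAtMost'[OF \<psi>_continuous]
  by (rule set_integrable_subset) auto

lemma sum_blocks:
  assumes "finite F"
  shows "(\<Sum>n\<in>F. f n) = (\<Sum>i\<le>L. \<Sum>n\<in>{n \<in> F. block L n = i}. f n)"
  using assms block_le(1) by (intro sum.group[symmetric]) auto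

text \<open>A frequency in block b fails to be a source of jumps exactly for target blocks up to b +
  1. Reversing the order of summation exposes a geometric series that starts from the largest
  term.\<close>

lemma sum_weights_le:
  "(\<Sum>i\<le>L. ((2 powr \<alpha>) ^ i)\<^sup>2 * of_bool (m \<notin> low L i)) \<le> (nonjump_const \<alpha>)\<^sup>2 * (w m)\<^sup>2"
proof -
  let ?b = "block L m" and ?r = "4 powr \<alpha> :: real" and ?q = "4 powr - \<alpha> :: real"
  have q: "0 < ?q" "?q < 1" using \<alpha> powr_less_mono[of "- \<alpha>" 0 4] by auto
  have rq: "?r * ?q = 1" by (simp add: powr_minus)
  have sq: "((2 powr \<alpha>) ^ i)\<^sup>2 = ?r ^ i" for i
    by (simp add: power2_eq_square flip: power_mult_distrib powr_mult)
  have "(\<Sum>i\<le>L. ((2 powr \<alpha>) ^ i)\<^sup>2 * of_bool (m \<notin> low L i)) \<le> (\<Sum>i\<le>Suc ?b. ?r ^ i)"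
  proof -
    have "(\<Sum>i\<le>L. ((2 powr \<alpha>) ^ i)\<^sup>2 * of_bool (m \<notin> low L i)) = (\<Sum>i\<in>{i \<in> {..L}. m \<notin> low L i}. ?r ^ i)"
      unfolding sq by (rule sum.mono_neutral_cong_right) auto
    also have "\<dots> \<le> (\<Sum>i\<le>Suc ?b. ?r ^ i)" by (intro sum_mono2) (auto simp: low_def)
    finally show ?thesis .
  qed
  also have "\<dots> = (\<Sum>i\<le>Suc ?b. ?r ^ (Suc ?b - i))"
    by (rule sum.nat_diff_reindex[of "\<lambda>i. ?r ^ i" "Suc (Suc ?b)", symmetric, unfolded lessThan_Suc_atMost diff_Suc_Suc])
  also have "\<dots> = (\<Sum>i\<le>Suc ?b. ?r ^ Suc ?b * ?q ^ i)"
  proof (rule sum.cong[OF refl])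
    fix i assume "i \<in> {..Suc ?b}"
    then have "?r ^ Suc ?b = ?r ^ (Suc ?b - i) * ?r ^ i" by (simp flip: power_add)
    then show "?r ^ (Suc ?b - i) = ?r ^ Suc ?b * ?q ^ i"
      using rq by (simp add: mult.assoc flip: power_mult_distrib)
  qed
  also have "\<dots> \<le> ?r ^ Suc ?b * (1 / (1 - ?q))"
    unfolding sum_distrib_left[symmetric]
  proof (rule mult_left_mono)
    have "(\<Sum>i\<le>Suc ?b. ?q ^ i) \<le> (\<Sum>i. ?q ^ i)" using q by (intro sum_le_suminf summable_geometric) auto
    then show "(\<Sum>i\<le>Suc ?b. ?q ^ i) \<le> 1 / (1 - ?q)" using q by (simp add: suminf_geometric)
  qed simp
  also have "\<dots> = (nonjump_const \<alpha>)\<^sup>2 * (w m)\<^sup>2"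
    using q by (simp add: nonjump_const_def weight_block sq)
  finally show ?thesis .
qed

text \<open>For targets in block \<open>i\<close> the admissible sources are what remains of
  \<open>U s\<close> after its low part is removed; call this \<open>z i\<close>. Multiplication by
  \<open>W\<close> acts on \<open>z i\<close> with norm \<open>N\<close>. The weighted square sum of
  the norms of the \<open>z i\<close> is exchanged with the sum over frequencies and bounded by
  \<open>sum_weights_le\<close>. An upper bound for these norms through coefficients is needed,
  hence Parseval's identity rather than Bessel's inequality.\<close>

lemma nonjump_pairing:
  assumes s: "s \<in> {0..T}" and F: "finite F"
    and \<gamma>: "\<And>n. \<gamma> n s = cis (- (k * (real_of_int n)\<^sup>2 * s)) * fourier_coeff (\<lambda>x. W (x, s) * U s x) n"
  shows "cmod (\<Sum>n\<in>F. \<phi> n * (of_real (w n) * (\<gamma> n s - (\<Sum>m\<in>low L (block L n). osc_kernel k n m s * \<psi> m s))))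
    \<le> N * nonjump_const \<alpha> * g s * norm_on \<phi> F"
proof -
  let ?a = "fourier_coeff (U s)" and ?c = "\<lambda>n. cis (- (k * (real_of_int n)\<^sup>2 * s))"
  define z where "z i = (\<lambda>x. U s x - (\<Sum>m\<in>low L i. ?a m * emode m x))" for i
  have zL2: "z i \<in> L2_torus" if "i \<le> L" for i
    unfolding z_def by (intro L2_torus_diff U_L2 s trig_poly_L2 finite_low that)
  have zc: "fourier_coeff (z i) m = of_bool (m \<notin> low L i) * ?a m" if "i \<le> L" for i m
  proof -
    have "fourier_coeff (z i) m = ?a m - fourier_coeff (\<lambda>x. \<Sum>m\<in>low L i. ?a m * emode m x) m"
      unfolding z_def fourier_coeff_eq by (intro L2_inner_diff U_L2 s trig_poly_L2 finite_low that emode_L2)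
    then show ?thesis by (simp add: fourier_coeff_trig_poly finite_low that)
  qed
  have Wz: "\<gamma> n s - (\<Sum>m\<in>low L i. osc_kernel k n m s * \<psi> m s) = ?c n * fourier_coeff (\<lambda>x. W (x, s) * z i x) n" if "i \<le> L" for i n
  proof -
    have "fourier_coeff (\<lambda>x. W (x, s) * z i x) n = fourier_coeff (\<lambda>x. W (x, s) * U s x - W (x, s) * (\<Sum>m\<in>low L i. ?a m * emode m x)) n"
      by (simp add: z_def right_diff_distrib)
    also have "\<dots> = fourier_coeff (\<lambda>x. W (x, s) * U s x) n - fourier_coeff (\<lambda>x. W (x, s) * (\<Sum>m\<in>low L i. ?a m * emode m x)) n"
      unfolding fourier_coeff_eq[of _ n] by (intro L2_inner_diff W_mult_L2 U_L2 s trig_poly_L2 finite_low that emode_L2)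
    also have "\<dots> = fourier_coeff (\<lambda>x. W (x, s) * U s x) n - (\<Sum>m\<in>low L i. ?a m * vhat (n - m) s)"
      by (simp only: fourier_coeff_W_trig_poly[OF finite_low[OF that]])
    finally have "?c n * fourier_coeff (\<lambda>x. W (x, s) * z i x) n = \<gamma> n s - (\<Sum>m\<in>low L i. ?c n * (?a m * vhat (n - m) s))"
      by (simp only: \<gamma> right_diff_distrib sum_distrib_left)
    moreover have "osc_kernel k n m s * \<psi> m s = ?c n * (?a m * vhat (n - m) s)" for m
    proof -
      have "cis (- (k * of_int (n\<^sup>2 - m\<^sup>2) * s)) * ?c m = ?c n" by (simp add: cis_mult algebra_simps)
      then have "(cis (- (k * of_int (n\<^sup>2 - m\<^sup>2) * s)) * ?c m) * (?a m * vhat (n - m) s) = ?c n * (?a m * vhat (n - m) s)" by (simp only:)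
      then show ?thesis by (simp only: osc_kernel_def \<psi>_def mult_ac)
    qed
    ultimately show ?thesis by simp
  qed
  let ?r = "\<lambda>i. (2 powr \<alpha>) ^ i :: real"
  let ?F = "\<lambda>i. {n \<in> F. block L n = i}"
  have split: "(\<Sum>n\<in>F. \<phi> n * (of_real (w n) * (\<gamma> n s - (\<Sum>m\<in>low L (block L n). osc_kernel k n m s * \<psi> m s))))
     = (\<Sum>i\<le>L. of_real (?r i) * (\<Sum>n\<in>?F i. \<phi> n * (?c n * fourier_coeff (\<lambda>x. W (x, s) * z i x) n)))"
    unfolding sum_blocks[OF F, of "\<lambda>n. \<phi> n * (of_real (w n) * _ n)"] sum_distrib_left
  proof (intro sum.cong refl)
    fix i n assume "i \<in> {..L}" "n \<in> ?F i"
    then show "\<phi> n * (of_real (w n) * (\<gamma> n s - (\<Sum>m\<in>low L (block L n). osc_kernel k n m s * \<psi> m s)))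
      = of_real (?r i) * (\<phi> n * (?c n * fourier_coeff (\<lambda>x. W (x, s) * z i x) n))"
      using Wz[of i n] by (simp add: weight_block)
  qed
  have "cmod (\<Sum>i\<le>L. of_real (?r i) * (\<Sum>n\<in>?F i. \<phi> n * (?c n * fourier_coeff (\<lambda>x. W (x, s) * z i x) n))) \<le> (\<Sum>i\<le>L. N * (\<bar>?r i * L2_norm (z i)\<bar> * \<bar>norm_on \<phi> (?F i)\<bar>))"
  proof (rule sum_norm_le)
    fix i assume i: "i \<in> {..L}"
    have "cmod (\<Sum>n\<in>?F i. \<phi> n * (?c n * fourier_coeff (\<lambda>x. W (x, s) * z i x) n)) \<le> N * L2_norm (z i) * norm_on \<phi> (?F i)"
      using i F by (intro W_pairing zL2) auto
    then have "?r i * cmod (\<Sum>n\<in>?F i. \<phi> n * (?c n * fourier_coeff (\<lambda>x. W (x, s) * z i x) n)) \<le> ?r i * (N * L2_norm (z i) * norm_on \<phi> (?F i))"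
      by (rule mult_left_mono) simp
    then show "cmod (of_real (?r i) * (\<Sum>n\<in>?F i. \<phi> n * (?c n * fourier_coeff (\<lambda>x. W (x, s) * z i x) n))) \<le> N * (\<bar>?r i * L2_norm (z i)\<bar> * \<bar>norm_on \<phi> (?F i)\<bar>)"
      using L2_norm_nonneg[of "z i"] L2_set_nonneg[of "\<lambda>n. cmod (\<phi> n)" "?F i"] by (simp add: norm_mult abs_mult mult_ac norm_power)
  qed
  also have "\<dots> \<le> N * (L2_set (\<lambda>i. ?r i * L2_norm (z i)) {..L} * L2_set (\<lambda>i. norm_on \<phi> (?F i)) {..L})"
    unfolding sum_distrib_left[symmetric] by (intro mult_left_mono L2_set_mult_ineq N_nonneg)
  also have "L2_set (\<lambda>i. norm_on \<phi> (?F i)) {..L} = norm_on \<phi> F"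
    unfolding L2_set_def sum_blocks[OF F, of "\<lambda>n. (cmod (\<phi> n))\<^sup>2"] by (simp add: sum_nonneg)
  also have "L2_set (\<lambda>i. ?r i * L2_norm (z i)) {..L} \<le> nonjump_const \<alpha> * g s"
  proof -
    have pars: "((\<lambda>m. (?r i)\<^sup>2 * (of_bool (m \<notin> low L i) * (cmod (?a m))\<^sup>2)) has_sum ((?r i)\<^sup>2 * (L2_norm (z i))\<^sup>2)) UNIV" if "i \<le> L" for i
    proof (rule has_sum_cmult_right)
      have "(cmod (fourier_coeff (z i) m))\<^sup>2 = of_bool (m \<notin> low L i) * (cmod (?a m))\<^sup>2" for m
        by (simp add: zc[OF that])
      then show "((\<lambda>m. of_bool (m \<notin> low L i) * (cmod (?a m))\<^sup>2) has_sum ((L2_norm (z i))\<^sup>2)) UNIV"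
        using parseval[OF zL2[OF that]] by simp
    qed
    have 1: "((\<lambda>m. \<Sum>i\<le>L. (?r i)\<^sup>2 * (of_bool (m \<notin> low L i) * (cmod (?a m))\<^sup>2)) has_sum (\<Sum>i\<le>L. (?r i)\<^sup>2 * (L2_norm (z i))\<^sup>2)) UNIV"
      by (rule has_sum_finite_sum) (use pars in auto)
    have eq: "(cmod (of_real (w m) * \<psi> m s))\<^sup>2 = (w m)\<^sup>2 * (cmod (?a m))\<^sup>2" for m
      by (simp add: \<psi>_def norm_mult power_mult_distrib)
    have 2: "((\<lambda>m. (nonjump_const \<alpha>)\<^sup>2 * (w m)\<^sup>2 * (cmod (?a m))\<^sup>2) has_sum ((nonjump_const \<alpha>)\<^sup>2 * (g s)\<^sup>2)) UNIV"
      unfolding g_def ell2_power2 mult.assoc eq[symmetric]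
      by (intro has_sum_cmult_right has_sum_infsum weighted_summable s)
    have "(\<Sum>i\<le>L. (?r i)\<^sup>2 * (L2_norm (z i))\<^sup>2) \<le> (nonjump_const \<alpha>)\<^sup>2 * (g s)\<^sup>2"
    proof (rule has_sum_mono[OF 1 2])
      fix m
      have "(\<Sum>i\<le>L. (?r i)\<^sup>2 * (of_bool (m \<notin> low L i) * (cmod (?a m))\<^sup>2)) = (\<Sum>i\<le>L. (?r i)\<^sup>2 * of_bool (m \<notin> low L i)) * (cmod (?a m))\<^sup>2"
        by (simp only: sum_distrib_right mult.assoc)
      also have "\<dots> \<le> (nonjump_const \<alpha>)\<^sup>2 * (w m)\<^sup>2 * (cmod (?a m))\<^sup>2"
        by (intro mult_right_mono sum_weights_le) simp
      finally show "(\<Sum>i\<le>L. (?r i)\<^sup>2 * (of_bool (m \<notin> low L i) * (cmod (?a m))\<^sup>2)) \<le> (nonjump_const \<alpha>)\<^sup>2 * (w m)\<^sup>2 * (cmod (?a m))\<^sup>2" .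
    qed
    then have "(L2_set (\<lambda>i. ?r i * L2_norm (z i)) {..L})\<^sup>2 \<le> (nonjump_const \<alpha> * g s)\<^sup>2"
      by (simp add: L2_set_def sum_nonneg power_mult_distrib)
    moreover have "nonjump_const \<alpha> * g s \<ge> 0"
      using nonjump_const_nonneg[OF \<alpha>(1)] by (simp add: g_def ell2_nonneg)
    ultimately show ?thesis by (rule power2_le_imp_le)
  qed
  finally show ?thesis
    unfolding split using N_nonneg by (simp add: mult_ac mult_left_mono mult_right_mono)
qed

section \<open>The jump part and its Riemann sums\<close>

definition jump_sum :: "int set \<Rightarrow> (int \<Rightarrow> complex) \<Rightarrow> real \<Rightarrow> (int \<Rightarrow> complex) \<Rightarrow> complex" where
  "jump_sum F \<phi> s y = (\<Sum>n\<in>F. \<phi> n * (of_real (w n) * (\<Sum>m\<in>low L (block L n). osc_kernel k n m s * y m)))"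

lemma jump_sum_add: "jump_sum F \<phi> s (\<lambda>m. y m + z m) = jump_sum F \<phi> s y + jump_sum F \<phi> s z"
  by (simp add: jump_sum_def distrib_left sum.distrib)

lemma jump_sum_integrable:
  assumes "\<And>m. set_integrable lborel {a..<b} (\<lambda>s. y m s)" "finite F"
  shows "set_integrable lborel {a..<b} (\<lambda>s. jump_sum F \<phi> s (\<lambda>m. y m s))"
  unfolding jump_sum_def
  by (intro set_integrable_finite_sum set_integrable_mult_right finite_low block_le assms
        set_integrable_bounded_mult[OF osc_kernel_measurable osc_kernel_le])

lemma const_integrable: "set_integrable lborel {a..<b::real} (\<lambda>s. c :: complex)"
  by (rule set_integrable_bounded_interval[of _ "cmod c"]) auto

lemma jump_sum_const_integral:
  assumes "finite F"
  shows "(LINT s:{a..<b}|lborel. jump_sum F \<phi> s y)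
    = (\<Sum>n\<in>F. \<phi> n * (of_real (w n) * (\<Sum>m\<in>low L (block L n). osc n m a b k * y m)))"
proof -
  have i: "set_integrable lborel {a..<b} (\<lambda>s. osc_kernel k n m s * y m)" for n m
    by (intro set_integrable_mult_left osc_kernel_integrable)
  have "(LINT s:{a..<b}|lborel. jump_sum F \<phi> s y) =
     (\<Sum>n\<in>F. LINT s:{a..<b}|lborel. \<phi> n * (of_real (w n) * (\<Sum>m\<in>low L (block L n). osc_kernel k n m s * y m)))"
    unfolding jump_sum_def
    by (intro set_integral_finite_sum set_integrable_mult_right set_integrable_finite_sum assms i finite_low block_le)
  also have "\<dots> = (\<Sum>n\<in>F. \<phi> n * (of_real (w n) * (\<Sum>m\<in>low L (block L n). LINT s:{a..<b}|lborel. osc_kernel k n m s * y m)))"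
    by (intro sum.cong refl, (subst set_integral_mult_right)+, subst set_integral_finite_sum[OF finite_low[OF block_le(1)] i]) simp
  finally show ?thesis by (simp add: osc_eq)
qed

text \<open>A bound for the weighted jump operator at a fixed time, with the weights of all blocks
  simply added. It grows with \<open>L\<close>, which is harmless in the discretization
  error.\<close>

definition crude :: real where
  "crude = (\<Sum>i\<le>L. (2 powr \<alpha>) ^ i) * N"

lemma crude_nonneg: "crude \<ge> 0"
  using N_nonneg by (simp add: crude_def sum_nonneg)

lemma jump_sum_crude:
  assumes F: "finite F"
  shows "cmod (jump_sum F \<phi> s y) \<le> crude * norm_on y (low L L) * norm_on \<phi> F"
proof -
  let ?r = "\<lambda>i. (2 powr \<alpha>) ^ i :: real"
  let ?F = "\<lambda>i. {n \<in> F. block L n = i}"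
  have split: "jump_sum F \<phi> s y = (\<Sum>i\<le>L. of_real (?r i) * (\<Sum>n\<in>?F i. \<phi> n * (\<Sum>m\<in>low L i. osc_kernel k n m s * y m)))"
    unfolding jump_sum_def sum_blocks[OF F, of "\<lambda>n. \<phi> n * (of_real (w n) * _ n)"] sum_distrib_left[of "of_real (?r _)"]
    by (intro sum.cong refl) (auto simp: weight_block)
  have "cmod (jump_sum F \<phi> s y) \<le> (\<Sum>i\<le>L. ?r i * (N * norm_on y (low L L) * norm_on \<phi> F))"
    unfolding split
  proof (rule sum_norm_le)
    fix i assume i: "i \<in> {..L}"
    have "cmod (\<Sum>n\<in>?F i. \<phi> n * (\<Sum>m\<in>low L i. osc_kernel k n m s * y m)) \<le> N * norm_on y (low L i) * norm_on \<phi> (?F i)"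
      using i F by (intro osc_kernel_pairing finite_low) auto
    also have "\<dots> \<le> N * norm_on y (low L L) * norm_on \<phi> F"
      using i F N_nonneg low_mono[of i L L]
      by (intro mult_mono mult_left_mono norm_on_subset finite_low mult_nonneg_nonneg L2_set_nonneg) auto
    finally show "cmod (of_real (?r i) * (\<Sum>n\<in>?F i. \<phi> n * (\<Sum>m\<in>low L i. osc_kernel k n m s * y m))) \<le> ?r i * (N * norm_on y (low L L) * norm_on \<phi> F)"
      by (simp add: norm_mult norm_power mult_left_mono)
  qed
  also have "\<dots> = crude * norm_on y (low L L) * norm_on \<phi> F"
    by (simp add: crude_def sum_distrib_right mult.assoc)
  finally show ?thesis .
qed

definition \<kappa> :: "nat \<Rightarrow> nat \<Rightarrow> real" where
  "\<kappa> l j = jump_const \<alpha> * ((N * (T / 2 ^ l)) powr (1 - \<alpha>) * e l j powr (\<alpha> / 2))"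

lemma \<kappa>_nonneg: "\<kappa> l j \<ge> 0"
  using jump_const_pos[OF \<alpha>(1)] by (simp add: \<kappa>_def)

lemma jump_sum_node:
  assumes j: "j < 2 ^ l" and F: "finite F"
  shows "cmod (LINT s:{node T l j..<node T l (Suc j)}|lborel. jump_sum F \<phi> s y)
    \<le> \<kappa> l j * norm_on (\<lambda>m. of_real (w m) * y m) (low L L) * norm_on \<phi> F"
proof -
  have "node T l j \<le> node T l (Suc j)" using T_pos by (intro node_mono) auto
  from jump_pairing[OF F e(1)[OF j] e(2) this \<alpha>, of \<phi> L y] show ?thesis
    unfolding jump_sum_const_integral[OF F] node_Suc_diff \<kappa>_def by (simp only: mult.assoc)
qed

abbreviation "v l j \<equiv> d (node T l j) (node T l (Suc j))"

lemma node_in: "j \<le> 2 ^ l \<Longrightarrow> node T l j \<in> {0..T}"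
  using node_nonneg[of T l j] node_le[of T j l] T_pos by simp

lemma norm_on_le_d:
  assumes "s \<in> {0..T}" "t \<in> {0..T}" "finite F"
  shows "norm_on (\<lambda>m. of_real (w m) * (\<psi> m t - \<psi> m s)) F \<le> d s t"
  using norm_on_le_ell2[OF weighted_diff_summable[OF assms(1,2)] assms(3)]
  by (simp add: d_def right_diff_distrib)

text \<open>The error made by freezing the solution at the left end of the interval.\<close>

definition remainder :: "int set \<Rightarrow> (int \<Rightarrow> complex) \<Rightarrow> nat \<Rightarrow> nat \<Rightarrow> complex" where
  "remainder F \<phi> l j = (LINT s:{node T l j..<node T l (Suc j)}|lborel. jump_sum F \<phi> s (\<lambda>m. \<psi> m s - \<psi> m (node T l j)))"

text \<open>On the left half the base point does not change; on the right half it moves to the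
  midpoint, and the correction is the integrated jump operator of the right half applied to the
  increment over the left half. After \<open>M\<close> halvings there are 2^M intervals of length T
  / 2^(l+M), on each of which the Lipschitz bound gives an error quadratic in the length.\<close>

lemma remainder_le:
  assumes "j < 2 ^ l" "finite F"
  shows "cmod (remainder F \<phi> l j) \<le> norm_on \<phi> F *
    (tree_sum (\<lambda>l j. \<kappa> (Suc l) (Suc (2 * j)) * v (Suc l) (2 * j)) M l j + crude * (N * R) * T\<^sup>2 / (4 ^ l * 2 ^ M))"
  using assms(1)
proof (induction M arbitrary: l j)
  case 0
  let ?a = "node T l j" and ?b = "node T l (Suc j)"
  have ab: "0 \<le> ?a" "?a \<le> ?b" "?b \<le> T"
    using node_in[of j l] node_in[of "Suc j" l] node_mono[of T j "Suc j" l] T_pos 0 by auto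
  have "cmod (remainder F \<phi> l j) \<le> crude * (N * R * (T / 2 ^ l)) * norm_on \<phi> F * (?b - ?a)"
    unfolding remainder_def
  proof (rule set_integral_norm_bound_AE[OF _ AE_I2 ab(2)])
    show "set_integrable lborel {?a..<?b} (\<lambda>s. jump_sum F \<phi> s (\<lambda>m. \<psi> m s - \<psi> m ?a))"
      by (intro jump_sum_integrable set_integral_diff \<psi>_integrable const_integrable assms(2) ab)
    fix s
    show "s \<in> {?a..<?b} \<longrightarrow> cmod (jump_sum F \<phi> s (\<lambda>m. \<psi> m s - \<psi> m ?a)) \<le> crude * (N * R * (T / 2 ^ l)) * norm_on \<phi> F"
    proof
      assume s: "s \<in> {?a..<?b}"
      have "norm_on (\<lambda>m. \<psi> m s - \<psi> m ?a) (low L L) \<le> N * R * (s - ?a)"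
        using s ab by (intro \<psi>_lipschitz finite_low) auto
      also have "\<dots> \<le> N * R * (T / 2 ^ l)"
        using s node_Suc_diff[of T l j] N_nonneg R_nonneg by (intro mult_left_mono) auto
      finally have "crude * norm_on (\<lambda>m. \<psi> m s - \<psi> m ?a) (low L L) * norm_on \<phi> F \<le> crude * (N * R * (T / 2 ^ l)) * norm_on \<phi> F"
        using crude_nonneg by (intro mult_right_mono mult_left_mono L2_set_nonneg)
      then show "cmod (jump_sum F \<phi> s (\<lambda>m. \<psi> m s - \<psi> m ?a)) \<le> crude * (N * R * (T / 2 ^ l)) * norm_on \<phi> F"
        by (rule order_trans[OF jump_sum_crude[OF assms(2)]])
    qed
  qed
  also have "\<dots> = norm_on \<phi> F * (crude * (N * R) * T\<^sup>2 / (4 ^ l * 2 ^ 0))"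
  proof -
    have "(2::real) ^ l * 2 ^ l = 4 ^ l" by (simp flip: power_mult_distrib)
    then show ?thesis unfolding node_Suc_diff by (simp add: power2_eq_square)
  qed
  finally show ?case by simp
next
  case (Suc M)
  let ?a = "node T l j" and ?m = "node T (Suc l) (Suc (2 * j))" and ?b = "node T l (Suc j)"
  note j1 = child_less(1)[OF Suc.prems] and j2 = child_less(2)[OF Suc.prems]
  have b: "node T (Suc l) (Suc (Suc (2 * j))) = ?b" using node_child[of T l "Suc j"] by simp
  have ab: "0 \<le> ?a" "?a \<le> ?m" "?m \<le> ?b" "?b \<le> T"
    using node_in[of j l] node_in[of "Suc j" l] node_mono[of T "2 * j" "Suc (2 * j)" "Suc l"]
      node_mono[of T "Suc (2 * j)" "Suc (Suc (2 * j))" "Suc l"] T_pos Suc.prems b by auto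
  let ?f = "\<lambda>s. jump_sum F \<phi> s (\<lambda>m. \<psi> m s - \<psi> m ?a)"
  have int: "set_integrable lborel {x..<y} (\<lambda>s. jump_sum F \<phi> s (\<lambda>m. \<psi> m s - c m))" if "0 \<le> x" "y \<le> T" for x y c
    by (intro jump_sum_integrable set_integral_diff \<psi>_integrable const_integrable assms(2) that)
  have intc: "set_integrable lborel {x..<y} (\<lambda>s. jump_sum F \<phi> s c)" for x y c
    by (intro jump_sum_integrable const_integrable assms(2))
  have "{?a..<?b} = {?a..<?m} \<union> {?m..<?b}" using ab by auto
  then have "remainder F \<phi> l j = (LINT s:{?a..<?m}|lborel. ?f s) + (LINT s:{?m..<?b}|lborel. ?f s)"
    unfolding remainder_def using ab by (simp only:) (intro set_integral_Un int, auto)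
  also have "(LINT s:{?a..<?m}|lborel. ?f s) = remainder F \<phi> (Suc l) (2 * j)"
    by (simp add: remainder_def)
  also have "(LINT s:{?m..<?b}|lborel. ?f s) = remainder F \<phi> (Suc l) (Suc (2 * j)) + (LINT s:{?m..<?b}|lborel. jump_sum F \<phi> s (\<lambda>m. \<psi> m ?m - \<psi> m ?a))"
  proof -
    have split: "?f = (\<lambda>s. jump_sum F \<phi> s (\<lambda>m. \<psi> m s - \<psi> m ?m) + jump_sum F \<phi> s (\<lambda>m. \<psi> m ?m - \<psi> m ?a))"
      by (rule ext) (simp flip: jump_sum_add)
    show ?thesis
      unfolding remainder_def b split by (rule set_integral_add(2)[OF int intc]) (use ab in auto)
  qed
  finally have rec: "remainder F \<phi> l j = remainder F \<phi> (Suc l) (2 * j) + (remainder F \<phi> (Suc l) (Suc (2 * j))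
      + (LINT s:{?m..<?b}|lborel. jump_sum F \<phi> s (\<lambda>m. \<psi> m ?m - \<psi> m ?a)))" .
  have "cmod (LINT s:{?m..<?b}|lborel. jump_sum F \<phi> s (\<lambda>m. \<psi> m ?m - \<psi> m ?a)) \<le>
      \<kappa> (Suc l) (Suc (2 * j)) * norm_on (\<lambda>m. of_real (w m) * (\<psi> m ?m - \<psi> m ?a)) (low L L) * norm_on \<phi> F"
    using jump_sum_node[OF j2 assms(2)] unfolding b .
  also have "\<dots> \<le> \<kappa> (Suc l) (Suc (2 * j)) * v (Suc l) (2 * j) * norm_on \<phi> F"
    using norm_on_le_d[of ?a ?m "low L L"] ab \<kappa>_nonneg finite_low[of L L]
    by (intro mult_right_mono mult_left_mono L2_set_nonneg) auto
  finally have 1: "cmod (LINT s:{?m..<?b}|lborel. jump_sum F \<phi> s (\<lambda>m. \<psi> m ?m - \<psi> m ?a)) \<le> norm_on \<phi> F * (\<kappa> (Suc l) (Suc (2 * j)) * v (Suc l) (2 * j))"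
    by (simp add: mult_ac)
  let ?E = "crude * (N * R) * T\<^sup>2" and ?ts = "tree_sum (\<lambda>l j. \<kappa> (Suc l) (Suc (2 * j)) * v (Suc l) (2 * j)) M (Suc l)"
  have "cmod (remainder F \<phi> l j) \<le> norm_on \<phi> F * (?ts (2 * j) + ?E / (4 ^ Suc l * 2 ^ M)) +
     (norm_on \<phi> F * (?ts (Suc (2 * j)) + ?E / (4 ^ Suc l * 2 ^ M)) + norm_on \<phi> F * (\<kappa> (Suc l) (Suc (2 * j)) * v (Suc l) (2 * j)))"
    unfolding rec
    by (intro norm_triangle_le add_mono Suc.IH[OF j1] order_trans[OF norm_triangle_ineq] Suc.IH[OF j2] 1)
  also have "\<dots> = norm_on \<phi> F * ((\<kappa> (Suc l) (Suc (2 * j)) * v (Suc l) (2 * j) + ?ts (2 * j) + ?ts (Suc (2 * j))) + (?E / (4 ^ Suc l * 2 ^ M) + ?E / (4 ^ Suc l * 2 ^ M)))"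
    by (simp only: distrib_left add_ac)
  also have "?E / (4 ^ Suc l * 2 ^ M) + ?E / (4 ^ Suc l * 2 ^ M) = ?E / (4 ^ l * 2 ^ Suc M)"
    by (simp add: field_simps)
  finally show ?case by (simp only: tree_sum.simps)
qed

lemma increment_le:
  assumes j: "j < 2 ^ l" and B: "\<And>s. s \<in> {node T l j..node T l (Suc j)} \<Longrightarrow> g s \<le> B"
  shows "v l j \<le> N * nonjump_const \<alpha> * B * (T / 2 ^ l) + \<kappa> l j * B +
    (tree_sum (\<lambda>l j. \<kappa> (Suc l) (Suc (2 * j)) * v (Suc l) (2 * j)) M l j + crude * (N * R) * T\<^sup>2 / (4 ^ l * 2 ^ M))"
    (is "_ \<le> ?B1 + ?B2 + ?B3")
proof -
  let ?a = "node T l j" and ?b = "node T l (Suc j)"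
  have ab: "0 \<le> ?a" "?a \<le> ?b" "?b \<le> T"
    using node_in[of j l] node_in[of "Suc j" l] node_mono[of T j "Suc j" l] T_pos j by auto
  have gB: "g ?a \<le> B" using B[of ?a] ab by simp
  have B0: "B \<ge> 0" by (rule order_trans[OF _ gB]) (simp add: g_def ell2_nonneg)
  have B3: "?B3 \<ge> 0"
    using \<kappa>_nonneg ell2_nonneg crude_nonneg N_nonneg R_nonneg by (auto simp: d_def intro!: add_nonneg_nonneg tree_sum_nonneg)
  define C where C: "C = ?B1 + ?B2 + ?B3"
  have "v l j \<le> C"
    unfolding d_def
  proof (rule ell2_leI(2), rule norm_on_dual)
    fix F :: "int set" and \<phi> assume F: "finite F"
    let ?nj = "\<lambda>s. \<Sum>n\<in>F. \<phi> n * (of_real (w n) * (\<gamma> n s - (\<Sum>m\<in>low L (block L n). osc_kernel k n m s * \<psi> m s)))"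
    have int\<gamma>: "set_integrable lborel {?a..<?b} (\<gamma> n)" for n by (rule \<gamma>_sub_integrable[OF ab(1,3)])
    have intnj: "set_integrable lborel {?a..<?b} ?nj"
      by (intro set_integrable_finite_sum set_integrable_mult_right set_integral_diff int\<gamma> F finite_low block_le
        set_integrable_bounded_mult[OF osc_kernel_measurable osc_kernel_le] \<psi>_integrable ab)
    have int1: "set_integrable lborel {?a..<?b} (\<lambda>s. jump_sum F \<phi> s (\<lambda>m. \<psi> m s - \<psi> m ?a))"
      by (intro jump_sum_integrable set_integral_diff \<psi>_integrable const_integrable F ab)
    have int2: "set_integrable lborel {?a..<?b} (\<lambda>s. jump_sum F \<phi> s (\<lambda>m. \<psi> m ?a))"
      by (intro jump_sum_integrable const_integrable F)
    have "(\<Sum>n\<in>F. \<phi> n * (of_real (w n) * \<psi> n ?b - of_real (w n) * \<psi> n ?a)) = (\<Sum>n\<in>F. (\<phi> n * of_real (w n)) * (\<psi> n ?b - \<psi> n ?a))"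
      by (simp add: algebra_simps)
    also have "\<dots> = - \<i> * (LINT s:{?a..<?b}|lborel. \<Sum>n\<in>F. (\<phi> n * of_real (w n)) * \<gamma> n s)"
      by (rule \<psi>_diff_pairing[OF ab F])
    also have "(\<lambda>s. \<Sum>n\<in>F. (\<phi> n * of_real (w n)) * \<gamma> n s) = (\<lambda>s. ?nj s + (jump_sum F \<phi> s (\<lambda>m. \<psi> m s - \<psi> m ?a) + jump_sum F \<phi> s (\<lambda>m. \<psi> m ?a)))"
      unfolding jump_sum_add[symmetric]
      by (rule ext) (simp add: jump_sum_def algebra_simps flip: sum.distrib)
    also have "(LINT s:{?a..<?b}|lborel. ?nj s + (jump_sum F \<phi> s (\<lambda>m. \<psi> m s - \<psi> m ?a) + jump_sum F \<phi> s (\<lambda>m. \<psi> m ?a)))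
      = (LINT s:{?a..<?b}|lborel. ?nj s) + (remainder F \<phi> l j + (LINT s:{?a..<?b}|lborel. jump_sum F \<phi> s (\<lambda>m. \<psi> m ?a)))"
      unfolding remainder_def using intnj int1 int2 by (simp add: set_integral_add)
    finally have eq: "cmod (\<Sum>n\<in>F. \<phi> n * (of_real (w n) * \<psi> n ?b - of_real (w n) * \<psi> n ?a))
      = cmod ((LINT s:{?a..<?b}|lborel. ?nj s) + (remainder F \<phi> l j + (LINT s:{?a..<?b}|lborel. jump_sum F \<phi> s (\<lambda>m. \<psi> m ?a))))"
      by (simp add: norm_mult)
    have "cmod (LINT s:{?a..<?b}|lborel. ?nj s) \<le> N * nonjump_const \<alpha> * B * norm_on \<phi> F * (?b - ?a)"
    proof (rule set_integral_norm_bound_AE[OF intnj _ ab(2)])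
      show "AE s in lborel. s \<in> {?a..<?b} \<longrightarrow> cmod (?nj s) \<le> N * nonjump_const \<alpha> * B * norm_on \<phi> F"
        using \<gamma>_eq
      proof eventually_elim
        case (elim s)
        show ?case
        proof
          assume s: "s \<in> {?a..<?b}"
          then have s': "s \<in> {0..T}" using ab by auto
          have "cmod (?nj s) \<le> N * nonjump_const \<alpha> * g s * norm_on \<phi> F"
            using elim s' by (intro nonjump_pairing F) auto
          also have "\<dots> \<le> N * nonjump_const \<alpha> * B * norm_on \<phi> F"
            using B[of s] s N_nonneg nonjump_const_nonneg[OF \<alpha>(1)] by (intro mult_right_mono mult_left_mono L2_set_nonneg) auto
          finally show "cmod (?nj s) \<le> N * nonjump_const \<alpha> * B * norm_on \<phi> F" .
        qed
      qed
    qed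
    then have 1: "cmod (LINT s:{?a..<?b}|lborel. ?nj s) \<le> norm_on \<phi> F * ?B1"
      by (simp add: node_Suc_diff mult_ac)
    have 2: "cmod (remainder F \<phi> l j) \<le> norm_on \<phi> F * ?B3" by (rule remainder_le[OF j F])
    have "cmod (LINT s:{?a..<?b}|lborel. jump_sum F \<phi> s (\<lambda>m. \<psi> m ?a)) \<le> \<kappa> l j * norm_on (\<lambda>m. of_real (w m) * \<psi> m ?a) (low L L) * norm_on \<phi> F"
      by (rule jump_sum_node[OF j F])
    also have "\<dots> \<le> \<kappa> l j * B * norm_on \<phi> F"
    proof (intro mult_right_mono mult_left_mono L2_set_nonneg \<kappa>_nonneg)
      have "norm_on (\<lambda>m. of_real (w m) * \<psi> m ?a) (low L L) \<le> g ?a"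
        unfolding g_def using ab by (intro norm_on_le_ell2 weighted_summable finite_low) auto
      then show "norm_on (\<lambda>m. of_real (w m) * \<psi> m ?a) (low L L) \<le> B" using gB by simp
    qed
    finally have 3: "cmod (LINT s:{?a..<?b}|lborel. jump_sum F \<phi> s (\<lambda>m. \<psi> m ?a)) \<le> norm_on \<phi> F * ?B2"
      by (simp add: mult_ac)
    have "cmod (\<Sum>n\<in>F. \<phi> n * (of_real (w n) * \<psi> n ?b - of_real (w n) * \<psi> n ?a)) \<le> norm_on \<phi> F * ?B1 + (norm_on \<phi> F * ?B3 + norm_on \<phi> F * ?B2)"
      unfolding eq by (intro norm_triangle_le add_mono 1 order_trans[OF norm_triangle_ineq] 2 3)
    also have "\<dots> = C * norm_on \<phi> F"
      unfolding C by (simp only: distrib_left distrib_right mult_ac add_ac)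
    finally show "cmod (\<Sum>n\<in>F. \<phi> n * (of_real (w n) * \<psi> n ?b - of_real (w n) * \<psi> n ?a)) \<le> C * norm_on \<phi> F" .
  next
    show "C \<ge> 0"
      unfolding C using B0 N_nonneg nonjump_const_nonneg[OF \<alpha>(1)] \<kappa>_nonneg T_pos
      by (intro add_nonneg_nonneg[OF _ B3] add_nonneg_nonneg[of ?B1 ?B2] mult_nonneg_nonneg) auto
  qed
  then show ?thesis unfolding C .
qed

lemma g_0: "g 0 = 1"
proof -
  have "log_size 0 = 0" using less_log_size[of 0 0] by auto
  then have w0: "w 0 = 1" by (simp add: weight_def block_def)
  have "\<psi> n 0 = of_bool (n = 0)" for n
    using solution[of 0 n] T_pos by (simp add: \<psi>_def set_lebesgue_integral_def)
  then have "(\<lambda>n. (cmod (of_real (w n) * \<psi> n 0))\<^sup>2) = (\<lambda>n. of_bool (n = 0))"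
    using w0 by auto
  moreover have "(\<Sum>\<^sub>\<infinity>n::int. of_bool (n = 0) :: real) = (\<Sum>\<^sub>\<infinity>n\<in>{0::int}. of_bool (n = 0))"
    by (rule infsum_cong_neutral) auto
  ultimately show ?thesis by (simp add: g_def ell2_def)
qed

text \<open>The bound contains neither \<open>L\<close> nor \<open>R\<close>, so the cap on the
  weights can be removed afterwards. The initial norm is 1 because the constant function has only
  the zero mode, whose weight is 1.\<close>

lemma sobolev_growth:
  fixes P :: "nat \<Rightarrow> nat \<Rightarrow> real" and \<theta> b :: real
  assumes \<theta>: "0 < \<theta>" "\<theta> < 1"
    and P_children: "\<And>l j. j < 2 ^ l \<Longrightarrow> (P (Suc l) (2 * j))\<^sup>2 + (P (Suc l) (Suc (2 * j)))\<^sup>2 \<le> \<theta> * (P l j)\<^sup>2"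
    and P_ge: "\<And>l j. N * (T / 2 ^ l) + (N * (T / 2 ^ l)) powr (1 - \<alpha>) * e l j powr (\<alpha> / 2) \<le> P l j"
    and bad: "\<And>M. tree_sum (\<lambda>l j. of_bool (P l j > growth_threshold (growth_const \<alpha>) \<theta>)) M 0 0 \<le> b"
    and t: "t \<in> {0..T}" and F: "finite F"
  shows "norm_on (\<lambda>n. of_real (w n) * fourier_coeff (U t) n) F \<le> 2 powr (1 + b)"
proof -
  have NT: "0 \<le> N * (T / 2 ^ l)" for l using N_nonneg T_pos by simp
  have P_ge1: "N * (T / 2 ^ l) \<le> P l j" for l j
    using P_ge[of l j] NT[of l] powr_ge_zero[of "N * (T / 2 ^ l)"] by (smt (verit) mult_nonneg_nonneg powr_ge_zero)
  have P_ge2: "(N * (T / 2 ^ l)) powr (1 - \<alpha>) * e l j powr (\<alpha> / 2) \<le> P l j" for l j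
    using P_ge[of l j] NT[of l] by linarith
  have P0: "P l j \<ge> 0" for l j using P_ge1[of l j] NT[of l] by linarith
  have jc: "jump_const \<alpha> > 0" by (rule jump_const_pos[OF \<alpha>(1)])
  have \<kappa>P: "\<kappa> l j \<le> jump_const \<alpha> * P l j" for l j
    unfolding \<kappa>_def using P_ge2 jc by (intro mult_left_mono) auto
  have \<kappa>P': "\<kappa> l j \<le> growth_const \<alpha> * P l j" for l j
    using \<kappa>P[of l j] P0[of l j] mult_nonneg_nonneg[OF nonjump_const_nonneg[OF \<alpha>(1)] P0[of l j]]
    by (simp add: growth_const_def distrib_right)
  interpret G: dyadic_growth T "growth_const \<alpha>" \<theta> "crude * (N * R) * T\<^sup>2" "2 powr (\<alpha> * L) * (N * R)" P g d
  proof
    show "growth_const \<alpha> \<ge> 1" using jc nonjump_const_nonneg[OF \<alpha>(1)] by (simp add: growth_const_def)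
    show "crude * (N * R) * T\<^sup>2 \<ge> 0" using crude_nonneg N_nonneg R_nonneg by simp
    show "g t \<ge> 0" "d s t \<ge> 0" for s t by (simp_all add: g_def d_def ell2_nonneg)
    show "g t \<le> g s + d s t" if "s \<in> {0..T}" "t \<in> {0..T}" for s t
      using ell2_add(2)[OF weighted_summable[OF that(1)] weighted_diff_summable[OF that]]
      by (simp add: g_def d_def)
    show "d r t \<le> d r s + d s t" if "r \<in> {0..T}" "s \<in> {0..T}" "t \<in> {0..T}" for r s t
      using ell2_add(2)[OF weighted_diff_summable[OF that(1,2)] weighted_diff_summable[OF that(2,3)]]
      by (simp add: d_def)
    show "d s t \<le> 2 powr (\<alpha> * L) * (N * R) * \<bar>t - s\<bar>" if "s \<in> {0..T}" "t \<in> {0..T}" for s t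
      by (rule d_lipschitz'[OF that])
    fix j l M :: nat and B :: real
    assume j: "j < 2 ^ l" and B: "\<And>s. s \<in> {node T l j..node T l (Suc j)} \<Longrightarrow> g s \<le> B"
    have "g (node T l j) \<le> B" using B[of "node T l j"] node_mono[of T j "Suc j" l] T_pos by simp
    then have B0: "B \<ge> 0" by (rule order_trans[rotated]) (simp add: g_def ell2_nonneg)
    have "v l j \<le> N * nonjump_const \<alpha> * B * (T / 2 ^ l) + \<kappa> l j * B +
      (tree_sum (\<lambda>l j. \<kappa> (Suc l) (Suc (2 * j)) * v (Suc l) (2 * j)) M l j + crude * (N * R) * T\<^sup>2 / (4 ^ l * 2 ^ M))"
      by (rule increment_le[OF j B])
    also have "N * nonjump_const \<alpha> * B * (T / 2 ^ l) = nonjump_const \<alpha> * (N * (T / 2 ^ l)) * B" by simp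
    also have "\<dots> \<le> nonjump_const \<alpha> * P l j * B"
      using P_ge1 B0 nonjump_const_nonneg[OF \<alpha>(1)] by (intro mult_right_mono mult_left_mono) auto
    also have "\<kappa> l j * B \<le> jump_const \<alpha> * P l j * B" using \<kappa>P B0 by (intro mult_right_mono)
    also have "tree_sum (\<lambda>l j. \<kappa> (Suc l) (Suc (2 * j)) * v (Suc l) (2 * j)) M l j \<le>
      tree_sum (\<lambda>l j. growth_const \<alpha> * P (Suc l) (Suc (2 * j)) * v (Suc l) (2 * j)) M l j"
      using \<kappa>P' j by (intro tree_sum_mono mult_right_mono) (auto simp: d_def ell2_nonneg)
    finally have "v l j \<le> (nonjump_const \<alpha> * P l j * B + jump_const \<alpha> * P l j * B) +
      (tree_sum (\<lambda>l j. growth_const \<alpha> * P (Suc l) (Suc (2 * j)) * v (Suc l) (2 * j)) M l j + crude * (N * R) * T\<^sup>2 / (4 ^ l * 2 ^ M))"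
      by simp
    moreover have "nonjump_const \<alpha> * P l j * B + jump_const \<alpha> * P l j * B \<le> growth_const \<alpha> * P l j * B"
      using P0[of l j] B0 by (simp add: growth_const_def algebra_simps)
    ultimately show "v l j \<le> growth_const \<alpha> * P l j * B
        + tree_sum (\<lambda>l j. growth_const \<alpha> * P (Suc l) (Suc (2 * j)) * v (Suc l) (2 * j)) M l j
        + crude * (N * R) * T\<^sup>2 / (4 ^ l * 2 ^ M)" by linarith
  qed (use T_pos \<theta> P0 P_children in auto)
  have "norm_on (\<lambda>n. of_real (w n) * fourier_coeff (U t) n) F = norm_on (\<lambda>n. of_real (w n) * \<psi> n t) F"
    by (simp add: \<psi>_def norm_mult)
  also have "\<dots> \<le> g t" unfolding g_def by (rule norm_on_le_ell2[OF weighted_summable[OF t] F])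
  also have "g t \<le> 2 powr (1 + b) * g 0" by (rule G.growth[OF bad t])
  finally show ?thesis by (simp add: g_0)
qed

end

section \<open>Truncated potentials and the Duhamel formula in Fourier coefficients\<close>

lemma space_time_interval [simp]: "space (time_interval T) = {0..T}"
  by (simp add: time_interval_def space_restrict_space)

lemma finite_measure_time_interval: "finite_measure (time_interval T)"
proof
  show "emeasure (time_interval T) (space (time_interval T)) \<noteq> \<infinity>"
    using emeasure_bounded_finite[of "{0..T}"]
    by (simp add: time_interval_def emeasure_restrict_space space_restrict_space)
qed

lemma AE_time_interval_iff: "(AE s in time_interval T. P s) \<longleftrightarrow> (AE s in lborel. s \<in> {0..T} \<longrightarrow> P s)"
  unfolding time_interval_def by (subst AE_restrict_space_iff) auto

lemma integral_time_interval:
  fixes f :: "real \<Rightarrow> complex"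
  shows "(LINT s|time_interval t. f s) = (LINT s:{0..t}|lborel. f s)"
  unfolding time_interval_def set_lebesgue_integral_def by (subst integral_restrict_space) auto

lemma integrable_time_interval:
  fixes f :: "real \<Rightarrow> complex"
  shows "integrable (time_interval t) f \<longleftrightarrow> set_integrable lborel {0..t} f"
  unfolding time_interval_def set_integrable_def by (subst integrable_restrict_space) auto

lemma fourier_coeff_cong_AE:
  assumes "f \<in> borel_measurable torus" "h \<in> borel_measurable torus" "AE x in torus. f x = h x"
  shows "fourier_coeff f n = fourier_coeff h n"
  unfolding fourier_coeff_def
proof (rule integral_cong_AE)
  have e: "(\<lambda>x. exp (- (\<i> * of_int n * complex_of_real x))) \<in> borel_measurable torus"
    by (rule borel_measurable_torus) measurable
  show "(\<lambda>x. f x * exp (- (\<i> * of_int n * complex_of_real x))) \<in> borel_measurable torus"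
    "(\<lambda>x. h x * exp (- (\<i> * of_int n * complex_of_real x))) \<in> borel_measurable torus"
    using assms(1,2) e by (auto intro: borel_measurable_times)
  show "AE x in torus. f x * exp (- (\<i> * of_int n * complex_of_real x)) = h x * exp (- (\<i> * of_int n * complex_of_real x))"
    using assms(3) by eventually_elim simp
qed

lemma fourier_coeff_one: "fourier_coeff (\<lambda>x. 1) n = of_bool (n = 0)"
proof -
  have "emode 0 = (\<lambda>x. 1)" by (simp add: emode_def fun_eq_iff)
  then show ?thesis using emode_orthonormal[of 0 n] by (simp only: fourier_coeff_eq) auto
qed

text \<open>Replacing the values above the essential supremum by 0 gives a bound at every point and
  changes \<open>V\<close> only on a null set.\<close>

definition truncation :: "real \<Rightarrow> real \<Rightarrow> (real \<times> real \<Rightarrow> complex) \<Rightarrow> real \<times> real \<Rightarrow> complex" where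
  "truncation T N V z = (if fst z \<in> {0..<2 * pi} \<and> snd z \<in> {0..T} \<and> cmod (V z) \<le> N then V z else 0)"

lemma truncation_measurable:
  assumes V: "V \<in> borel_measurable (torus \<Otimes>\<^sub>M time_interval T)" and T: "T > 0"
  shows "truncation T N V \<in> borel_measurable (borel \<Otimes>\<^sub>M borel)"
proof -
  \<comment> \<open>\<open>V\<close> is measurable only on the product of the restricted spaces; the
    retractions \<open>p\<close> and \<open>q\<close> pull it back to a Borel function on the plane
    with the same values on the rectangle.\<close>
  define p where "p x = (if x \<in> {0..<2 * pi} then x else 0)" for x :: real
  define q where "q s = (if s \<in> {0..T} then s else 0)" for s :: real
  have "p \<in> borel \<rightarrow>\<^sub>M restrict_space lborel {0..<2 * pi}"
    unfolding p_def by (rule measurable_restrict_space2) auto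
  then have p: "p \<in> borel \<rightarrow>\<^sub>M torus" by (simp only: measurable_cong_sets[OF refl sets_torus])
  have q: "q \<in> borel \<rightarrow>\<^sub>M time_interval T"
    unfolding time_interval_def q_def using T by (intro measurable_restrict_space2) auto
  have "(\<lambda>z. (p (fst z), q (snd z))) \<in> borel \<Otimes>\<^sub>M borel \<rightarrow>\<^sub>M torus \<Otimes>\<^sub>M time_interval T"
    by (intro measurable_Pair measurable_compose[OF measurable_fst p] measurable_compose[OF measurable_snd q])
  from measurable_compose[OF this V]
  have [measurable]: "(\<lambda>z. V (p (fst z), q (snd z))) \<in> borel_measurable (borel \<Otimes>\<^sub>M borel)" .
  have "truncation T N V = (\<lambda>z. if fst z \<in> {0..<2 * pi} \<and> snd z \<in> {0..T} \<and> cmod (V (p (fst z), q (snd z))) \<le> N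
      then V (p (fst z), q (snd z)) else 0)"
    by (auto simp: truncation_def p_def q_def fun_eq_iff)
  then show ?thesis by simp
qed

lemma truncation_le: "N \<ge> 0 \<Longrightarrow> cmod (truncation T N V z) \<le> N"
  by (simp add: truncation_def)

lemma truncation_eq_AE:
  assumes V: "V \<in> Linf T" and N: "N = enn2real (Linf_norm T V)"
  shows "AE s in time_interval T. AE x in torus. truncation T N V (x, s) = V (x, s)"
proof -
  interpret time: finite_measure "time_interval T" by (rule finite_measure_time_interval)
  interpret pair_sigma_finite torus "time_interval T" ..
  have m: "V \<in> borel_measurable (torus \<Otimes>\<^sub>M time_interval T)" and fin: "Linf_norm T V < \<infinity>"
    using V by (auto simp: Linf_def)
  have "AE z in torus \<Otimes>\<^sub>M time_interval T. ennreal (cmod (V z)) \<le> Linf_norm T V"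
    unfolding Linf_norm_def by (rule esssup_AE)
  then have "AE z in torus \<Otimes>\<^sub>M time_interval T. cmod (V z) \<le> N"
  proof eventually_elim
    case (elim z)
    have "ennreal N = Linf_norm T V" using fin by (simp add: N)
    then have "ennreal (cmod (V z)) \<le> ennreal N" using elim by simp
    then show ?case by (subst (asm) ennreal_le_iff) (simp_all add: N)
  qed
  then have "AE x in torus. AE s in time_interval T. cmod (V (x, s)) \<le> N" by (rule AE_pair)
  then have "AE s in time_interval T. AE x in torus. cmod (V (x, s)) \<le> N"
    by (subst (asm) AE_commute) (use m in simp_all)
  moreover have "AE s in time_interval T. s \<in> {0..T}" using AE_space[of "time_interval T"] by simp
  ultimately show ?thesis
  proof eventually_elim
    case (elim s)
    have "AE x in torus. x \<in> {0..<2 * pi}" using AE_space[of torus] by simp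
    with elim(1) show ?case
      by eventually_elim (use elim(2) in \<open>simp add: truncation_def\<close>)
  qed
qed

lemma mild_solution_bounded:
  assumes "mild_solution T k V v0 u" "T > 0"
  obtains R where "\<And>t. t \<in> {0..T} \<Longrightarrow> L2_norm (\<lambda>x. u x t) \<le> R"
proof -
  have L2: "(\<lambda>x. u x t) \<in> L2_torus" if "t \<in> {0..T}" for t
    using assms that by (simp add: mild_solution_def)
  have "continuous_on {0..T} (\<lambda>t. L2_norm (\<lambda>x. u x t))"
    unfolding continuous_on_def
  proof
    fix t assume t: "t \<in> {0..T}"
    have lim: "((\<lambda>s. L2_norm (\<lambda>x. u x s - u x t)) \<longlongrightarrow> 0) (at t within {0..T})"
      using assms t by (simp add: mild_solution_def)
    have tri: "L2_norm (\<lambda>x. u x s) \<le> L2_norm (\<lambda>x. u x s - u x r) + L2_norm (\<lambda>x. u x r)"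
      if "s \<in> {0..T}" "r \<in> {0..T}" for s r
      using L2_norm_triangle[OF L2_torus_diff[OF L2[OF that(1)] L2[OF that(2)]] L2[OF that(2)]] by simp
    have sym: "L2_norm (\<lambda>x. u x s - u x r) = L2_norm (\<lambda>x. u x r - u x s)" for s r
      by (simp add: L2_norm_def norm_minus_commute)
    have "\<forall>\<^sub>F s in at t within {0..T}. norm (L2_norm (\<lambda>x. u x s) - L2_norm (\<lambda>x. u x t)) \<le> L2_norm (\<lambda>x. u x s - u x t)"
      unfolding eventually_at_filter
    proof (intro always_eventually allI impI)
      fix s assume "s \<noteq> t" "s \<in> {0..T}"
      then show "norm (L2_norm (\<lambda>x. u x s) - L2_norm (\<lambda>x. u x t)) \<le> L2_norm (\<lambda>x. u x s - u x t)"
        using tri[of s t] tri[of t s] sym[of s t] t by (simp add: abs_le_iff)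
    qed
    then have "((\<lambda>s. L2_norm (\<lambda>x. u x s) - L2_norm (\<lambda>x. u x t)) \<longlongrightarrow> 0) (at t within {0..T})"
      using lim by (rule Lim_null_comparison)
    then show "((\<lambda>s. L2_norm (\<lambda>x. u x s)) \<longlongrightarrow> L2_norm (\<lambda>x. u x t)) (at t within {0..T})"
      by (simp add: LIM_zero_iff)
  qed
  then have "bounded ((\<lambda>t. L2_norm (\<lambda>x. u x t)) ` {0..T})"
    by (intro compact_imp_bounded compact_continuous_image) auto
  then obtain R where "\<forall>y\<in>(\<lambda>t. L2_norm (\<lambda>x. u x t)) ` {0..T}. norm y \<le> R" by (auto simp: bounded_iff)
  then show ?thesis using that[of R] by force
qed

text \<open>Duhamel's formula comes with a different integrand \<open>w\<close> for each
  \<open>t\<close>, but the coefficients of \<open>w s\<close> depend on \<open>t\<close> only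
  through the factor exp (i k n^2 t). Hence a single \<gamma> serves all times.\<close>

lemma mild_solution_fourier:
  assumes u: "mild_solution T k V (\<lambda>x. 1) u" and T: "T > 0"
    and V: "V \<in> Linf T" and N: "N = enn2real (Linf_norm T V)"
  obtains \<gamma> where
    "\<And>n. set_integrable lborel {0..T} (\<gamma> n)"
    "AE s in lborel. s \<in> {0..T} \<longrightarrow> (\<forall>n. \<gamma> n s = cis (- (k * (real_of_int n)\<^sup>2 * s)) *
       fourier_coeff (\<lambda>x. truncation T N V (x, s) * u x s) n)"
    "\<And>t n. t \<in> {0..T} \<Longrightarrow> cis (- (k * (real_of_int n)\<^sup>2 * t)) * fourier_coeff (\<lambda>x. u x t) n =
       of_bool (n = 0) - \<i> * (LINT s:{0..<t}|lborel. \<gamma> n s)"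
proof -
  let ?W = "truncation T N V"
  have N0: "N \<ge> 0" by (simp add: N)
  interpret potential ?W T N
    using truncation_measurable[of V T N] truncation_le[OF N0] T V by unfold_locales (auto simp: Linf_def)
  have L2: "(\<lambda>x. u x t) \<in> L2_torus" if "t \<in> {0..T}" for t
    using u that by (simp add: mild_solution_def)
  have duh: "\<exists>f w h. free_evolution k t (\<lambda>x. 1) f \<and>
        (AE s in time_interval t. free_evolution k (t - s) (\<lambda>x. V (x, s) * u x s) (w s)) \<and>
        has_L2_integral w t h \<and> (AE x in torus. u x t = f x - \<i> * h x)" if "t \<in> {0..T}" for t
    using u that by (simp add: mild_solution_def)
  let ?c = "\<lambda>n s. cis (k * (real_of_int n)\<^sup>2 * s)"
  let ?G = "\<lambda>n s. ?c n (- s) * fourier_coeff (\<lambda>x. ?W (x, s) * u x s) n"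
  have coeff: "AE s in time_interval t. \<forall>n. fourier_coeff (w s) n = ?c n t * ?G n s"
    if t: "t \<in> {0..T}" and w: "AE s in time_interval t. free_evolution k (t - s) (\<lambda>x. V (x, s) * u x s) (w s)" for t w
  proof -
    have "AE s in time_interval t. AE x in torus. ?W (x, s) = V (x, s)"
      using truncation_eq_AE[OF V N] unfolding AE_time_interval_iff
      by eventually_elim (use t in auto)
    moreover have "AE s in time_interval t. s \<in> {0..t}" using AE_space[of "time_interval t"] by simp
    ultimately show ?thesis
      using w
    proof eventually_elim
      case (elim s)
      have s: "s \<in> {0..T}" using elim(2) t by auto
      have m: "(\<lambda>x. V (x, s) * u x s) \<in> borel_measurable torus" "(\<lambda>x. ?W (x, s) * u x s) \<in> borel_measurable torus"
        using elim(3) W_mult_L2[OF L2[OF s], of s] by (auto simp: free_evolution_def dest: L2_torus_measurable)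
      have "AE x in torus. V (x, s) * u x s = ?W (x, s) * u x s" using elim(1) by eventually_elim simp
      from fourier_coeff_cong_AE[OF m this]
      have "fourier_coeff (w s) n = cis (k * (t - s) * (real_of_int n)\<^sup>2) * fourier_coeff (\<lambda>x. ?W (x, s) * u x s) n" for n
        using elim(3) by (simp add: free_evolution_def cis_conv_exp)
      moreover have "cis (k * (t - s) * (real_of_int n)\<^sup>2) = ?c n t * ?c n (- s)" for n
        by (simp add: cis_mult algebra_simps)
      ultimately show ?case by simp
    qed
  qed
  obtain fT wT hT where wT: "AE s in time_interval T. free_evolution k (T - s) (\<lambda>x. V (x, s) * u x s) (wT s)"
      "has_L2_integral wT T hT"
    using duh[of T] T by auto
  \<comment> \<open>Taken from the final time \<open>T\<close>, whose integrand covers the whole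
    interval; the phase at \<open>T\<close> is divided out.\<close>
  define \<gamma> where "\<gamma> n s = ?c n (- T) * fourier_coeff (wT s) n" for n s
  have int: "set_integrable lborel {0..T} (\<gamma> n)" for n
  proof -
    have "integrable (time_interval T) (\<lambda>s. L2_inner (wT s) (emode n))"
      using wT(2) by (simp add: has_L2_integral_def)
    then show ?thesis
      unfolding \<gamma>_def fourier_coeff_eq integrable_time_interval by (rule set_integrable_mult_right)
  qed
  have AE\<gamma>: "AE s in time_interval T. \<forall>n. \<gamma> n s = ?G n s"
    using coeff[OF _ wT(1)] T unfolding \<gamma>_def
    by (auto simp: mult.assoc[symmetric] cis_mult)
  have sol: "cis (- (k * (real_of_int n)\<^sup>2 * t)) * fourier_coeff (\<lambda>x. u x t) n = of_bool (n = 0) - \<i> * (LINT s:{0..<t}|lborel. \<gamma> n s)"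
    if t: "t \<in> {0..T}" for t n
  proof -
    obtain f w h where f: "free_evolution k t (\<lambda>x. 1) f"
      and w: "AE s in time_interval t. free_evolution k (t - s) (\<lambda>x. V (x, s) * u x s) (w s)"
      and h: "has_L2_integral w t h" and eq: "AE x in torus. u x t = f x - \<i> * h x"
      using duh[OF t] by auto
    have fL2: "f \<in> L2_torus" and hL2: "h \<in> L2_torus"
      using f h by (auto simp: free_evolution_def has_L2_integral_def)
    have "fourier_coeff (\<lambda>x. u x t) n = fourier_coeff (\<lambda>x. f x - \<i> * h x) n"
      by (intro fourier_coeff_cong_AE eq L2_torus_measurable L2 t L2_torus_diff L2_torus_cmult fL2 hL2)
    also have "\<dots> = fourier_coeff f n - \<i> * fourier_coeff h n"
      unfolding fourier_coeff_eq
      by (subst L2_inner_diff[OF fL2 L2_torus_cmult[OF hL2] emode_L2]) (simp add: L2_inner_cmult)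
    also have "fourier_coeff f n = of_bool (n = 0)"
      using f by (simp add: free_evolution_def fourier_coeff_one)
    also have "fourier_coeff h n = (LINT s|time_interval t. fourier_coeff (w s) n)"
      using h by (simp add: has_L2_integral_def fourier_coeff_eq)
    also have "\<dots> = (LINT s|time_interval t. ?c n t * \<gamma> n s)"
    proof (rule integral_cong_AE)
      have "integrable (time_interval t) (\<lambda>s. L2_inner (w s) (emode n))"
        using h by (simp add: has_L2_integral_def)
      then show "(\<lambda>s. fourier_coeff (w s) n) \<in> borel_measurable (time_interval t)"
        unfolding fourier_coeff_eq by (rule borel_measurable_integrable)
      have "integrable (time_interval t) (\<gamma> n)"
        unfolding integrable_time_interval by (rule set_integrable_subset[OF int]) (use t in auto)
      then show "(\<lambda>s. ?c n t * \<gamma> n s) \<in> borel_measurable (time_interval t)"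
        by (intro borel_measurable_integrable integrable_mult_right)
      have "AE s in time_interval t. \<forall>n. \<gamma> n s = ?G n s"
        using AE\<gamma> unfolding AE_time_interval_iff by eventually_elim (use t in auto)
      then show "AE s in time_interval t. fourier_coeff (w s) n = ?c n t * \<gamma> n s"
        using coeff[OF t w] by eventually_elim simp
    qed
    also have "\<dots> = ?c n t * (LINT s:{0..t}|lborel. \<gamma> n s)"
      by (simp add: integral_time_interval)
    also have "(LINT s:{0..t}|lborel. \<gamma> n s) = (LINT s:{0..<t}|lborel. \<gamma> n s)"
    proof (rule set_integral_cong_set)
      have "set_integrable lborel {0..<t} (\<gamma> n)" "set_integrable lborel {0..t} (\<gamma> n)"
        using t by (auto intro: set_integrable_subset[OF int])
      then show "set_borel_measurable lborel {0..t} (\<gamma> n)" "set_borel_measurable lborel {0..<t} (\<gamma> n)"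
        unfolding set_integrable_def set_borel_measurable_def by (auto dest: borel_measurable_integrable)
      show "AE x in lborel. (x \<in> {0..<t}) = (x \<in> {0..t})"
        using AE_lborel_singleton[of t] by eventually_elim auto
    qed
    finally have "fourier_coeff (\<lambda>x. u x t) n = of_bool (n = 0) - \<i> * (?c n t * (LINT s:{0..<t}|lborel. \<gamma> n s))" .
    moreover have "cis (- (k * (real_of_int n)\<^sup>2 * t)) * ?c n t = 1" by (simp add: cis_mult)
    moreover have "cis (- (k * (real_of_int n)\<^sup>2 * t)) * of_bool (n = 0) = of_bool (n = 0)" by simp
    ultimately show ?thesis by (simp add: right_diff_distrib mult.left_commute[of _ \<i>] flip: mult.assoc)
  qed
  show ?thesis
  proof (rule that[of \<gamma>])
    show "AE s in lborel. s \<in> {0..T} \<longrightarrow> (\<forall>n. \<gamma> n s = cis (- (k * (real_of_int n)\<^sup>2 * s)) * fourier_coeff (\<lambda>x. ?W (x, s) * u x s) n)"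
      using AE\<gamma> unfolding AE_time_interval_iff by simp
  qed (use int sol in auto)
qed

section \<open>Choice of the controls and conclusion\<close>

text \<open>Concavity of the power gives 2^(1-s), and halving the interval gives 2^(-a).\<close>

lemma powr_children:
  fixes a s x x1 x2 :: real
  assumes "0 \<le> x1" "0 \<le> x2" "x1 + x2 \<le> x" "0 < s" "s < 1" "T > 0"
  shows "(T / 2 ^ Suc l) powr a * x1 powr s + (T / 2 ^ Suc l) powr a * x2 powr s
    \<le> 2 powr (1 - s - a) * ((T / 2 ^ l) powr a * x powr s)"
proof -
  have "x1 powr s + x2 powr s \<le> 2 powr (1 - s) * (x1 + x2) powr s"
    using holder_sum_powr[of "{True, False}" "\<lambda>b. if b then x1 else x2" s] assms by simp
  also have "\<dots> \<le> 2 powr (1 - s) * x powr s" using assms by (intro mult_left_mono powr_mono2) auto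
  finally have "(T / 2 ^ Suc l) powr a * (x1 powr s + x2 powr s) \<le> (T / 2 ^ Suc l) powr a * (2 powr (1 - s) * x powr s)"
    by (rule mult_left_mono) simp
  also have "(T / 2 ^ Suc l) powr a = (T / 2 ^ l) powr a * 2 powr - a"
    using assms(6) by (simp add: powr_divide powr_mult powr_minus field_simps)
  also have "(T / 2 ^ l) powr a * 2 powr - a * (2 powr (1 - s) * x powr s) = (2 powr - a * 2 powr (1 - s)) * ((T / 2 ^ l) powr a * x powr s)"
    by (simp only: mult_ac)
  also have "2 powr - a * 2 powr (1 - s) = (2 powr (1 - s - a) :: real)"
    by (simp add: algebra_simps flip: powr_add)
  finally show ?thesis
    using assms(6) by (simp add: distrib_left powr_divide powr_mult powr_minus field_simps)
qed

text \<open>The term linear in the length contributes n^2 / 2, and the cross term is n (y1 + y2) <=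
  2 \<theta> n y. Both need 2 \<theta> >= 1, which is why \<open>contraction\<close> is at least
  1/2.\<close>

lemma square_sum_children:
  fixes \<theta> n y y1 y2 :: real
  assumes "1 / 2 \<le> \<theta>" "0 \<le> n" "0 \<le> y" "0 \<le> y1" "0 \<le> y2" "y1\<^sup>2 + y2\<^sup>2 \<le> \<theta> * y\<^sup>2"
  shows "(n / 2 + y1)\<^sup>2 + (n / 2 + y2)\<^sup>2 \<le> \<theta> * (n + y)\<^sup>2"
proof -
  have "(y1 + y2)\<^sup>2 \<le> 2 * (y1\<^sup>2 + y2\<^sup>2)" using sum_squares_bound[of y1 y2] by (simp add: power2_sum)
  also have "\<dots> \<le> 2 * (\<theta> * y\<^sup>2)" using assms by simp
  also have "\<dots> \<le> (2 * \<theta>) * ((2 * \<theta>) * y\<^sup>2)"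
    using assms mult_right_mono[of 1 "2 * \<theta>" "2 * (\<theta> * y\<^sup>2)"] by (simp add: mult_ac)
  finally have "(y1 + y2)\<^sup>2 \<le> (2 * \<theta> * y)\<^sup>2" by (simp add: power2_eq_square mult_ac)
  then have "y1 + y2 \<le> 2 * \<theta> * y" by (rule power2_le_imp_le) (use assms in auto)
  then have "n * (y1 + y2) \<le> n * (2 * \<theta> * y)" using assms by (intro mult_left_mono)
  moreover have "n\<^sup>2 / 2 \<le> \<theta> * n\<^sup>2" using assms mult_right_mono[of "1 / 2" \<theta> "n\<^sup>2"] by simp
  ultimately show ?thesis using assms(6) by (simp add: power2_sum power_divide algebra_simps)
qed

text \<open>Here and below, \<open>\<delta> = 1 / p'\<close>.\<close>

definition contraction :: "real \<Rightarrow> real \<Rightarrow> real" where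
  "contraction \<alpha> \<delta> = max (1 / 2) (2 powr (\<alpha> * (2 - 2 * \<delta>) - 1))"

text \<open>The power of |I| in the jump control: 1 - \<alpha> from the L^2 endpoint, minus r
  \<alpha> / 2 with r = 1 - 2 \<delta>, because e_I is estimated by |I|^(-r) times the total energy
  of I.\<close>

definition scale_exponent :: "real \<Rightarrow> real \<Rightarrow> real" where
  "scale_exponent \<alpha> \<delta> = 1 - \<alpha> - \<alpha> * (1 - 2 * \<delta>) / 2"

text \<open>The first factor comes from Chebyshev's inequality at half the threshold. The other two
  are the geometric sums over the tree for the linear part and for the jump part of the
  control.\<close>

definition bad_const :: "real \<Rightarrow> real \<Rightarrow> real \<Rightarrow> real" where
  "bad_const \<alpha> \<delta> q = (2 / growth_threshold (growth_const \<alpha>) (contraction \<alpha> \<delta>)) powr q *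
     (1 / (1 - 2 powr (1 - q)) + 1 / (1 - 2 powr (1 - \<alpha> / 2 * q - scale_exponent \<alpha> \<delta> * q)))"

text \<open>The hypotheses in terms of \<delta>: since 2 \<delta> = 2 (p - 1) / p, the condition
  \<alpha> p < 2 (p - 1) reads \<alpha> < 2 \<delta>, and p < 2 reads \<delta> < 1/2.\<close>

locale exponents =
  fixes \<alpha> \<delta> s\<^sub>0 :: real
  assumes \<alpha>_pos: "0 < \<alpha>" and \<alpha>_less: "\<alpha> < 2 * \<delta>" and \<delta>_less: "\<delta> < 1 / 2" and \<alpha>_eq: "\<alpha> = 2 * \<delta> * s\<^sub>0"
begin

lemma \<delta>_pos: "0 < \<delta>" and \<alpha>_less_1: "\<alpha> < 1"
  using \<alpha>_pos \<alpha>_less \<delta>_less by auto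

lemma s\<^sub>0_bounds: "0 < s\<^sub>0" "s\<^sub>0 < 1"
  using \<alpha>_pos \<alpha>_less \<delta>_pos unfolding \<alpha>_eq by (auto simp: zero_less_mult_iff)

lemma \<delta>_square: "4 * (\<delta> * (1 - \<delta>)) < 1"
proof -
  have "0 < (1 - 2 * \<delta>)\<^sup>2" using \<delta>_less by simp
  then show ?thesis by (simp add: power2_eq_square algebra_simps)
qed

text \<open>This exponent governs the squares of the jump controls under halving; its sign gives the
  contraction required by the growth estimate.\<close>

lemma square_exponent: "\<alpha> * (2 - 2 * \<delta>) - 1 < 0"
proof -
  have "\<alpha> * (2 - 2 * \<delta>) < 2 * \<delta> * (2 - 2 * \<delta>)" using \<alpha>_less \<delta>_less by (intro mult_strict_right_mono) auto
  also have "\<dots> = 4 * (\<delta> * (1 - \<delta>))" by (simp add: algebra_simps)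
  also have "\<dots> < 1" by (rule \<delta>_square)
  finally show ?thesis by simp
qed

lemma contraction_bounds: "1 / 2 \<le> contraction \<alpha> \<delta>" "0 < contraction \<alpha> \<delta>" "contraction \<alpha> \<delta> < 1"
  using square_exponent powr_less_mono[of "\<alpha> * (2 - 2 * \<delta>) - 1" 0 2] by (auto simp: contraction_def)

text \<open>The analogue of \<open>square_exponent\<close> for the counting power 1 +
  \<open>s\<^sub>0\<close>. The exponent factors with \<open>s\<^sub>0\<close> in front, and the
  other factor has a sign because \<open>s\<^sub>0\<close> < 1 and 4 \<delta> (1 - \<delta>) <
  1.\<close>

lemma bad_exponent: "1 - \<alpha> / 2 * (1 + s\<^sub>0) - scale_exponent \<alpha> \<delta> * (1 + s\<^sub>0) < 0"
proof -
  have "2 * (\<delta> * (1 - \<delta>)) * (1 + s\<^sub>0) < 1"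
  proof -
    have "2 * (\<delta> * (1 - \<delta>)) * (1 + s\<^sub>0) \<le> 2 * (\<delta> * (1 - \<delta>)) * 2"
      using s\<^sub>0_bounds \<delta>_pos \<delta>_less by (intro mult_left_mono) auto
    then show ?thesis using \<delta>_square by simp
  qed
  then have "s\<^sub>0 * (1 - 2 * (\<delta> * (1 - \<delta>)) * (1 + s\<^sub>0)) > 0" using s\<^sub>0_bounds by simp
  moreover have "\<alpha> / 2 * (1 + s\<^sub>0) + scale_exponent \<alpha> \<delta> * (1 + s\<^sub>0) - 1 = s\<^sub>0 * (1 - 2 * (\<delta> * (1 - \<delta>)) * (1 + s\<^sub>0))"
    unfolding scale_exponent_def \<alpha>_eq by (simp add: field_simps)
  ultimately show ?thesis by linarith
qed

lemma threshold_pos: "growth_threshold (growth_const \<alpha>) (contraction \<alpha> \<delta>) > 0"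
  using growth_const_ge[OF \<alpha>_pos] contraction_bounds by (intro growth_threshold_pos) auto

lemma bad_const_nonneg: "bad_const \<alpha> \<delta> (1 + s\<^sub>0) \<ge> 0"
  unfolding bad_const_def using bad_exponent s\<^sub>0_bounds
    powr_less_mono[of "1 - \<alpha> / 2 * (1 + s\<^sub>0) - scale_exponent \<alpha> \<delta> * (1 + s\<^sub>0)" 0 2]
    powr_less_mono[of "- s\<^sub>0" 0 2]
  by (intro mult_nonneg_nonneg add_nonneg_nonneg) auto

end

locale potential_exponents = potential W T N + exponents \<alpha> \<delta> s\<^sub>0
  for W :: "real \<times> real \<Rightarrow> complex" and T N \<alpha> \<delta> s\<^sub>0 :: real +
  fixes k :: real
  assumes finite_energy: "total_energy (1 - 2 * \<delta>) 0 0 k < \<infinity>"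
begin

abbreviation "r \<equiv> 1 - 2 * \<delta>"

text \<open>The value 0 off the tree lets \<open>jump_control_ge\<close> hold for all
  indices.\<close>

definition node_energy :: "nat \<Rightarrow> nat \<Rightarrow> real" where
  "node_energy l j = (if j < 2 ^ l then enn2real (energy (node T l j) (node T l (Suc j)) k) else 0)"

text \<open>Replaces the energy of the node, which says nothing about the energies of its halves;
  this sum is superadditive under halving.\<close>

definition tail_energy :: "nat \<Rightarrow> nat \<Rightarrow> real" where
  "tail_energy l j = enn2real (total_energy r l j k)"

definition jump_control :: "nat \<Rightarrow> nat \<Rightarrow> real" where
  "jump_control l j = N powr (1 - \<alpha>) * ((T / 2 ^ l) powr scale_exponent \<alpha> \<delta> * tail_energy l j powr (\<alpha> / 2))"

lemma total_energy_finite: "j < 2 ^ l \<Longrightarrow> total_energy r l j k < \<infinity>"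
proof (induction l arbitrary: j)
  case 0
  then show ?case using finite_energy by simp
next
  case (Suc l)
  have j: "j div 2 < 2 ^ l" "j = 2 * (j div 2) \<or> j = Suc (2 * (j div 2))" using Suc.prems by auto
  have "total_energy r (Suc l) j k \<le> total_energy r l (j div 2) k"
    using j(2) by (subst (2) total_energy_rec) (auto intro: add_increasing add_increasing2)
  then show ?case using Suc.IH[OF j(1)] by (rule le_less_trans)
qed

lemma tail_energy_nonneg: "tail_energy l j \<ge> 0"
  by (simp add: tail_energy_def)

lemma tail_energy_children:
  assumes "j < 2 ^ l"
  shows "tail_energy (Suc l) (2 * j) + tail_energy (Suc l) (Suc (2 * j)) \<le> tail_energy l j"
proof -
  have "enn2real (total_energy r (Suc l) (2 * j) k + total_energy r (Suc l) (Suc (2 * j)) k) \<le> enn2real (total_energy r l j k)"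
  proof (rule enn2real_mono)
    show "total_energy r (Suc l) (2 * j) k + total_energy r (Suc l) (Suc (2 * j)) k \<le> total_energy r l j k"
      by (subst (3) total_energy_rec) (auto intro: add_increasing)
    show "total_energy r l j k < \<top>" using total_energy_finite[OF assms] by simp
  qed
  then show ?thesis
    using total_energy_finite[OF child_less(1)[OF assms]] total_energy_finite[OF child_less(2)[OF assms]]
    by (simp add: tail_energy_def enn2real_plus)
qed

lemma energy_finite:
  assumes "j < 2 ^ l"
  shows "energy (node T l j) (node T l (Suc j)) k \<le> ennreal (node_energy l j)"
    and "(T / 2 ^ l) powr r * node_energy l j \<le> tail_energy l j"
proof -
  have le: "scaled_energy r l j k \<le> total_energy r l j k"
    by (subst total_energy_rec) (auto intro: add_increasing2)
  then have "scaled_energy r l j k < \<infinity>" using total_energy_finite[OF assms] by (rule le_less_trans)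
  moreover have "(T / 2 ^ l) powr r > 0" using T_pos by simp
  ultimately have fin: "energy (node T l j) (node T l (Suc j)) k < \<infinity>"
    unfolding scaled_energy_def by (auto simp: ennreal_mult_less_top top_unique less_top[symmetric] ennreal_mult_eq_top_iff)
  then show "energy (node T l j) (node T l (Suc j)) k \<le> ennreal (node_energy l j)"
    using assms by (simp add: node_energy_def)
  have "enn2real (scaled_energy r l j k) \<le> enn2real (total_energy r l j k)"
    using le total_energy_finite[OF assms] by (intro enn2real_mono) auto
  then show "(T / 2 ^ l) powr r * node_energy l j \<le> tail_energy l j"
    using assms by (simp add: scaled_energy_def tail_energy_def node_energy_def enn2real_mult)
qed

lemma node_energy_nonneg: "node_energy l j \<ge> 0"
  by (simp add: node_energy_def)

lemma jump_control_nonneg: "jump_control l j \<ge> 0"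
  by (simp add: jump_control_def)

lemma jump_control_ge:
  "(N * (T / 2 ^ l)) powr (1 - \<alpha>) * node_energy l j powr (\<alpha> / 2) \<le> jump_control l j"
proof (cases "j < 2 ^ l")
  case False
  then show ?thesis using jump_control_nonneg by (simp add: node_energy_def)
next
  case True
  let ?t = "T / 2 ^ l"
  have t: "?t > 0" using T_pos by simp
  have "?t powr - r * ?t powr r = 1" using T_pos by (simp flip: powr_add)
  then have "node_energy l j = ?t powr - r * (?t powr r * node_energy l j)"
    by (simp only: mult.assoc[symmetric] mult_1)
  also have "\<dots> \<le> ?t powr - r * tail_energy l j"
    using energy_finite(2)[OF True] by (intro mult_left_mono) auto
  finally have "node_energy l j powr (\<alpha> / 2) \<le> (?t powr - r * tail_energy l j) powr (\<alpha> / 2)"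
    using \<alpha>_pos node_energy_nonneg by (intro powr_mono2) auto
  also have "\<dots> = ?t powr (- r * (\<alpha> / 2)) * tail_energy l j powr (\<alpha> / 2)"
    by (simp add: powr_mult powr_powr)
  finally have "(N * ?t) powr (1 - \<alpha>) * node_energy l j powr (\<alpha> / 2) \<le>
    (N * ?t) powr (1 - \<alpha>) * (?t powr (- r * (\<alpha> / 2)) * tail_energy l j powr (\<alpha> / 2))"
    by (rule mult_left_mono) simp
  also have "\<dots> = N powr (1 - \<alpha>) * ((?t powr (1 - \<alpha>) * ?t powr (- r * (\<alpha> / 2))) * tail_energy l j powr (\<alpha> / 2))"
    by (simp only: powr_mult mult_ac)
  also have "?t powr (1 - \<alpha>) * ?t powr (- r * (\<alpha> / 2)) = ?t powr scale_exponent \<alpha> \<delta>"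
    unfolding powr_add[symmetric] scale_exponent_def
    by (rule arg_cong[of _ _ "\<lambda>x. ?t powr x"]) (simp add: field_simps)
  finally show ?thesis by (simp only: jump_control_def)
qed

lemma jump_control_powr:
  "jump_control l j powr c = (N powr (1 - \<alpha>)) powr c * ((T / 2 ^ l) powr (scale_exponent \<alpha> \<delta> * c) * tail_energy l j powr (\<alpha> / 2 * c))"
  unfolding jump_control_def powr_mult powr_powr ..

text \<open>Used with c = 2 for the growth estimate and with c = 1 + \<open>s\<^sub>0\<close> for
  counting bad intervals.\<close>

lemma jump_control_powr_children:
  assumes "j < 2 ^ l" "0 < \<alpha> / 2 * c" "\<alpha> / 2 * c < 1"
  shows "jump_control (Suc l) (2 * j) powr c + jump_control (Suc l) (Suc (2 * j)) powr c
    \<le> 2 powr (1 - \<alpha> / 2 * c - scale_exponent \<alpha> \<delta> * c) * jump_control l j powr c"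
proof -
  have "(T / 2 ^ Suc l) powr (scale_exponent \<alpha> \<delta> * c) * tail_energy (Suc l) (2 * j) powr (\<alpha> / 2 * c)
      + (T / 2 ^ Suc l) powr (scale_exponent \<alpha> \<delta> * c) * tail_energy (Suc l) (Suc (2 * j)) powr (\<alpha> / 2 * c)
     \<le> 2 powr (1 - \<alpha> / 2 * c - scale_exponent \<alpha> \<delta> * c) * ((T / 2 ^ l) powr (scale_exponent \<alpha> \<delta> * c) * tail_energy l j powr (\<alpha> / 2 * c))"
    by (intro powr_children tail_energy_nonneg tail_energy_children assms T_pos)
  from mult_left_mono[OF this, of "(N powr (1 - \<alpha>)) powr c"] show ?thesis
    unfolding jump_control_powr by (simp add: distrib_left mult_ac)
qed

definition control :: "nat \<Rightarrow> nat \<Rightarrow> real" where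
  "control l j = N * (T / 2 ^ l) + jump_control l j"

lemma control_children:
  assumes j: "j < 2 ^ l"
  shows "(control (Suc l) (2 * j))\<^sup>2 + (control (Suc l) (Suc (2 * j)))\<^sup>2 \<le> contraction \<alpha> \<delta> * (control l j)\<^sup>2"
proof -
  have p2: "jump_control l j powr 2 = (jump_control l j)\<^sup>2" for l j
    using jump_control_nonneg[of l j] by simp
  have ex: "1 - \<alpha> / 2 * 2 - scale_exponent \<alpha> \<delta> * 2 = \<alpha> * (2 - 2 * \<delta>) - 1"
    by (simp add: scale_exponent_def field_simps)
  have "(jump_control (Suc l) (2 * j))\<^sup>2 + (jump_control (Suc l) (Suc (2 * j)))\<^sup>2 \<le> 2 powr (\<alpha> * (2 - 2 * \<delta>) - 1) * (jump_control l j)\<^sup>2"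
    using jump_control_powr_children[OF j, of 2] \<alpha>_pos \<alpha>_less_1 unfolding p2 ex by simp
  also have "\<dots> \<le> contraction \<alpha> \<delta> * (jump_control l j)\<^sup>2"
    unfolding contraction_def by (intro mult_right_mono) auto
  finally have "(N * (T / 2 ^ l) / 2 + jump_control (Suc l) (2 * j))\<^sup>2 + (N * (T / 2 ^ l) / 2 + jump_control (Suc l) (Suc (2 * j)))\<^sup>2
      \<le> contraction \<alpha> \<delta> * (N * (T / 2 ^ l) + jump_control l j)\<^sup>2"
    using contraction_bounds N_nonneg T_pos jump_control_nonneg by (intro square_sum_children) auto
  then show ?thesis by (simp add: control_def mult_ac)
qed

text \<open>Chebyshev's inequality: on a bad interval one of the two parts of the control exceeds
  half the threshold. The q-th powers of both parts contract, the linear one because q > 1, so their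
  sums over the tree are bounded by the values at the root.\<close>

lemma bad_count:
  fixes q defines "q \<equiv> 1 + s\<^sub>0"
  shows "tree_sum (\<lambda>l j. of_bool (control l j > growth_threshold (growth_const \<alpha>) (contraction \<alpha> \<delta>))) M 0 0
    \<le> bad_const \<alpha> \<delta> q * ((T * N) powr q + jump_control 0 0 powr q)"
proof -
  let ?\<tau> = "growth_threshold (growth_const \<alpha>) (contraction \<alpha> \<delta>)"
  let ?n = "\<lambda>l j::nat. N * (T / 2 ^ l)"
  let ?y = jump_control
  have \<tau>: "?\<tau> > 0" by (rule threshold_pos)
  have q: "q > 0" using s\<^sub>0_bounds by (simp add: q_def)
  have n0: "?n l j \<ge> 0" for l j using N_nonneg T_pos by simp
  have bad: "of_bool (control l j > ?\<tau>) \<le> (2 / ?\<tau>) powr q * (?n l j powr q + ?y l j powr q)" for l j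
  proof (cases "control l j > ?\<tau>")
    case True
    then have "?n l j \<ge> ?\<tau> / 2 \<or> ?y l j \<ge> ?\<tau> / 2" unfolding control_def by linarith
    then obtain x where x: "x \<ge> ?\<tau> / 2" "x powr q \<le> ?n l j powr q + ?y l j powr q"
      by (metis add.commute le_add_same_cancel1 powr_ge_zero)
    have "1 = (2 / ?\<tau> * (?\<tau> / 2)) powr q" using \<tau> by simp
    also have "\<dots> \<le> (2 / ?\<tau> * x) powr q" using x \<tau> q by (intro powr_mono2 mult_left_mono) auto
    also have "\<dots> = (2 / ?\<tau>) powr q * x powr q" by (rule powr_mult)
    also have "\<dots> \<le> (2 / ?\<tau>) powr q * (?n l j powr q + ?y l j powr q)" using x by (intro mult_left_mono) auto
    finally show ?thesis using True by simp
  qed simp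
  have "tree_sum (\<lambda>l j. of_bool (control l j > ?\<tau>)) M 0 0 \<le> tree_sum (\<lambda>l j. (2 / ?\<tau>) powr q * (?n l j powr q + ?y l j powr q)) M 0 0"
    using bad by (intro tree_sum_mono) auto
  also have "\<dots> = (2 / ?\<tau>) powr q * (tree_sum (\<lambda>l j. ?n l j powr q) M 0 0 + tree_sum (\<lambda>l j. ?y l j powr q) M 0 0)"
    by (simp only: tree_sum_cmult tree_sum_add)
  also have "\<dots> \<le> (2 / ?\<tau>) powr q * (?n 0 0 powr q / (1 - 2 powr (1 - q)) + ?y 0 0 powr q / (1 - 2 powr (1 - \<alpha> / 2 * q - scale_exponent \<alpha> \<delta> * q)))"
  proof (intro mult_left_mono add_mono tree_sum_contraction)
    show "2 powr (1 - q) < (1::real)" using powr_less_mono[of "1 - q" 0 2] s\<^sub>0_bounds by (simp add: q_def)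
    show "2 powr (1 - \<alpha> / 2 * q - scale_exponent \<alpha> \<delta> * q) < (1::real)"
      using powr_less_mono[of "1 - \<alpha> / 2 * q - scale_exponent \<alpha> \<delta> * q" 0 2] bad_exponent by (simp add: q_def)
    show "?n (Suc l) (2 * j) powr q + ?n (Suc l) (Suc (2 * j)) powr q \<le> 2 powr (1 - q) * ?n l j powr q" for l j :: nat
    proof -
      have "?n (Suc l) i = 1 / 2 * ?n l j" for i by simp
      then have "?n (Suc l) i powr q = (1 / 2) powr q * ?n l j powr q" for i by (simp only: powr_mult)
      moreover have "2 * (1 / 2) powr q = (2 powr (1 - q) :: real)"
        by (simp add: powr_diff powr_divide)
      ultimately show ?thesis by (simp add: mult.assoc[symmetric])
    qed
    show "?y (Suc l) (2 * j) powr q + ?y (Suc l) (Suc (2 * j)) powr q \<le> 2 powr (1 - \<alpha> / 2 * q - scale_exponent \<alpha> \<delta> * q) * ?y l j powr q"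
      if "j < 2 ^ l" for l j
    proof (rule jump_control_powr_children[OF that])
      show "0 < \<alpha> / 2 * q" using \<alpha>_pos q by simp
      have "\<alpha> * q < 1 * 2" using \<alpha>_pos \<alpha>_less_1 q s\<^sub>0_bounds by (intro mult_strict_mono) (auto simp: q_def)
      then show "\<alpha> / 2 * q < 1" by simp
    qed
  qed auto
  also have "\<dots> \<le> (2 / ?\<tau>) powr q * ((1 / (1 - 2 powr (1 - q)) + 1 / (1 - 2 powr (1 - \<alpha> / 2 * q - scale_exponent \<alpha> \<delta> * q))) * (?n 0 0 powr q + ?y 0 0 powr q))"
  proof (intro mult_left_mono)
    have "x / a + y / b \<le> (1 / a + 1 / b) * (x + y)" if "x \<ge> 0" "y \<ge> 0" "a > 0" "b > 0" for x y a b :: real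
    proof -
      have "(1 / a + 1 / b) * (x + y) = (x / a + y / b) + (x / b + y / a)" by (simp add: algebra_simps add_divide_distrib)
      moreover have "0 \<le> x / b + y / a" using that by simp
      ultimately show ?thesis by linarith
    qed
    then show "?n 0 0 powr q / (1 - 2 powr (1 - q)) + ?y 0 0 powr q / (1 - 2 powr (1 - \<alpha> / 2 * q - scale_exponent \<alpha> \<delta> * q))
      \<le> (1 / (1 - 2 powr (1 - q)) + 1 / (1 - 2 powr (1 - \<alpha> / 2 * q - scale_exponent \<alpha> \<delta> * q))) * (?n 0 0 powr q + ?y 0 0 powr q)"
      using powr_less_mono[of "1 - q" 0 2] s\<^sub>0_bounds
        powr_less_mono[of "1 - \<alpha> / 2 * q - scale_exponent \<alpha> \<delta> * q" 0 2] bad_exponent by (auto simp: q_def)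
  qed simp
  also have "\<dots> = bad_const \<alpha> \<delta> q * ((T * N) powr q + ?y 0 0 powr q)"
    unfolding bad_const_def by (simp add: mult_ac)
  finally show ?thesis .
qed

lemma weighted_growth:
  assumes "mild_system W T N k R \<alpha> U \<gamma> node_energy" "t \<in> {0..T}" "finite F"
  shows "norm_on (\<lambda>n. of_real (weight \<alpha> L n) * fourier_coeff (U t) n) F
    \<le> 2 powr (1 + bad_const \<alpha> \<delta> (1 + s\<^sub>0) * ((T * N) powr (1 + s\<^sub>0) + jump_control 0 0 powr (1 + s\<^sub>0)))"
proof -
  interpret mild_system W T N k R \<alpha> L U \<gamma> node_energy by fact
  show ?thesis
  proof (rule sobolev_growth[where P = control and \<theta> = "contraction \<alpha> \<delta>"])
    show "N * (T / 2 ^ l) + (N * (T / 2 ^ l)) powr (1 - \<alpha>) * node_energy l j powr (\<alpha> / 2) \<le> control l j" for l j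
      unfolding control_def using jump_control_ge by simp
  qed (use contraction_bounds control_children bad_count assms in auto)
qed

text \<open>Since \<alpha> / 2 = \<delta> \<open>s\<^sub>0\<close>, the power \<alpha> / 2 of the
  total energy is the \<open>s\<^sub>0\<close>-th power of its power \<delta>. The inner bracket
  will be the value of \<open>U1\<close> at \<open>k\<close>; the powers of \<open>N\<close> and
  \<open>T\<close> match by the choice of \<open>scale_exponent\<close>.\<close>

lemma jump_control_root:
  "jump_control 0 0 = (T * N) powr (1 - s\<^sub>0) *
     ((N\<^sup>2 * T powr (1 + r)) powr (1 / 2 - \<delta>) * tail_energy 0 0 powr \<delta>) powr s\<^sub>0"
proof (cases "N = 0")
  case True
  show ?thesis unfolding jump_control_def by (simp add: True)
next
  case False
  then have N: "N > 0" using N_nonneg by simp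
  have "N\<^sup>2 = N powr 2" using N by simp
  then have "((N\<^sup>2 * T powr (1 + r)) powr (1 / 2 - \<delta>) * tail_energy 0 0 powr \<delta>) powr s\<^sub>0
    = (N powr (2 * (1 / 2 - \<delta>) * s\<^sub>0) * T powr ((1 + r) * (1 / 2 - \<delta>) * s\<^sub>0)) * tail_energy 0 0 powr (\<delta> * s\<^sub>0)"
    by (simp only: powr_mult powr_powr)
  then have "(T * N) powr (1 - s\<^sub>0) * ((N\<^sup>2 * T powr (1 + r)) powr (1 / 2 - \<delta>) * tail_energy 0 0 powr \<delta>) powr s\<^sub>0
    = (N powr (1 - s\<^sub>0) * N powr (2 * (1 / 2 - \<delta>) * s\<^sub>0)) * ((T powr (1 - s\<^sub>0) * T powr ((1 + r) * (1 / 2 - \<delta>) * s\<^sub>0)) * tail_energy 0 0 powr (\<delta> * s\<^sub>0))"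
    by (simp only: powr_mult mult_ac)
  also have "N powr (1 - s\<^sub>0) * N powr (2 * (1 / 2 - \<delta>) * s\<^sub>0) = N powr (1 - \<alpha>)"
    unfolding powr_add[symmetric] \<alpha>_eq by (rule arg_cong[of _ _ "\<lambda>x. N powr x"]) (simp add: algebra_simps)
  also have "T powr (1 - s\<^sub>0) * T powr ((1 + r) * (1 / 2 - \<delta>) * s\<^sub>0) = T powr scale_exponent \<alpha> \<delta>"
    unfolding powr_add[symmetric] scale_exponent_def \<alpha>_eq
    by (rule arg_cong[of _ _ "\<lambda>x. T powr x"]) (simp add: field_simps)
  also have "\<delta> * s\<^sub>0 = \<alpha> / 2" unfolding \<alpha>_eq by simp
  finally show ?thesis by (simp add: jump_control_def)
qed

end

section \<open>Powers of extended numbers, the norms and the logarithm\<close>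

lemma ennreal_powr_ennreal: "x \<ge> 0 \<Longrightarrow> ennreal_powr (ennreal x) a = ennreal (x powr a)"
  by (simp add: ennreal_powr_def)

lemma ennreal_powr_mono:
  assumes "x \<le> y" "a > 0" shows "ennreal_powr x a \<le> ennreal_powr y a"
proof (cases "y = \<infinity>")
  case False
  then have "y < \<top>" by (simp add: less_top)
  then have "enn2real x \<le> enn2real y" "x \<noteq> \<infinity>" using assms(1) by (auto intro: enn2real_mono)
  then show ?thesis using assms False by (auto simp: ennreal_powr_def intro!: ennreal_leI powr_mono2)
qed (simp add: ennreal_powr_def)

lemma ennreal_powr_measurable [measurable]:
  assumes [measurable]: "f \<in> borel_measurable M"
  shows "(\<lambda>x. ennreal_powr (f x) a) \<in> borel_measurable M"
  unfolding ennreal_powr_def by measurable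

lemma ennreal_powr_cmult:
  assumes "c \<ge> 0" "a > 0" "b > 0" "a * b = 1"
  shows "ennreal_powr (ennreal c * ennreal_powr x a) b = ennreal (c powr b) * x"
proof (cases "x = \<infinity>")
  case True
  show ?thesis
  proof (cases "c = 0")
    case False
    then show ?thesis using True assms by (simp add: ennreal_powr_def ennreal_mult_top)
  qed (simp add: ennreal_powr_def)
next
  case False
  then obtain y where y: "x = ennreal y" "y \<ge> 0" by (cases x) auto
  have "(c * y powr a) powr b = c powr b * y" using y assms by (simp add: powr_mult powr_powr)
  then show ?thesis
    using y assms by (simp add: ennreal_powr_ennreal flip: ennreal_mult)
qed

text \<open>The L^(1/\<delta>) norm of H^\<delta> is the \<delta>-th power of the integral of H, so
  it is at most (c1 S)^\<delta>; the prefactor S^(1/2 - \<delta>) completes this to the square root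
  of S.\<close>

lemma Lp_norm_root_le:
  fixes H :: "real \<Rightarrow> ennreal"
  assumes H: "H \<in> borel_measurable borel" "(\<integral>\<^sup>+k. H k \<partial>lborel) \<le> ennreal (c1 * S)"
    and "S \<ge> 0" "c1 \<ge> 0" and \<delta>: "0 < \<delta>" "\<delta> < 1 / 2"
  shows "Lp_norm (1 / \<delta>) (\<lambda>k. ennreal (S powr (1 / 2 - \<delta>)) * ennreal_powr (H k) \<delta>) \<le> ennreal (c1 powr \<delta> * sqrt S)"
proof -
  let ?c = "S powr (1 / 2 - \<delta>)"
  have "(\<integral>\<^sup>+k. ennreal_powr (ennreal ?c * ennreal_powr (H k) \<delta>) (1 / \<delta>) \<partial>lborel) = (\<integral>\<^sup>+k. ennreal (?c powr (1 / \<delta>)) * H k \<partial>lborel)"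
    using \<delta> by (intro nn_integral_cong ennreal_powr_cmult) auto
  also have "\<dots> = ennreal (?c powr (1 / \<delta>)) * (\<integral>\<^sup>+k. H k \<partial>lborel)"
    using H(1) by (intro nn_integral_cmult) auto
  also have "\<dots> \<le> ennreal (?c powr (1 / \<delta>)) * ennreal (c1 * S)" by (intro mult_left_mono H) auto
  also have "\<dots> = ennreal (?c powr (1 / \<delta>) * (c1 * S))" using assms by (intro ennreal_mult[symmetric]) auto
  finally have "Lp_norm (1 / \<delta>) (\<lambda>k. ennreal ?c * ennreal_powr (H k) \<delta>) \<le> ennreal_powr (ennreal (?c powr (1 / \<delta>) * (c1 * S))) \<delta>"
    unfolding Lp_norm_def using \<delta> by (simp add: ennreal_powr_mono)
  also have "\<dots> = ennreal ((?c powr (1 / \<delta>) * (c1 * S)) powr \<delta>)" using assms by (intro ennreal_powr_ennreal) auto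
  also have "(?c powr (1 / \<delta>) * (c1 * S)) powr \<delta> = c1 powr \<delta> * (?c * S powr \<delta>)"
    using \<delta> by (simp add: powr_mult powr_powr mult_ac)
  also have "?c * S powr \<delta> = sqrt S"
    using assms(3) by (simp add: powr_half_sqrt flip: powr_add)
  finally show ?thesis .
qed

text \<open>For a finite set of frequencies choose \<open>L\<close> so large that none of them is
  capped; then the weight dominates (1 + |n|)^\<alpha>.\<close>

lemma sobolev_norm_le:
  assumes \<alpha>: "\<alpha> > 0" and "B \<ge> 0"
    and "\<And>L F. finite F \<Longrightarrow> norm_on (\<lambda>n. of_real (weight \<alpha> L n) * fourier_coeff f n) F \<le> B"
  shows "sobolev_norm \<alpha> f \<le> ennreal B"
proof -
  have "(\<Sum>\<^sub>\<infinity>n\<in>UNIV. ennreal ((1 + \<bar>real_of_int n\<bar>) powr (2 * \<alpha>) * (cmod (fourier_coeff f n))\<^sup>2)) \<le> ennreal (B\<^sup>2)"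
  proof (subst nonneg_infsum_complete, simp, rule SUP_least)
    fix F :: "int set" assume "F \<in> {F. finite F \<and> F \<subseteq> UNIV}"
    then have F: "finite F" by simp
    define L where "L = Max (insert 0 (log_size ` F))"
    have wt: "(1 + \<bar>real_of_int n\<bar>) powr (2 * \<alpha>) \<le> (weight \<alpha> L n)\<^sup>2" if "n \<in> F" for n
    proof -
      have b: "block L n = log_size n" using that F by (simp add: block_def L_def)
      have "1 + \<bar>n\<bar> \<le> 2 ^ log_size n" using abs_less_log_size[of n] by simp
      then have "real_of_int (1 + \<bar>n\<bar>) \<le> real_of_int (2 ^ log_size n)" by (simp only: of_int_le_iff)
      then have "1 + \<bar>real_of_int n\<bar> \<le> 2 powr real (log_size n)" by (simp add: powr_realpow)
      then have "(1 + \<bar>real_of_int n\<bar>) powr (2 * \<alpha>) \<le> (2 powr real (log_size n)) powr (2 * \<alpha>)"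
        using \<alpha> by (intro powr_mono2) auto
      also have "\<dots> = (weight \<alpha> L n)\<^sup>2"
        by (simp add: weight_def b powr_powr power2_eq_square algebra_simps flip: powr_add)
      finally show ?thesis .
    qed
    have "(\<Sum>n\<in>F. ennreal ((1 + \<bar>real_of_int n\<bar>) powr (2 * \<alpha>) * (cmod (fourier_coeff f n))\<^sup>2))
      = ennreal (\<Sum>n\<in>F. (1 + \<bar>real_of_int n\<bar>) powr (2 * \<alpha>) * (cmod (fourier_coeff f n))\<^sup>2)"
      by (rule sum_ennreal) simp
    also have "\<dots> \<le> ennreal (\<Sum>n\<in>F. (cmod (of_real (weight \<alpha> L n) * fourier_coeff f n))\<^sup>2)"
      using wt by (intro ennreal_leI sum_mono) (simp add: norm_mult power_mult_distrib mult_right_mono)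
    also have "\<dots> \<le> ennreal (B\<^sup>2)"
      using assms(3)[OF F, of L] by (intro ennreal_leI) (simp add: L2_set_def sqrt_le_D)
    finally show "(\<Sum>n\<in>F. ennreal ((1 + \<bar>real_of_int n\<bar>) powr (2 * \<alpha>) * (cmod (fourier_coeff f n))\<^sup>2)) \<le> ennreal (B\<^sup>2)" .
  qed
  then have "sobolev_norm \<alpha> f \<le> ennreal_powr (ennreal (B\<^sup>2)) (1 / 2)"
    unfolding sobolev_norm_def by (rule ennreal_powr_mono) simp
  also have "\<dots> = ennreal B" using assms(2) by (simp add: ennreal_powr_ennreal powr_half_sqrt)
  finally show ?thesis .
qed

lemma log1p_le:
  assumes "x \<le> ennreal (2 powr (1 + b))" "b \<ge> 0"
  shows "log1p x \<le> ennreal (2 + b)"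
proof -
  have "x \<noteq> \<infinity>" using assms(1) by (auto simp: top_unique)
  then obtain y where y: "x = ennreal y" "y \<ge> 0" by (cases x) auto
  have "y \<le> 2 powr (1 + b)" using assms(1) y by (simp add: ennreal_le_iff)
  moreover have "1 \<le> 2 powr (1 + b)" using assms(2) by (intro ge_one_powr_ge_zero) auto
  moreover have "2 powr (2 + b) = 2 powr (1 + (1 + b))" by (simp add: add.assoc[symmetric])
  then have "2 powr (2 + b) = 2 * 2 powr (1 + b)" by (simp add: powr_add)
  ultimately have "1 + y \<le> 2 powr (2 + b)" by linarith
  then have "ln (1 + y) \<le> ln (2 powr (2 + b))"
    using y by (subst ln_le_cancel_iff) simp_all
  also have "\<dots> = (2 + b) * ln 2" by (simp add: ln_powr)
  also have "\<dots> \<le> (2 + b) * 1" using assms(2) ln_le_minus_one[of 2] by (intro mult_left_mono) auto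
  finally show ?thesis using y by (simp add: log1p_def ennreal_leI)
qed

context potential
begin

text \<open>Excludes the product 0 * \<infinity> = 0 on the right-hand side of the theorem at those
  \<open>k\<close> where the total energy is infinite.\<close>

lemma total_energy_zero:
  assumes "N = 0" shows "total_energy r l j k = 0"
proof -
  have "vhat n s = 0" for n s using vhat_le[of n s] assms by simp
  then have "osc n m a b k = 0" for n m a b by (simp add: osc_def)
  then have "energy_term n m a b k = 0" for n m a b by (simp add: energy_term_def)
  then have "energy a b k = 0" for a b by (simp add: energy_def)
  then show ?thesis by (simp add: total_energy_def scaled_energy_def)
qed

end

theorem theorem3p2:
  fixes \<alpha> p p' s\<^sub>0 :: real
  assumes "0 < \<alpha>" "\<alpha> < 1" "4 / 3 < p" "p < 2" "\<alpha> * p < 2 * (p - 1)"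
    and "1 / p + 1 / p' = 1"
    and "s\<^sub>0 = \<alpha> * p' / 2"
  shows "\<exists>C > 0. \<forall>(T :: real) (V :: real \<times> real \<Rightarrow> complex) (u :: real \<Rightarrow> real \<Rightarrow> real \<Rightarrow> complex) (N :: real).
    T > 0 \<longrightarrow> V \<in> Linf T \<longrightarrow> N = enn2real (Linf_norm T V) \<longrightarrow>
    (\<forall>k. mild_solution T k V (\<lambda>x. 1) (\<lambda>x t. u x t k)) \<longrightarrow>
    (\<exists>U\<^sub>1 :: real \<Rightarrow> ennreal. U\<^sub>1 \<in> borel_measurable borel \<and>
       Lp_norm p' U\<^sub>1 \<le> ennreal (C * T powr (1 - 1 / p') * N) \<and>
       (\<forall>k. (SUP t \<in> {0<..<T}. log1p (sobolev_norm \<alpha> (\<lambda>x. u x t k)))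
          \<le> ennreal C * (1 + ennreal ((T * N) powr (1 + s\<^sub>0))
               + ennreal ((T * N) powr (1 - s\<^sub>0\<^sup>2)) * ennreal_powr (U\<^sub>1 k) (s\<^sub>0 * (1 + s\<^sub>0)))))"
proof -
  define \<delta> where "\<delta> = 1 / p'"
  have \<delta>_eq: "\<delta> = 1 - 1 / p" using assms(6) by (simp add: \<delta>_def)
  have p: "p > 0" using assms by simp
  have \<delta>: "0 < \<delta>" "\<delta> < 1 / 2" unfolding \<delta>_eq using assms by (simp_all add: field_simps)
  have p': "p' = 1 / \<delta>" by (simp add: \<delta>_def)
  have \<alpha>\<delta>: "\<alpha> < 2 * \<delta>" unfolding \<delta>_eq using assms p by (simp add: field_simps)
  interpret exponents \<alpha> \<delta> s\<^sub>0
    by unfold_locales (use assms(1,7) \<delta> \<alpha>\<delta> p' in \<open>auto simp: field_simps\<close>)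
  let ?r = "1 - 2 * \<delta>" and ?q = "1 + s\<^sub>0"
  define C1 where "C1 = 9 * zeta / (1 - 2 powr - ?r)"
  define Cb where "Cb = bad_const \<alpha> \<delta> ?q"
  \<comment> \<open>The three summands serve the constant term of the logarithm, the count of bad
    intervals and the norm of \<open>U1\<close>.\<close>
  define C where "C = 2 + Cb + C1 powr \<delta>"
  have C1: "C1 \<ge> 0"
    unfolding C1_def using zeta_nonneg \<delta> powr_less_mono[of "- ?r" 0 2] by simp
  have Cb: "Cb \<ge> 0" unfolding Cb_def by (rule bad_const_nonneg)
  have C: "C > 0" "C \<ge> 2" "C \<ge> Cb" "C \<ge> C1 powr \<delta>" using Cb by (auto simp: C_def add_pos_nonneg)
  show ?thesis
  proof (intro exI[of _ C] conjI C(1) allI impI)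
    fix T N :: real and V u
    assume T: "T > 0" and V: "V \<in> Linf T" and N: "N = enn2real (Linf_norm T V)"
      and u: "\<forall>k. mild_solution T k V (\<lambda>x. 1) (\<lambda>x t. u x t k)"
    let ?W = "truncation T N V"
    have N0: "N \<ge> 0" by (simp add: N)
    interpret potential ?W T N
      using truncation_measurable[of V T N] truncation_le[OF N0] T V by unfold_locales (auto simp: Linf_def)
    let ?H = "total_energy ?r 0 0"
    define S where "S = N\<^sup>2 * T powr (1 + ?r)"
    define U1 where "U1 k = ennreal (S powr (1 / 2 - \<delta>)) * ennreal_powr (?H k) \<delta>" for k
    have S: "S \<ge> 0" by (simp add: S_def)
    have sqrtS: "sqrt S = T powr (1 - 1 / p') * N"
    proof -
      have "(1 + ?r) / 2 = 1 - 1 / p'" by (simp add: p')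
      moreover have "sqrt (T powr (1 + ?r)) = T powr ((1 + ?r) / 2)"
        by (simp add: powr_half_sqrt[symmetric] powr_powr)
      ultimately have "sqrt (T powr (1 + ?r)) = T powr (1 - 1 / p')" by (simp only:)
      then show ?thesis
        unfolding S_def real_sqrt_mult real_sqrt_abs using N0 by (simp only: abs_of_nonneg mult.commute)
    qed
    have m: "U1 \<in> borel_measurable borel" unfolding U1_def by measurable
    have "Lp_norm p' U1 \<le> ennreal (C1 powr \<delta> * sqrt S)"
      unfolding p' U1_def
      by (rule Lp_norm_root_le) (use nn_integral_total_energy[of ?r] \<delta> C1 S in \<open>simp_all add: C1_def S_def\<close>)
    also have "\<dots> \<le> ennreal (C * T powr (1 - 1 / p') * N)"
      unfolding sqrtS mult.assoc using C N0 by (intro ennreal_leI mult_right_mono) auto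
    finally have Lp: "Lp_norm p' U1 \<le> ennreal (C * T powr (1 - 1 / p') * N)" .
    have bound: "(SUP t \<in> {0<..<T}. log1p (sobolev_norm \<alpha> (\<lambda>x. u x t k)))
          \<le> ennreal C * (1 + ennreal ((T * N) powr ?q)
               + ennreal ((T * N) powr (1 - s\<^sub>0\<^sup>2)) * ennreal_powr (U1 k) (s\<^sub>0 * ?q))" (is "?L \<le> ?R") for k
    \<comment> \<open>Where H is infinite the right-hand side is infinite and the estimate is
      trivial; elsewhere the total energies of all nodes are finite real numbers.\<close>
    proof (cases "?H k = \<infinity>")
      case True
      then have "N \<noteq> 0" using total_energy_zero[of ?r 0 0 k] by auto
      then have "S powr (1 / 2 - \<delta>) > 0" "(T * N) powr (1 - s\<^sub>0\<^sup>2) > 0" using T by (auto simp: S_def)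
      then have "?R = \<infinity>"
        using True C(1) by (simp add: U1_def ennreal_powr_def ennreal_mult_top)
      then show ?thesis by simp
    next
      case False
      then interpret E: potential_exponents ?W T N \<alpha> \<delta> s\<^sub>0 k
        by unfold_locales (simp add: less_top)
      have sol: "mild_solution T k V (\<lambda>x. 1) (\<lambda>x t. u x t k)" using u by simp
      obtain R where R: "\<And>t. t \<in> {0..T} \<Longrightarrow> L2_norm (\<lambda>x. u x t k) \<le> R"
        using mild_solution_bounded[OF sol T] by auto
      obtain \<gamma> where \<gamma>: "\<And>n. set_integrable lborel {0..T} (\<gamma> n)"
        "AE s in lborel. s \<in> {0..T} \<longrightarrow> (\<forall>n. \<gamma> n s = cis (- (k * (real_of_int n)\<^sup>2 * s)) * fourier_coeff (\<lambda>x. ?W (x, s) * u x s k) n)"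
        "\<And>t n. t \<in> {0..T} \<Longrightarrow> cis (- (k * (real_of_int n)\<^sup>2 * t)) * fourier_coeff (\<lambda>x. u x t k) n = of_bool (n = 0) - \<i> * (LINT s:{0..<t}|lborel. \<gamma> n s)"
        using mild_solution_fourier[OF sol T V N] by blast
      have sys: "mild_system ?W T N k R \<alpha> (\<lambda>t x. u x t k) \<gamma> E.node_energy"
        using sol R \<gamma> \<alpha>_pos \<alpha>_less_1 E.energy_finite(1) E.node_energy_nonneg
        by unfold_locales (auto simp: mild_solution_def)
      define u1 where "u1 = S powr (1 / 2 - \<delta>) * E.tail_energy 0 0 powr \<delta>"
      have u1: "u1 \<ge> 0" "U1 k = ennreal u1"
        using False by (auto simp: u1_def U1_def E.tail_energy_def ennreal_powr_def ennreal_mult)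
      have Z: "E.jump_control 0 0 powr ?q = (T * N) powr (1 - s\<^sub>0\<^sup>2) * u1 powr (s\<^sub>0 * ?q)"
      proof -
        have "E.jump_control 0 0 powr ?q = (T * N) powr ((1 - s\<^sub>0) * ?q) * u1 powr (s\<^sub>0 * ?q)"
          unfolding E.jump_control_root u1_def S_def by (simp only: powr_mult powr_powr mult_ac)
        also have "(1 - s\<^sub>0) * ?q = 1 - s\<^sub>0\<^sup>2" by (simp add: power2_eq_square algebra_simps)
        finally show ?thesis .
      qed
      define b where "b = Cb * ((T * N) powr ?q + E.jump_control 0 0 powr ?q)"
      have b: "b \<ge> 0" using Cb by (simp add: b_def)
      have "log1p (sobolev_norm \<alpha> (\<lambda>x. u x t k)) \<le> ennreal (2 + b)" if "t \<in> {0<..<T}" for t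
      proof (intro log1p_le sobolev_norm_le \<alpha>_pos b)
        fix L and F :: "int set" assume "finite F"
        then show "norm_on (\<lambda>n. of_real (weight \<alpha> L n) * fourier_coeff (\<lambda>x. u x t k) n) F \<le> 2 powr (1 + b)"
          unfolding b_def Cb_def using E.weighted_growth[OF sys, of t F L] that by simp
      qed simp
      then have "?L \<le> ennreal (2 + b)" by (rule SUP_least)
      also have "2 + b \<le> C * (1 + (T * N) powr ?q + (T * N) powr (1 - s\<^sub>0\<^sup>2) * u1 powr (s\<^sub>0 * ?q))"
      proof -
        have "b \<le> C * ((T * N) powr ?q + E.jump_control 0 0 powr ?q)"
          unfolding b_def using C by (intro mult_right_mono) auto
        then show ?thesis unfolding Z using C by (simp add: distrib_left)
      qed
      also have "ennreal (C * (1 + (T * N) powr ?q + (T * N) powr (1 - s\<^sub>0\<^sup>2) * u1 powr (s\<^sub>0 * ?q))) = ?R"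
      proof -
        have "ennreal (c * (1 + x + y * z)) = ennreal c * (1 + ennreal x + ennreal y * ennreal z)"
          if "c \<ge> 0" "x \<ge> 0" "y \<ge> 0" "z \<ge> 0" for c x y z
          using that by (simp add: ennreal_mult)
        then show ?thesis using C(1) u1 by (simp add: ennreal_powr_ennreal)
      qed
      finally show ?thesis by (simp add: ennreal_leI)
    qed
    show "\<exists>U\<^sub>1 :: real \<Rightarrow> ennreal. U\<^sub>1 \<in> borel_measurable borel \<and>
       Lp_norm p' U\<^sub>1 \<le> ennreal (C * T powr (1 - 1 / p') * N) \<and>
       (\<forall>k. (SUP t \<in> {0<..<T}. log1p (sobolev_norm \<alpha> (\<lambda>x. u x t k)))
          \<le> ennreal C * (1 + ennreal ((T * N) powr (1 + s\<^sub>0))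
               + ennreal ((T * N) powr (1 - s\<^sub>0\<^sup>2)) * ennreal_powr (U\<^sub>1 k) (s\<^sub>0 * (1 + s\<^sub>0))))"
      using m Lp bound by blast
  qed
qed

end
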